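(* For every fixed integer $d\geq 1$, $$\lim_{\beta\uparrow 2} C_{\mathrm{LY}}(\beta,d)=\frac d2 .$$ More precisely, for every fixed integer $d\ge 1$ there exists a constant $K_d>0$, depending only on $d$, such that for every $1\leq\beta<2$, $$\frac d\beta< C_{\mathrm{LY}}(\beta,d)\leq\frac d\beta+K_d(2-\beta)\log\frac{e}{2-\beta}.$$
   Context: Let $d\ge 1$ be an integer and $\beta\in(0,2)$. $|\cdot|$ is the Euclidean norm on $\mathbb{R}^d$ and $\Gamma$ is the Gamma function. Put $$c_{\beta,d}=\frac{2^\beta\,\Gamma((d+\beta)/2)}{\pi^{d/2}\,|\Gamma(-\beta/2)|}.$$ Let $G^{(\beta)}(t,x)$, $t>0$, $x\in\mathbb{R}^d$, be the fractional heat kernel of $(-\Delta)^{\beta/2}$, i.e. the function with Fourier transform $\widehat{G^{(\beta)}(t,\cdot)}(\xi)=e^{-t|\xi|^\beta}$, where $\widehat f(\xi)=\int_{\mathbb{R}^d}f(x)e^{-i\langle x,\xi\rangle}\,dx$; it is positive, smooth, radial in $x$, and has integral $1$ in $x$. Put $\Phi_\beta(x)=G^{(\beta)}(1,x)$. The optimal Li--Yau constant of Weber and Zacher is $$C_{\mathrm{LY}}(\beta,d)=\frac{c_{\beta,d}}{2}\sup_{y\in\mathbb{R}^d}\int_{\mathbb{R}^d}\frac{1}{|\sigma|^{d+\beta}}\log\frac{\Phi_\beta(y)^2}{\Phi_\beta(y+\sigma)\Phi_\beta(y-\sigma)}\,d\sigma .$$ *)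

theory Defs
  imports "HOL-Analysis.Analysis"
begin

definition fourier_transform :: "(real ^ 'n \<Rightarrow> real) \<Rightarrow> real ^ 'n \<Rightarrow> complex" where
  "fourier_transform f \<xi> =
     (\<integral>x. complex_of_real (f x) * exp (- \<i> * complex_of_real (x \<bullet> \<xi>)) \<partial>lborel)"

text \<open>The Fourier transform determines an integrable function only up to null sets; continuity
  (the kernel is in fact smooth) selects the pointwise representative. Positivity, radial symmetry
  and total mass \<open>1\<close> are consequences and not part of the definition.\<close>

definition fractional_heat_kernel :: "real \<Rightarrow> real \<Rightarrow> real ^ 'n \<Rightarrow> real" where
  "fractional_heat_kernel \<beta> t =
     (THE g. continuous_on UNIV g \<and> integrable lborel g \<and>
        (\<forall>\<xi>. fourier_transform g \<xi> = complex_of_real (exp (- t * norm \<xi> powr \<beta>))))"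

definition heat_profile :: "real \<Rightarrow> real ^ 'n \<Rightarrow> real" where
  "heat_profile \<beta> x = fractional_heat_kernel \<beta> 1 x"

definition frac_laplace_const :: "real \<Rightarrow> nat \<Rightarrow> real" where
  "frac_laplace_const \<beta> d =
     2 powr \<beta> * Gamma ((real d + \<beta>) / 2) / (pi powr (real d / 2) * \<bar>Gamma (- \<beta> / 2)\<bar>)"

text \<open>The supremum is taken in \<^typ>\<open>ereal\<close>, so that an upper bound on the constant includes its
  finiteness (the supremum of an unbounded set of reals would be unspecified).
  The dimension is \<open>CARD('n)\<close>.\<close>

definition li_yau_const :: "'n::finite itself \<Rightarrow> real \<Rightarrow> ereal" where
  "li_yau_const _ \<beta> =
     ereal (frac_laplace_const \<beta> CARD('n) / 2) *
     (SUP y :: real ^ 'n. ereal (\<integral>\<sigma>.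
        1 / norm \<sigma> powr (real CARD('n) + \<beta>) *
        ln ((heat_profile \<beta> y)\<^sup>2 / (heat_profile \<beta> (y + \<sigma>) * heat_profile \<beta> (y - \<sigma>))) \<partial>lborel))"

end

theory Submission
  imports Defs "HOL-Probability.Characteristic_Functions" "HOL-Real_Asymp.Real_Asymp"
begin

text \<open>Write \<open>\<Phi>\<close> for the heat profile and \<open>d\<close> for the dimension. The quantity under the supremum is, up to the
factor \<open>c/2\<close>, the fractional Laplacian of \<open>log \<Phi>\<close> at \<open>y\<close>. Two ideas determine it.

\<^bold>\<open>The supremum is attained at the origin.\<close> For \<open>\<beta> < 2\<close> the profile is a positive mixture of centred Gaussians
(subordination), so \<open>\<Phi>(x) = exp (l(|x|^2))\<close> with \<open>l\<close> convex and decreasing. The parallelogram law and convexity give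
\<open>l(|y+\<sigma>|^2) + l(|y-\<sigma>|^2) \<ge> 2 l(|y|^2 + |\<sigma>|^2)\<close>, and a convex decreasing function loses most near \<open>0\<close>, so
\<open>l(|y|^2) - l(|y|^2 + |\<sigma>|^2) \<le> l(0) - l(|\<sigma>|^2)\<close>. Hence the integrand at \<open>y\<close> is bounded, pointwise in \<open>\<sigma>\<close>, by the
integrand at \<open>0\<close> (\<open>stable_density_log_ratio_le\<close>). The mixing measure is never constructed. Instead
\<open>gaussian_positivity_transfer\<close> shows that \<open>exp (-|\<xi>|^\<beta>)\<close> inherits positivity from all Gaussians, because it is a limit
of compound Poisson exponentials. Consequently every linear inequality between point values that holds for all centred
Gaussians holds for \<open>\<Phi>\<close> (\<open>stable_density_combination\<close>); log-convexity is such a family of inequalities, since \<open>f\<close> is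
log-convex iff \<open>exp (c s) f(s)\<close> is convex for every \<open>c\<close>.

\<^bold>\<open>The value at the origin.\<close> With \<open>r(\<sigma>) = \<Phi>(\<sigma>)/\<Phi>(0)\<close> split \<open>- ln r = (1 - r) + (- ln r - 1 + r)\<close>. The first part
integrates to exactly \<open>d/\<beta>\<close>: the fractional Laplacian has symbol \<open>|\<xi>|^\<beta>\<close>, and
\<open>\<integral> |\<xi>|^\<beta> exp (-|\<xi>|^\<beta>) = (d/\<beta>) \<integral> exp (-|\<xi>|^\<beta>)\<close> (\<open>frac_laplace_stable_density_origin\<close>). The second part is
nonnegative and not identically zero, which is the strict lower bound. For the upper bound the constant \<open>c\<close> is
\<open>O(2 - \<beta>)\<close>, so it suffices that the integral of the second part is \<open>O(log (e/(2 - \<beta>)))\<close>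
(\<open>stable_density_log_defect\<close>). Near the origin log-convexity gives \<open>- ln r \<le> A |\<sigma>|^2\<close> with \<open>A\<close> independent of \<open>\<beta>\<close>, so
the second part is \<open>O(|\<sigma>|^4)\<close>. Away from the origin only \<open>log \<Phi>\<close> matters, so any lower bound for \<open>\<Phi>\<close> that is
polynomial in \<open>2 - \<beta>\<close> and in \<open>1/|\<sigma>|\<close> is enough (\<open>stable_density_tail_ge\<close>).

The kernel is specified only through its Fourier transform. Fourier inversion, proved by Gaussian regularisation, yields
both the existence and the uniqueness of such a function (\<open>heat_profile_eq_stable_density\<close>).\<close>

section \<open>Fourier transform of Gaussians\<close>

abbreviation gaussian :: "real \<Rightarrow> 'a::real_normed_vector \<Rightarrow> real" where
  "gaussian a x \<equiv> exp (- a * (norm x)\<^sup>2)"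

lemma measurable_cis [measurable]: "cis \<in> borel_measurable borel"
  by (intro borel_measurable_continuous_onI continuous_intros)

lemma gaussian_fourier_real:
  fixes a t :: real
  assumes a: "a > 0"
  shows "integrable lborel (\<lambda>x. complex_of_real (exp (- a * x\<^sup>2)) * cis (t * x))"
    and "(\<integral>x. complex_of_real (exp (- a * x\<^sup>2)) * cis (t * x) \<partial>lborel)
      = of_real (sqrt (pi / a) * exp (- t\<^sup>2 / (4 * a)))"
proof -
  define s where "s = t / sqrt (2 * a)"
  define f where "f = (\<lambda>x. std_normal_density x *\<^sub>R cis (s * x))"
  have f_int: "integrable lborel f"
    unfolding f_def by (rule Bochner_Integration.integrable_bound[OF integrable_normal_density[of 1 0]])
      (auto simp: norm_mult)
  have char: "(\<integral>x. f x \<partial>lborel) = exp (- (s\<^sup>2) / 2)"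
  proof -
    have "char std_normal_distribution s = (\<integral>x. f x \<partial>lborel)"
      unfolding char_def f_def
      by (subst integral_density) (auto simp: cis_conv_exp mult.commute)
    then show ?thesis by (simp add: char_std_normal_distribution)
  qed
  have sc: "sqrt (2 * a) \<noteq> 0" using a by simp
  have eq: "f (0 + sqrt (2 * a) * x) = of_real (1 / sqrt (2 * pi)) * (complex_of_real (exp (- a * x\<^sup>2)) * cis (t * x))" for x
    using a by (simp add: f_def s_def std_normal_density_def power_mult_distrib scaleR_conv_of_real mult_ac)
  have "integrable lborel (\<lambda>x. f (0 + sqrt (2 * a) * x))"
    using lborel_integrable_real_affine_iff[OF sc, of f 0] f_int by simp
  then have i1: "integrable lborel (\<lambda>x. of_real (1 / sqrt (2 * pi)) * (complex_of_real (exp (- a * x\<^sup>2)) * cis (t * x)))"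
    by (simp only: eq)
  have k: "complex_of_real (sqrt (2 * pi)) * of_real (1 / sqrt (2 * pi)) = 1"
    by (simp flip: of_real_mult)
  show "integrable lborel (\<lambda>x. complex_of_real (exp (- a * x\<^sup>2)) * cis (t * x))"
    using integrable_mult_right[OF i1, of "of_real (sqrt (2 * pi))"] unfolding mult.assoc[symmetric] k mult_1_left .
  have "(\<integral>x. f x \<partial>lborel) = sqrt (2 * a) *\<^sub>R (\<integral>x. f (0 + sqrt (2 * a) * x) \<partial>lborel)"
    using lborel_integral_real_affine[OF sc, of f 0] a by simp
  also have "\<dots> = of_real (sqrt (2 * a) / sqrt (2 * pi)) * (\<integral>x. complex_of_real (exp (- a * x\<^sup>2)) * cis (t * x) \<partial>lborel)"
    unfolding eq by (simp add: scaleR_conv_of_real)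
  finally have *: "(\<integral>x. f x \<partial>lborel) = of_real (sqrt (2 * a) / sqrt (2 * pi)) * (\<integral>x. complex_of_real (exp (- a * x\<^sup>2)) * cis (t * x) \<partial>lborel)" .
  have "sqrt (2 * a) / sqrt (2 * pi) * (sqrt (pi / a) * exp (- t\<^sup>2 / (4 * a))) = exp (- (s\<^sup>2) / 2)"
    using a by (simp add: s_def power_divide real_sqrt_divide real_sqrt_mult field_simps)
  then have "of_real (sqrt (2 * a) / sqrt (2 * pi)) * complex_of_real (sqrt (pi / a) * exp (- t\<^sup>2 / (4 * a))) = of_real (exp (- (s\<^sup>2) / 2))"
    by (metis of_real_mult)
  also have "\<dots> = of_real (sqrt (2 * a) / sqrt (2 * pi)) * (\<integral>x. complex_of_real (exp (- a * x\<^sup>2)) * cis (t * x) \<partial>lborel)"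
    using char * by (simp add: exp_of_real)
  finally show "(\<integral>x. complex_of_real (exp (- a * x\<^sup>2)) * cis (t * x) \<partial>lborel)
      = of_real (sqrt (pi / a) * exp (- t\<^sup>2 / (4 * a)))"
    using a by (subst (asm) mult_cancel_left) auto
qed

text \<open>The Gaussian and the character both factor over the coordinates, so this reduces to the one-dimensional
characteristic function by integrating over the product measure that defines \<open>lborel\<close>.\<close>

lemma gaussian_fourier:
  fixes \<xi> :: "'a::euclidean_space"
  assumes a: "a > 0"
  shows "integrable lborel (\<lambda>x. complex_of_real (gaussian a x) * cis (x \<bullet> \<xi>))"
    and "(\<integral>x. complex_of_real (gaussian a x) * cis (x \<bullet> \<xi>) \<partial>lborel)
      = of_real (sqrt (pi / a) ^ DIM('a) * exp (- (norm \<xi>)\<^sup>2 / (4 * a)))"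
proof -
  interpret product_sigma_finite "\<lambda>b::'a. lborel :: real measure" by standard
  let ?T = "\<lambda>f. \<Sum>b\<in>Basis. f b *\<^sub>R (b::'a)"
  let ?g = "\<lambda>x::'a. complex_of_real (gaussian a x) * cis (x \<bullet> \<xi>)"
  let ?h = "\<lambda>b x. complex_of_real (exp (- a * x\<^sup>2)) * cis ((\<xi> \<bullet> b) * x)"
  have inner_T: "?T f \<bullet> b = f b" if "b \<in> Basis" for f b
    using that by (simp add: inner_sum_left inner_Basis if_distrib sum.delta cong: if_cong)
  have cis_sum: "cis (sum f A) = (\<Prod>b\<in>A. cis (f b))" if "finite A" for f :: "'a \<Rightarrow> real" and A
    using that by induction (simp_all add: cis_mult[symmetric])
  have g_T: "?g (?T f) = (\<Prod>b\<in>Basis. ?h b (f b))" for f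
  proof -
    have "(norm (?T f))\<^sup>2 = (\<Sum>b\<in>Basis. (f b)\<^sup>2)"
      unfolding power2_norm_eq_inner
      by (subst euclidean_inner) (auto intro!: sum.cong simp: inner_T power2_eq_square)
    moreover have "?T f \<bullet> \<xi> = (\<Sum>b\<in>Basis. (\<xi> \<bullet> b) * f b)"
      by (subst euclidean_inner) (auto intro!: sum.cong simp: inner_T)
    ultimately show ?thesis
      by (simp add: sum_distrib_left sum_negf[symmetric] exp_sum cis_sum prod.distrib del: of_real_exp)
  qed
  have meas: "?T \<in> measurable (Pi\<^sub>M Basis (\<lambda>b. lborel)) borel" by measurable
  have gm: "?g \<in> borel_measurable borel" by measurable
  show "integrable lborel ?g"
    by (subst lborel_eq, subst integrable_distr_eq[OF meas gm], unfold g_T)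
       (intro product_integrable_prod gaussian_fourier_real[OF a] finite_Basis)
  have "integral\<^sup>L lborel ?g = (\<integral>f. (\<Prod>b\<in>Basis. ?h b (f b)) \<partial>Pi\<^sub>M Basis (\<lambda>b. lborel))"
    by (subst lborel_eq, subst integral_distr[OF meas gm], unfold g_T) simp
  also have "\<dots> = (\<Prod>b\<in>Basis. integral\<^sup>L lborel (?h b))"
    by (intro product_integral_prod gaussian_fourier_real[OF a] finite_Basis)
  also have "\<dots> = (\<Prod>b\<in>Basis. of_real (sqrt (pi / a) * exp (- (\<xi> \<bullet> b)\<^sup>2 / (4 * a))))"
    by (intro prod.cong refl gaussian_fourier_real[OF a])
  also have "\<dots> = of_real (sqrt (pi / a) ^ DIM('a) * exp (\<Sum>b\<in>Basis. - (\<xi> \<bullet> b)\<^sup>2 / (4 * a)))"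
    by (simp add: prod.distrib exp_sum of_real_prod)
  also have "(\<Sum>b\<in>Basis. - (\<xi> \<bullet> b)\<^sup>2 / (4 * a)) = - (norm \<xi>)\<^sup>2 / (4 * a)"
    unfolding power2_norm_eq_inner
    by (subst euclidean_inner[of \<xi>]) (simp add: sum_divide_distrib sum_negf power2_eq_square)
  finally show "integral\<^sup>L lborel ?g = of_real (sqrt (pi / a) ^ DIM('a) * exp (- (norm \<xi>)\<^sup>2 / (4 * a)))" .
qed

lemma gaussian_integral:
  assumes a: "a > 0"
  shows "integrable lborel (\<lambda>x::'a::euclidean_space. gaussian a x)"
    and "(\<integral>x. gaussian a (x::'a) \<partial>lborel) = sqrt (pi / a) ^ DIM('a)"
proof -
  have i: "integrable lborel (\<lambda>x::'a. complex_of_real (gaussian a x))"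
    using gaussian_fourier(1)[OF a, of "0::'a"] by simp
  then show *: "integrable lborel (\<lambda>x::'a::euclidean_space. gaussian a x)"
    using integrable_Re[OF i] by (simp del: of_real_exp)
  have "complex_of_real (\<integral>x. gaussian a (x::'a) \<partial>lborel) = of_real (sqrt (pi / a) ^ DIM('a))"
    using gaussian_fourier(2)[OF a, of "0::'a"] by (simp del: of_real_exp)
  then show "(\<integral>x. gaussian a (x::'a) \<partial>lborel) = sqrt (pi / a) ^ DIM('a)"
    using of_real_eq_iff by blast
qed

lemma gaussian_cos_integral:
  fixes \<xi> :: "'a::euclidean_space"
  assumes a: "a > 0"
  shows "integrable lborel (\<lambda>x. gaussian a x * cos (x \<bullet> \<xi>))"
    and "(\<integral>x. gaussian a x * cos (x \<bullet> \<xi>) \<partial>lborel)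
      = sqrt (pi / a) ^ DIM('a) * exp (- (norm \<xi>)\<^sup>2 / (4 * a))"
proof -
  have Re: "Re (complex_of_real (gaussian a x) * cis (x \<bullet> \<xi>)) = gaussian a x * cos (x \<bullet> \<xi>)" for x
    by (simp del: of_real_exp)
  show "integrable lborel (\<lambda>x. gaussian a x * cos (x \<bullet> \<xi>))"
    using integrable_Re[OF gaussian_fourier(1)[OF a, of \<xi>]] unfolding Re .
  show "(\<integral>x. gaussian a x * cos (x \<bullet> \<xi>) \<partial>lborel)
      = sqrt (pi / a) ^ DIM('a) * exp (- (norm \<xi>)\<^sup>2 / (4 * a))"
    using integral_Re[OF gaussian_fourier(1)[OF a, of \<xi>]] unfolding Re gaussian_fourier(2)[OF a] Re_complex_of_real .
qed

section \<open>Fourier inversion\<close>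

text \<open>All exchanges of Bochner integrals below have an integrand dominated by a product of two integrable functions.\<close>

lemma Fubini_lborel_product_bound:
  fixes F :: "'a::euclidean_space \<Rightarrow> 'b::euclidean_space \<Rightarrow> 'c::{banach, second_countable_topology}"
  assumes F[measurable]: "case_prod F \<in> borel_measurable (borel \<Otimes>\<^sub>M borel)"
    and f: "integrable lborel f" and g: "integrable lborel g"
    and bound: "\<And>x y. norm (F x y) \<le> f x * g y"
  shows "(\<integral>x. (\<integral>y. F x y \<partial>lborel) \<partial>lborel) = (\<integral>y. (\<integral>x. F x y \<partial>lborel) \<partial>lborel)"
proof -
  have Fx: "integrable lborel (F x)" for x
    by (rule Bochner_Integration.integrable_bound[OF integrable_mult_right[OF g, of "f x"]])
      (use bound[of x] in \<open>auto intro!: AE_I2 order_trans[OF _ abs_ge_self]\<close>)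
  have "integrable lborel (\<lambda>x. \<integral>y. norm (F x y) \<partial>lborel)"
  proof (rule Bochner_Integration.integrable_bound[OF integrable_mult_left[OF f, of "integral\<^sup>L lborel g"]])
    show "AE x in lborel. norm (\<integral>y. norm (F x y) \<partial>lborel) \<le> norm (f x * integral\<^sup>L lborel g)"
    proof (rule AE_I2)
      fix x
      have "(\<integral>y. norm (F x y) \<partial>lborel) \<le> (\<integral>y. f x * g y \<partial>lborel)"
        by (intro integral_mono integrable_norm Fx integrable_mult_right g bound)
      then show "norm (\<integral>y. norm (F x y) \<partial>lborel) \<le> norm (f x * integral\<^sup>L lborel g)"
        by (simp add: integral_nonneg_AE)
    qed
  qed measurable
  then have "integrable (lborel \<Otimes>\<^sub>M lborel) (case_prod F)"
    by (intro lborel_pair.Fubini_integrable) (use Fx in \<open>auto simp: F\<close>)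
  from lborel_pair.Fubini_integral[OF this]
  show "(\<integral>x. (\<integral>y. F x y \<partial>lborel) \<partial>lborel) = (\<integral>y. (\<integral>x. F x y \<partial>lborel) \<partial>lborel)"
    by simp
qed

lemma lborel_translate:
  fixes f :: "'a::euclidean_space \<Rightarrow> 'b::{banach, second_countable_topology}"
  assumes f: "integrable lborel f"
  shows "integrable lborel (\<lambda>x. f (x - c))" and "(\<integral>x. f (x - c) \<partial>lborel) = integral\<^sup>L lborel f"
proof -
  have f': "f \<in> borel_measurable borel"
    using borel_measurable_integrable[OF f] by simp
  have eq: "(\<lambda>x. f (x - c)) = (\<lambda>x. f (- c + x))" by simp
  show "integrable lborel (\<lambda>x. f (x - c))" unfolding eq
    by (subst integrable_distr_eq[symmetric, where N = borel and f=f]) (use f f' in \<open>auto simp: lborel_distr_plus\<close>)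
  show "(\<integral>x. f (x - c) \<partial>lborel) = integral\<^sup>L lborel f" unfolding eq
    by (subst integral_distr[symmetric, where N = borel and f=f]) (use f' in \<open>auto simp: lborel_distr_plus\<close>)
qed

text \<open>Since \<open>g\<close> is not assumed bounded, the usual change of variables with dominated convergence is not available. The
error is split at a radius \<open>r\<close> of continuity: outside it, \<open>|g|\<close> is paired with the supremum of the kernel, which tends
to \<open>0\<close>, and the constant \<open>g y\<close> with the kernel's tail mass, estimated by giving up half of the exponent.\<close>

lemma gaussian_approximate_identity:
  fixes g :: "'a::euclidean_space \<Rightarrow> real"
  assumes cont: "continuous_on UNIV g" and g: "integrable lborel g"
  shows "((\<lambda>a. sqrt (a / pi) ^ DIM('a) * (\<integral>x. g x * gaussian a (x - y) \<partial>lborel)) \<longlongrightarrow> g y) at_top"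
proof (rule tendstoI)
  fix \<epsilon> :: real assume \<epsilon>: "\<epsilon> > 0"
  define d where "d = DIM('a)"
  define E where "E = (\<lambda>a x. gaussian a (x - y :: 'a))"
  have E_int: "integrable lborel (E a)" "integral\<^sup>L lborel (E a) = sqrt (pi / a) ^ d" if "a > 0" for a
    using lborel_translate[OF gaussian_integral(1)[OF that], of y] gaussian_integral(2)[OF that, where 'a='a]
    by (simp_all add: E_def[abs_def] d_def)
  have gm[measurable]: "g \<in> borel_measurable borel" using cont by (rule borel_measurable_continuous_onI)
  have Em[measurable]: "E a \<in> borel_measurable borel" for a unfolding E_def by measurable
  obtain r where r: "r > 0" "\<And>x. norm (x - y) < r \<Longrightarrow> \<bar>g x - g y\<bar> < \<epsilon> / 2"
    using cont \<epsilon> unfolding continuous_on_iff dist_norm by (metis UNIV_I half_gt_zero real_norm_def)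
  define B where "B = (\<integral>x. \<bar>g x\<bar> \<partial>lborel)"
  \<comment> \<open>the three terms come from the neighbourhood of \<open>y\<close>, from \<open>g\<close> far away, and from the constant \<open>g y\<close> far away\<close>
  define err where "err = (\<lambda>a. \<epsilon> / 2 + sqrt (a / pi) ^ d * exp (- a * r\<^sup>2) * B + \<bar>g y\<bar> * (sqrt 2 ^ d * exp (- (a / 2) * r\<^sup>2)))"
  have main: "\<bar>sqrt (a / pi) ^ d * (\<integral>x. g x * E a x \<partial>lborel) - g y\<bar> \<le> err a" if a: "a > 0" for a
  proof -
    have E_le1: "E a x \<le> 1" for x using a by (simp add: E_def)
    have E_pos: "E a x \<ge> 0" for x by (simp add: E_def)
    have i_gE: "integrable lborel (\<lambda>x. g x * E a x)"
      by (rule Bochner_Integration.integrable_bound[OF g])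
        (auto simp: abs_mult E_pos intro!: AE_I2 mult_left_le E_le1)
    have one: "sqrt (a / pi) ^ d * sqrt (pi / a) ^ d = 1"
      using a by (simp flip: power_mult_distrib real_sqrt_mult)
    have "sqrt (a / pi) ^ d * (\<integral>x. g x * E a x \<partial>lborel) - g y
        = sqrt (a / pi) ^ d * ((\<integral>x. g x * E a x \<partial>lborel) - (\<integral>x. g y * E a x \<partial>lborel))"
      using one by (simp add: E_int[OF a] algebra_simps)
    also have "\<dots> = sqrt (a / pi) ^ d * (\<integral>x. (g x - g y) * E a x \<partial>lborel)"
      by (subst Bochner_Integration.integral_diff[symmetric]) (use i_gE E_int[OF a] in \<open>auto simp: algebra_simps\<close>)
    finally have "\<bar>sqrt (a / pi) ^ d * (\<integral>x. g x * E a x \<partial>lborel) - g y\<bar>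
        = sqrt (a / pi) ^ d * \<bar>\<integral>x. (g x - g y) * E a x \<partial>lborel\<bar>"
      using a by (simp add: abs_mult)
    also have "\<bar>\<integral>x. (g x - g y) * E a x \<partial>lborel\<bar>
        \<le> (\<integral>x. \<epsilon> / 2 * E a x + exp (- a * r\<^sup>2) * \<bar>g x\<bar> + \<bar>g y\<bar> * exp (- (a / 2) * r\<^sup>2) * E (a / 2) x \<partial>lborel)"
    proof (rule order_trans[OF integral_abs_bound integral_mono])
      show "integrable lborel (\<lambda>x. \<bar>(g x - g y) * E a x\<bar>)"
        using i_gE E_int(1)[OF a] by (intro integrable_abs) (simp add: left_diff_distrib)
      show "integrable lborel (\<lambda>x. \<epsilon> / 2 * E a x + exp (- a * r\<^sup>2) * \<bar>g x\<bar> + \<bar>g y\<bar> * exp (- (a / 2) * r\<^sup>2) * E (a / 2) x)"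
        using E_int(1)[OF a] E_int(1)[of "a/2"] g a
        by (intro Bochner_Integration.integrable_add integrable_mult_right integrable_abs) auto
      fix x
      show "\<bar>(g x - g y) * E a x\<bar> \<le> \<epsilon> / 2 * E a x + exp (- a * r\<^sup>2) * \<bar>g x\<bar> + \<bar>g y\<bar> * exp (- (a / 2) * r\<^sup>2) * E (a / 2) x"
      proof (cases "norm (x - y) < r")
        case True
        have "\<bar>(g x - g y) * E a x\<bar> \<le> \<epsilon> / 2 * E a x"
          using mult_right_mono[OF less_imp_le[OF r(2)[OF True]] E_pos[of x]] E_pos[of x] by (simp only: abs_mult abs_of_nonneg)
        moreover have "0 \<le> exp (- a * r\<^sup>2) * \<bar>g x\<bar>" "0 \<le> \<bar>g y\<bar> * exp (- (a / 2) * r\<^sup>2) * E (a / 2) x"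
          by (simp_all add: E_def)
        ultimately show ?thesis by linarith
      next
        case False
        then have sq: "r\<^sup>2 \<le> (norm (x - y))\<^sup>2" using r(1) by (intro power_mono) auto
        have e1: "E a x \<le> exp (- a * r\<^sup>2)" using mult_left_mono[OF sq, of a] a by (simp add: E_def)
        have e2: "E a x \<le> exp (- (a / 2) * r\<^sup>2) * E (a / 2) x"
        proof -
          have "- a * (norm (x - y))\<^sup>2 \<le> - (a / 2) * r\<^sup>2 + - (a / 2) * (norm (x - y))\<^sup>2"
            using mult_left_mono[OF sq, of a] a by linarith
          then show ?thesis by (simp only: E_def exp_add[symmetric] exp_le_cancel_iff)
        qed
        have "\<bar>(g x - g y) * E a x\<bar> \<le> (\<bar>g x\<bar> + \<bar>g y\<bar>) * E a x"
          using E_pos[of x] by (simp add: abs_mult mult_right_mono)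
        also have "\<dots> \<le> \<bar>g x\<bar> * exp (- a * r\<^sup>2) + \<bar>g y\<bar> * (exp (- (a / 2) * r\<^sup>2) * E (a / 2) x)"
          using mult_left_mono[OF e1, of "\<bar>g x\<bar>"] mult_left_mono[OF e2, of "\<bar>g y\<bar>"] by (simp add: distrib_right)
        finally have "\<bar>(g x - g y) * E a x\<bar> \<le> exp (- a * r\<^sup>2) * \<bar>g x\<bar> + \<bar>g y\<bar> * exp (- (a / 2) * r\<^sup>2) * E (a / 2) x"
          by (simp add: mult_ac)
        moreover have "0 \<le> \<epsilon> / 2 * E a x" using \<epsilon> E_pos by simp
        ultimately show ?thesis by linarith
      qed
    qed
    also have "(\<integral>x. \<epsilon> / 2 * E a x + exp (- a * r\<^sup>2) * \<bar>g x\<bar> + \<bar>g y\<bar> * exp (- (a / 2) * r\<^sup>2) * E (a / 2) x \<partial>lborel)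
       = \<epsilon> / 2 * sqrt (pi / a) ^ d + exp (- a * r\<^sup>2) * B + \<bar>g y\<bar> * exp (- (a / 2) * r\<^sup>2) * sqrt (pi / (a / 2)) ^ d"
      using E_int[OF a] E_int[of "a/2"] a g by (simp add: B_def)
    also have "sqrt (a / pi) ^ d * (\<epsilon> / 2 * sqrt (pi / a) ^ d + exp (- a * r\<^sup>2) * B + \<bar>g y\<bar> * exp (- (a / 2) * r\<^sup>2) * sqrt (pi / (a / 2)) ^ d)
      = \<epsilon> / 2 * (sqrt (a / pi) ^ d * sqrt (pi / a) ^ d) + sqrt (a / pi) ^ d * exp (- a * r\<^sup>2) * B
        + \<bar>g y\<bar> * exp (- (a / 2) * r\<^sup>2) * (sqrt (a / pi) ^ d * sqrt (pi / (a / 2)) ^ d)"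
      by (simp only: distrib_left mult_ac)
    also have "sqrt (a / pi) ^ d * sqrt (pi / (a / 2)) ^ d = sqrt 2 ^ d"
      using a by (simp flip: power_mult_distrib real_sqrt_mult)
    finally show ?thesis using a unfolding one err_def
      by (simp add: mult_ac mult_left_mono)
  qed
  have lim1: "((\<lambda>a. sqrt (a / pi) ^ d * exp (- a * r\<^sup>2)) \<longlongrightarrow> 0) at_top"
  proof (rule Lim_null_comparison)
    have "((\<lambda>a. (a * r\<^sup>2) ^ d / exp (a * r\<^sup>2)) \<longlongrightarrow> 0) at_top"
      by (rule filterlim_compose[OF tendsto_power_div_exp_0])
        (use r in \<open>auto intro!: filterlim_at_top_mult_tendsto_pos[OF tendsto_const] filterlim_ident simp: mult.commute\<close>)
    from tendsto_mult_left[OF this, of "(1 / r\<^sup>2) ^ d"]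
    show "((\<lambda>a. (1 / r\<^sup>2) ^ d * ((a * r\<^sup>2) ^ d / exp (a * r\<^sup>2))) \<longlongrightarrow> 0) at_top" by simp
    show "\<forall>\<^sub>F a in at_top. norm (sqrt (a / pi) ^ d * exp (- a * r\<^sup>2)) \<le> (1 / r\<^sup>2) ^ d * ((a * r\<^sup>2) ^ d / exp (a * r\<^sup>2))"
      using eventually_ge_at_top[of 1]
    proof eventually_elim
      case (elim a)
      have "a / pi \<le> a" using elim pi_ge_two by (simp add: divide_le_eq mult_left_le)
      also have "a \<le> a\<^sup>2" using elim by (simp add: power2_eq_square)
      finally have "sqrt (a / pi) \<le> a" using elim by (intro real_le_lsqrt) auto
      then have "sqrt (a / pi) ^ d \<le> a ^ d" using elim by (intro power_mono) auto
      moreover have "(1 / r\<^sup>2) ^ d * (a * r\<^sup>2) ^ d = a ^ d" using r by (simp flip: power_mult_distrib)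
      ultimately show ?case using elim by (simp add: exp_minus divide_inverse mult_right_mono)
    qed
  qed
  have lim2: "((\<lambda>a. exp (- (a / 2) * r\<^sup>2)) \<longlongrightarrow> 0) at_top"
    using r(1) by real_asymp
  have "(err \<longlongrightarrow> \<epsilon> / 2 + 0 * B + \<bar>g y\<bar> * (sqrt 2 ^ d * 0)) at_top"
    unfolding err_def by (intro tendsto_intros lim1 lim2)
  then have "\<forall>\<^sub>F a in at_top. err a < \<epsilon>"
    by (rule order_tendstoD(2)) (use \<epsilon> in simp)
  then show "\<forall>\<^sub>F a in at_top. dist (sqrt (a / pi) ^ DIM('a) * (\<integral>x. g x * gaussian a (x - y) \<partial>lborel)) (g y) < \<epsilon>"
    using eventually_gt_at_top[of 0]
  proof eventually_elim
    case (elim a)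
    with main[of a] show ?case by (simp add: dist_real_def E_def d_def)
  qed
qed

abbreviation fourier :: "('a::euclidean_space \<Rightarrow> real) \<Rightarrow> 'a \<Rightarrow> complex" where
  "fourier g \<xi> \<equiv> \<integral>x. of_real (g x) * cis (- (x \<bullet> \<xi>)) \<partial>lborel"

text \<open>Moving the Fourier transform from \<open>g\<close> onto a modulated Gaussian, whose transform is again a Gaussian, turns the
regularised inversion integral into a Gaussian mean of \<open>g\<close> around \<open>y\<close>.\<close>

lemma fourier_multiplication_formula:
  fixes g :: "'a::euclidean_space \<Rightarrow> real"
  assumes g: "integrable lborel g" and a: "a > 0"
  shows "(\<integral>\<xi>. fourier g \<xi> * (of_real (exp (- (norm \<xi>)\<^sup>2 / (4 * a))) * cis (\<xi> \<bullet> y)) \<partial>lborel)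
    = of_real (sqrt (4 * pi * a) ^ DIM('a) * (\<integral>x. g x * gaussian a (x - y) \<partial>lborel))"
proof -
  define b where "b = 1 / (4 * a)"
  have b: "b > 0" using a by (simp add: b_def)
  have [measurable]: "g \<in> borel_measurable borel" using borel_measurable_integrable[OF g] by simp
  let ?F = "\<lambda>\<xi> x. (of_real (g x) * cis (- (x \<bullet> \<xi>))) * (of_real (gaussian b \<xi>) * cis (\<xi> \<bullet> y))"
  have "(\<integral>\<xi>. fourier g \<xi> * (of_real (exp (- (norm \<xi>)\<^sup>2 / (4 * a))) * cis (\<xi> \<bullet> y)) \<partial>lborel)
     = (\<integral>\<xi>. (\<integral>x. ?F \<xi> x \<partial>lborel) \<partial>lborel)"
    by (simp add: b_def)
  also have "\<dots> = (\<integral>x. (\<integral>\<xi>. ?F \<xi> x \<partial>lborel) \<partial>lborel)"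
    by (rule Fubini_lborel_product_bound[OF _ gaussian_integral(1)[OF b] integrable_norm[OF g]])
      (measurable, simp add: norm_mult)
  also have "\<dots> = (\<integral>x. of_real (sqrt (4 * pi * a) ^ DIM('a) * (g x * gaussian a (x - y))) \<partial>lborel)"
  proof (rule Bochner_Integration.integral_cong[OF refl])
    fix x
    have cis: "cis (\<xi> \<bullet> (y - x)) = cis (- (x \<bullet> \<xi>)) * cis (\<xi> \<bullet> y)" for \<xi>
      by (simp add: cis_mult inner_diff_right inner_commute[of x])
    have "(\<integral>\<xi>. ?F \<xi> x \<partial>lborel) = (\<integral>\<xi>. of_real (g x) * (of_real (gaussian b \<xi>) * cis (\<xi> \<bullet> (y - x))) \<partial>lborel)"
      by (intro Bochner_Integration.integral_cong refl) (simp only: cis mult_ac)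
    also have "\<dots> = of_real (g x) * of_real (sqrt (pi / b) ^ DIM('a) * exp (- (norm (y - x))\<^sup>2 / (4 * b)))"
      by (simp only: gaussian_fourier[OF b] integral_mult_right_zero)
    also have "\<dots> = of_real (sqrt (4 * pi * a) ^ DIM('a) * (g x * gaussian a (x - y)))"
      using a by (simp add: b_def norm_minus_commute mult_ac)
    finally show "(\<integral>\<xi>. ?F \<xi> x \<partial>lborel) = of_real (sqrt (4 * pi * a) ^ DIM('a) * (g x * gaussian a (x - y)))" .
  qed
  also have "\<dots> = of_real (sqrt (4 * pi * a) ^ DIM('a) * (\<integral>x. g x * gaussian a (x - y) \<partial>lborel))"
    by (subst integral_complex_of_real) simp
  finally show ?thesis .
qed

text \<open>For a function with nonnegative transform this limit is what proves the transform integrable, so it is kept apart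
from the inversion formula for integrable transforms.\<close>

lemma fourier_inversion_gaussian_means:
  fixes g :: "'a::euclidean_space \<Rightarrow> real"
  assumes cont: "continuous_on UNIV g" and g: "integrable lborel g"
  shows "((\<lambda>a. \<integral>\<xi>. fourier g \<xi> * (of_real (exp (- (norm \<xi>)\<^sup>2 / (4 * a))) * cis (\<xi> \<bullet> y)) \<partial>lborel)
    \<longlongrightarrow> of_real ((2 * pi) ^ DIM('a) * g y)) at_top"
proof (rule Lim_transform_eventually)
  show "((\<lambda>a. complex_of_real ((2 * pi) ^ DIM('a) * (sqrt (a / pi) ^ DIM('a) * (\<integral>x. g x * gaussian a (x - y) \<partial>lborel))))
      \<longlongrightarrow> of_real ((2 * pi) ^ DIM('a) * g y)) at_top"
    by (intro tendsto_of_real tendsto_mult_left gaussian_approximate_identity assms)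
  show "\<forall>\<^sub>F a in at_top. complex_of_real ((2 * pi) ^ DIM('a) * (sqrt (a / pi) ^ DIM('a) * (\<integral>x. g x * gaussian a (x - y) \<partial>lborel)))
      = (\<integral>\<xi>. fourier g \<xi> * (of_real (exp (- (norm \<xi>)\<^sup>2 / (4 * a))) * cis (\<xi> \<bullet> y)) \<partial>lborel)"
    using eventually_gt_at_top[of 0]
  proof eventually_elim
    case (elim a)
    have "2 * pi * sqrt (a / pi) = sqrt (4 * pi * a)"
    proof -
      have "4 * pi * a = (2 * pi)\<^sup>2 * (a / pi)" by (simp add: power2_eq_square)
      then show ?thesis by (subst \<open>4 * pi * a = _\<close>, subst real_sqrt_mult, subst real_sqrt_abs) simp
    qed
    then have "(2 * pi) ^ DIM('a) * sqrt (a / pi) ^ DIM('a) = sqrt (4 * pi * a) ^ DIM('a)"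
      by (metis power_mult_distrib)
    then show ?case
      unfolding fourier_multiplication_formula[OF g elim] by (simp only: mult.assoc[symmetric])
  qed
qed

lemma fourier_inversion:
  fixes g :: "'a::euclidean_space \<Rightarrow> real" and h :: "'a \<Rightarrow> complex"
  assumes cont: "continuous_on UNIV g" and g: "integrable lborel g"
    and h: "\<And>\<xi>. fourier g \<xi> = h \<xi>" and h_int: "integrable lborel h"
  shows "(\<integral>\<xi>. h \<xi> * cis (\<xi> \<bullet> y) \<partial>lborel) = of_real ((2 * pi) ^ DIM('a) * g y)"
proof (rule tendsto_unique[OF _ _ fourier_inversion_gaussian_means[OF cont g, of y, unfolded h]])
  have [measurable]: "h \<in> borel_measurable borel" using borel_measurable_integrable[OF h_int] by simp
  show "((\<lambda>a. \<integral>\<xi>. h \<xi> * (of_real (exp (- (norm \<xi>)\<^sup>2 / (4 * a))) * cis (\<xi> \<bullet> y)) \<partial>lborel)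
      \<longlongrightarrow> (\<integral>\<xi>. h \<xi> * cis (\<xi> \<bullet> y) \<partial>lborel)) at_top"
  proof (rule integral_dominated_convergence_at_top[where w = "\<lambda>\<xi>. norm (h \<xi>)"])
    show "AE \<xi> in lborel. ((\<lambda>a. h \<xi> * (of_real (exp (- (norm \<xi>)\<^sup>2 / (4 * a))) * cis (\<xi> \<bullet> y))) \<longlongrightarrow> h \<xi> * cis (\<xi> \<bullet> y)) at_top"
    proof (rule AE_I2)
      fix \<xi> :: 'a
      have "((\<lambda>a. exp (- (norm \<xi>)\<^sup>2 / (4 * a))) \<longlongrightarrow> 1) at_top" by real_asymp
      from tendsto_mult[OF tendsto_const tendsto_mult[OF tendsto_of_real[OF this] tendsto_const]]
      show "((\<lambda>a. h \<xi> * (of_real (exp (- (norm \<xi>)\<^sup>2 / (4 * a))) * cis (\<xi> \<bullet> y))) \<longlongrightarrow> h \<xi> * cis (\<xi> \<bullet> y)) at_top"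
        by simp
    qed
    show "\<forall>\<^sub>F a in at_top. AE \<xi> in lborel. norm (h \<xi> * (of_real (exp (- (norm \<xi>)\<^sup>2 / (4 * a))) * cis (\<xi> \<bullet> y))) \<le> norm (h \<xi>)"
      using eventually_gt_at_top[of 0]
    proof eventually_elim
      case (elim a)
      then show ?case by (auto simp: norm_mult intro!: AE_I2 mult_left_le)
    qed
  qed (use h_int in \<open>auto\<close>)
qed simp

section \<open>Radial integrals and Gamma integrals\<close>

abbreviation radial_weight :: "nat \<Rightarrow> real \<Rightarrow> real \<Rightarrow> real" where
  "radial_weight n b u \<equiv> indicator {0..} u * (unit_ball_vol n * (real n / b) * u powr (real n / b - 1))"

lemma emeasure_norm_powr_le:
  fixes b c :: real
  assumes b: "b > 0" and c: "c \<ge> 0"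
  shows "emeasure lborel {x::'a::euclidean_space. norm x powr b \<le> c}
    = ennreal (unit_ball_vol (DIM('a)) * c powr (real DIM('a) / b))"
proof -
  have "norm x powr b \<le> c \<longleftrightarrow> norm x \<le> c powr (1 / b)" for x :: 'a
  proof
    assume "norm x powr b \<le> c"
    from powr_mono2[OF _ _ this, of "1/b"] show "norm x \<le> c powr (1/b)"
      using b by (simp add: powr_powr)
  next
    assume "norm x \<le> c powr (1 / b)"
    from powr_mono2[OF _ _ this, of b] show "norm x powr b \<le> c"
      using b c by (simp add: powr_powr)
  qed
  then have "{x::'a. norm x powr b \<le> c} = cball 0 (c powr (1 / b))"
    by (simp only: set_eq_iff mem_Collect_eq mem_cball_0 simp_thms)
  moreover have "(c powr (1 / b)) ^ DIM('a) = c powr (real DIM('a) / b)"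
    by (cases "c = 0") (simp_all add: powr_power)
  ultimately show ?thesis by (simp add: emeasure_cball)
qed

text \<open>Polar integration for functions of \<open>|x|^b\<close>: the image of Lebesgue measure is determined by the volumes of balls.
A general exponent \<open>b\<close> is allowed so that \<open>exp (-|x|^b)\<close> becomes a Gamma integrand directly.\<close>

lemma distr_norm_powr:
  fixes b :: real
  assumes b: "b > 0"
  shows "distr lborel borel (\<lambda>x::'a::euclidean_space. norm x powr b)
    = density lborel (\<lambda>u. ennreal (radial_weight DIM('a) b u))"
    (is "?M = ?N")
proof (rule measure_eqI_generator_eq[where E = "range (\<lambda>c. {..c})" and \<Omega> = UNIV and A = "\<lambda>i. {..real i}"])
  let ?q = "real DIM('a) / b"
  let ?V = "unit_ball_vol (DIM('a))"
  have q: "?q > 0" using b by simp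
  have V: "?V \<ge> 0" by simp
  have M: "emeasure ?M {..c} = (if c < 0 then 0 else ennreal (?V * c powr ?q))" for c
  proof -
    have "emeasure ?M {..c} = emeasure lborel {x::'a. norm x powr b \<le> c}"
      by (subst emeasure_distr) (auto simp: vimage_def)
    moreover have "{x::'a. norm x powr b \<le> c} = {}" if "c < 0"
      using that by (auto simp: not_le intro: less_le_trans)
    ultimately show ?thesis using emeasure_norm_powr_le[OF b, of c, where 'a='a] by auto
  qed
  have N: "emeasure ?N {..c} = (if c < 0 then 0 else ennreal (?V * c powr ?q))" for c
  proof -
    have e: "emeasure ?N {..c} = (\<integral>\<^sup>+u. ennreal (indicator {0..c} u * (?V * ?q * u powr (?q - 1))) \<partial>lborel)"
      by (subst emeasure_density) (auto intro!: nn_integral_cong split: split_indicator)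
    show ?thesis
    proof (cases "c < 0")
      case True then show ?thesis unfolding e by simp
    next
      case False
      then have "((\<lambda>u. ?V * ?q * u powr (?q - 1)) has_integral ?V * ?q * (c powr ?q / ?q)) {0..c}"
        using has_integral_powr_from_0[of "?q - 1" c] q by (intro has_integral_mult_right) simp
      then have "(\<integral>\<^sup>+u. ennreal (indicator {0..c} u * (?V * ?q * u powr (?q - 1))) \<partial>lborel) = ennreal (?V * ?q * (c powr ?q / ?q))"
        by (rule nn_integral_has_integral_lebesgue[rotated]) (use V q b in simp)
      then show ?thesis unfolding e using False q b by simp
    qed
  qed
  show "Int_stable (range (\<lambda>c::real. {..c}))"
    by (auto simp: Int_stable_def)
  show "emeasure ?M X = emeasure ?N X" if "X \<in> range (\<lambda>c. {..c})" for X
    using that M N by auto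
  show "sets ?M = sigma_sets UNIV (range (\<lambda>c. {..c}))" "sets ?N = sigma_sets UNIV (range (\<lambda>c. {..c}))"
    by (simp_all add: borel_eq_atMost)
  show "(\<Union>i. {..real i}) = UNIV"
    by (auto intro: real_arch_simple)
  show "emeasure ?M {..real i} \<noteq> \<infinity>" for i
    unfolding M by simp
  show "range (\<lambda>c::real. {..c}) \<subseteq> Pow UNIV" by simp
  show "range (\<lambda>i. {..real i}) \<subseteq> range (\<lambda>c::real. {..c})" by blast
qed

lemma nn_integral_radial:
  fixes b :: real
  assumes b: "b > 0" and f[measurable]: "f \<in> borel_measurable borel"
  shows "(\<integral>\<^sup>+x. f (norm (x::'a::euclidean_space) powr b) \<partial>lborel)
    = (\<integral>\<^sup>+u. ennreal (radial_weight DIM('a) b u) * f u \<partial>lborel)"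
proof -
  have "(\<integral>\<^sup>+x. f (norm (x::'a) powr b) \<partial>lborel) = nn_integral (distr lborel borel (\<lambda>x::'a. norm x powr b)) f"
    by (rule nn_integral_distr[symmetric]) measurable
  also have "\<dots> = (\<integral>\<^sup>+u. ennreal (radial_weight DIM('a) b u) * f u \<partial>lborel)"
    unfolding distr_norm_powr[OF b] by (rule nn_integral_density) measurable
  finally show ?thesis .
qed

lemma nn_integral_Gamma_rate:
  fixes p A :: real
  assumes p: "p > 0" and A: "A > 0"
  shows "(\<integral>\<^sup>+t. ennreal (indicator {0..} t * (t powr (p - 1) * exp (- A * t))) \<partial>lborel) = ennreal (Gamma p / A powr p)"
proof -
  let ?I = "\<integral>\<^sup>+t. ennreal (indicator {0..} t * (t powr (p - 1) * exp (- A * t))) \<partial>lborel"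
  have "ennreal (Gamma p) = (\<integral>\<^sup>+t. ennreal (indicator {0..} t * t powr (p - 1) / exp t) \<partial>lborel)"
    using Gamma_conv_nn_integral_real[OF p] .
  also have "\<dots> = ennreal A * (\<integral>\<^sup>+t. ennreal (indicator {0..} (A * t) * (A * t) powr (p - 1) / exp (A * t)) \<partial>lborel)"
    using A by (subst nn_integral_real_affine[where c = A and t = 0]) auto
  also have "(\<integral>\<^sup>+t. ennreal (indicator {0..} (A * t) * (A * t) powr (p - 1) / exp (A * t)) \<partial>lborel)
     = (\<integral>\<^sup>+t. ennreal (A powr (p - 1)) * ennreal (indicator {0..} t * (t powr (p - 1) * exp (- A * t))) \<partial>lborel)"
    using A by (intro nn_integral_cong)
      (auto simp: powr_mult exp_minus divide_inverse zero_le_mult_iff mult_ac ennreal_mult[symmetric] split: split_indicator)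
  also have "\<dots> = ennreal (A powr (p - 1)) * ?I"
    by (rule nn_integral_cmult) measurable
  finally have "ennreal (Gamma p) = ennreal (A powr p) * ?I"
    using A by (simp add: mult.assoc[symmetric] ennreal_mult[symmetric] powr_diff)
  moreover have "I = ennreal (G / P)" if "ennreal G = ennreal P * I" "P > 0" for G P I
  proof -
    have "I = ennreal (1 / P * P) * I" using that by simp
    also have "\<dots> = ennreal (1 / P) * (ennreal P * I)"
      using that by (subst ennreal_mult) (simp_all add: mult.assoc)
    also have "\<dots> = ennreal (1 / P * G)"
      using that by (subst that(1)[symmetric], subst ennreal_mult') simp_all
    finally show ?thesis by simp
  qed
  ultimately show ?thesis using A by simp
qed

lemma nn_integral_exp_norm_powr:
  fixes b q :: real
  assumes b: "b > 0" and q: "q \<ge> 0"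
  shows "(\<integral>\<^sup>+x. ennreal ((norm (x::'a::euclidean_space) powr b) powr q * exp (- (norm x powr b))) \<partial>lborel)
    = ennreal (unit_ball_vol (DIM('a)) * (real DIM('a) / b) * Gamma (real DIM('a) / b + q))"
proof -
  let ?d = "real DIM('a) / b" and ?V = "unit_ball_vol (DIM('a))"
  have d: "?d > 0" using b by simp
  have "(\<integral>\<^sup>+x. ennreal ((norm (x::'a::euclidean_space) powr b) powr q * exp (- (norm x powr b))) \<partial>lborel)
    = (\<integral>\<^sup>+u. ennreal (radial_weight DIM('a) b u) * ennreal (u powr q * exp (- u)) \<partial>lborel)"
    by (rule nn_integral_radial[OF b]) measurable
  also have "\<dots> = (\<integral>\<^sup>+u. ennreal (?V * ?d) * ennreal (indicator {0..} u * (u powr (?d + q - 1) * exp (- 1 * u))) \<partial>lborel)"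
  proof (intro nn_integral_cong)
    fix u :: real
    have "u powr (?d + q - 1) = u powr (?d - 1) * u powr q"
      by (subst powr_add[symmetric]) (simp add: algebra_simps)
    then show "ennreal (radial_weight DIM('a) b u) * ennreal (u powr q * exp (- u))
        = ennreal (?V * ?d) * ennreal (indicator {0..} u * (u powr (?d + q - 1) * exp (- 1 * u)))"
      using b by (simp add: ennreal_mult'[symmetric] ennreal_mult''[symmetric] mult_ac)
  qed
  also have "\<dots> = ennreal (?V * ?d) * ennreal (Gamma (?d + q) / 1 powr (?d + q))"
    using d q by (subst nn_integral_cmult) (auto simp only: nn_integral_Gamma_rate, measurable)
  finally show ?thesis using d q b by (simp add: ennreal_mult'[symmetric] del: times_divide_eq_left times_divide_eq_right)
qed

lemma integrable_exp_norm_powr: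
  fixes b q :: real
  assumes b: "b > 0" and q: "q \<ge> 0"
  shows "integrable lborel (\<lambda>x::'a::euclidean_space. (norm x powr b) powr q * exp (- (norm x powr b)))"
    and "(\<integral>x. (norm (x::'a) powr b) powr q * exp (- (norm x powr b)) \<partial>lborel)
      = unit_ball_vol (DIM('a)) * (real DIM('a) / b) * Gamma (real DIM('a) / b + q)"
proof -
  have 0: "0 \<le> unit_ball_vol (DIM('a)) * (real DIM('a) / b) * Gamma (real DIM('a) / b + q)"
    using b q by (intro mult_nonneg_nonneg less_imp_le[OF Gamma_real_pos]) (auto intro: add_pos_nonneg)
  show "integrable lborel (\<lambda>x::'a::euclidean_space. (norm x powr b) powr q * exp (- (norm x powr b)))"
    by (rule integrableI_nonneg) (auto simp: nn_integral_exp_norm_powr[OF assms])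
  show "(\<integral>x. (norm (x::'a) powr b) powr q * exp (- (norm x powr b)) \<partial>lborel)
      = unit_ball_vol (DIM('a)) * (real DIM('a) / b) * Gamma (real DIM('a) / b + q)"
    by (subst integral_eq_nn_integral) (simp_all add: nn_integral_exp_norm_powr[OF assms] enn2real_ennreal[OF 0] del: times_divide_eq_left times_divide_eq_right)
qed

text \<open>The Levy--Khintchine representation of \<open>A^\<alpha>\<close>, in the variable inverse to the jump size. Writing
\<open>1 - exp (- A/t)\<close> as the integral of \<open>A exp (- A v)\<close> over \<open>0 < v < 1/t\<close> and exchanging the integrals leaves a Gamma
integral of parameter \<open>1 - \<alpha>\<close>; in these variables no substitution is needed.\<close>

lemma nn_integral_levy_powr:
  fixes \<alpha> A :: real
  assumes \<alpha>: "0 < \<alpha>" "\<alpha> < 1" and A: "A \<ge> 0"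
  shows "(\<integral>\<^sup>+t. ennreal (indicator {0<..} t * (t powr (\<alpha> - 1) * (1 - exp (- A / t)))) \<partial>lborel)
    = ennreal (A powr \<alpha> * Gamma (1 - \<alpha>) / \<alpha>)"
proof (cases "A = 0")
  case False
  with A have A: "A > 0" by simp
  let ?F = "\<lambda>t v. ennreal (t powr (\<alpha> - 1) * (A * exp (- A * v))) * indicator {(t, v). 0 < t \<and> 0 < v \<and> v * t \<le> 1} (t, v)"
  have inner_v: "ennreal (indicator {0<..} t * (t powr (\<alpha> - 1) * (1 - exp (- A / t)))) = (\<integral>\<^sup>+v. ?F t v \<partial>lborel)" for t
  proof (cases "t > 0")
    case True
    have ind: "indicator {(t, v). 0 < t \<and> 0 < v \<and> v * t \<le> 1} (t, v) = (indicator {0..1 / t} v :: ennreal)"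
      if "v \<noteq> 0" for v :: real
      using that True pos_le_divide_eq[of t v 1] by (auto simp: indicator_def)
    have "(\<integral>\<^sup>+v. ?F t v \<partial>lborel) = (\<integral>\<^sup>+v. ennreal (t powr (\<alpha> - 1) * (A * exp (- A * v))) * indicator {0..1 / t} v \<partial>lborel)"
      by (rule nn_integral_cong_AE, rule AE_mp[OF AE_lborel_singleton[of 0] AE_I2])
        (simp add: ind)
    also have "\<dots> = ennreal (- (t powr (\<alpha> - 1)) * exp (- A * (1 / t)) - (- (t powr (\<alpha> - 1)) * exp (- A * 0)))"
      using A True by (intro nn_integral_FTC_Icc[where F = "\<lambda>v. - (t powr (\<alpha> - 1)) * exp (- A * v)"]) (auto intro!: derivative_eq_intros)
    finally show ?thesis using True by (simp add: algebra_simps)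
  next
    case False
    then show ?thesis by simp
  qed
  have inner_t: "(\<integral>\<^sup>+t. ?F t v \<partial>lborel) = ennreal (A / \<alpha>) * ennreal (indicator {0..} v * (v powr ((1 - \<alpha>) - 1) * exp (- A * v)))" if "v \<noteq> 0" for v
  proof (cases "v > 0")
    case True
    have ind: "indicator {(t, v). 0 < t \<and> 0 < v \<and> v * t \<le> 1} (t, v) = (indicator {0..1 / v} t :: ennreal)"
      if "t \<noteq> 0" for t :: real
      using that True pos_le_divide_eq[of v t 1] by (auto simp: indicator_def mult.commute)
    have "(\<integral>\<^sup>+t. ?F t v \<partial>lborel) = (\<integral>\<^sup>+t. ennreal (A * exp (- A * v)) * ennreal (indicator {0..1 / v} t * t powr (\<alpha> - 1)) \<partial>lborel)"
    proof (rule nn_integral_cong_AE, rule AE_mp[OF AE_lborel_singleton[of 0] AE_I2], rule impI)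
      fix t :: real assume "t \<noteq> 0"
      have "ennreal (t powr (\<alpha> - 1) * (A * exp (- A * v))) * indicator {0..1 / v} t
          = ennreal (A * exp (- A * v)) * ennreal (indicator {0..1 / v} t * t powr (\<alpha> - 1))"
        using A by (auto simp: ennreal_mult'[symmetric] mult_ac split: split_indicator)
      then show "?F t v = ennreal (A * exp (- A * v)) * ennreal (indicator {0..1 / v} t * t powr (\<alpha> - 1))"
        unfolding ind[OF \<open>t \<noteq> 0\<close>] .
    qed
    also have "\<dots> = ennreal (A * exp (- A * v)) * (\<integral>\<^sup>+t. ennreal (indicator {0..1 / v} t * t powr (\<alpha> - 1)) \<partial>lborel)"
      by (rule nn_integral_cmult) measurable
    also have "(\<integral>\<^sup>+t. ennreal (indicator {0..1 / v} t * t powr (\<alpha> - 1)) \<partial>lborel) = ennreal ((1 / v) powr \<alpha> / \<alpha>)"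
      using has_integral_powr_from_0[of "\<alpha> - 1" "1 / v"] \<alpha> True
      by (intro nn_integral_has_integral_lebesgue) auto
    also have "ennreal (A * exp (- A * v)) * ennreal ((1 / v) powr \<alpha> / \<alpha>) = ennreal (A * exp (- A * v) * ((1 / v) powr \<alpha> / \<alpha>))"
      by (rule ennreal_mult'[symmetric]) (use A in simp)
    also have "A * exp (- A * v) * ((1 / v) powr \<alpha> / \<alpha>) = A / \<alpha> * (v powr ((1 - \<alpha>) - 1) * exp (- A * v))"
      using True by (simp add: powr_divide powr_minus_divide)
    also have "ennreal (A / \<alpha> * (v powr ((1 - \<alpha>) - 1) * exp (- A * v)))
        = ennreal (A / \<alpha>) * ennreal (v powr ((1 - \<alpha>) - 1) * exp (- A * v))"
      by (rule ennreal_mult') (use A \<alpha> in simp)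
    finally show ?thesis using True by simp
  next
    case False
    with that show ?thesis by simp
  qed
  have "(\<integral>\<^sup>+t. ennreal (indicator {0<..} t * (t powr (\<alpha> - 1) * (1 - exp (- A / t)))) \<partial>lborel)
      = (\<integral>\<^sup>+t. (\<integral>\<^sup>+v. ?F t v \<partial>lborel) \<partial>lborel)"
    unfolding inner_v ..
  also have "\<dots> = (\<integral>\<^sup>+v. (\<integral>\<^sup>+t. ?F t v \<partial>lborel) \<partial>lborel)"
    by (rule lborel_pair.Fubini'[symmetric]) measurable
  also have "\<dots> = (\<integral>\<^sup>+v. ennreal (A / \<alpha>) * ennreal (indicator {0..} v * (v powr ((1 - \<alpha>) - 1) * exp (- A * v))) \<partial>lborel)"
    by (rule nn_integral_cong_AE, rule AE_mp[OF AE_lborel_singleton[of 0] AE_I2]) (use inner_t in blast)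
  also have "\<dots> = ennreal (A / \<alpha>) * ennreal (Gamma (1 - \<alpha>) / A powr (1 - \<alpha>))"
    using \<alpha> A by (subst nn_integral_cmult) (measurable, simp only: nn_integral_Gamma_rate diff_gt_0_iff_gt)
  also have "\<dots> = ennreal (A powr \<alpha> * Gamma (1 - \<alpha>) / \<alpha>)"
  proof -
    have "A / \<alpha> * (Gamma (1 - \<alpha>) / A powr (1 - \<alpha>)) = A powr \<alpha> * Gamma (1 - \<alpha>) / \<alpha>"
      using A by (simp add: powr_diff)
    moreover have "A / \<alpha> \<ge> 0" using A \<alpha> by simp
    ultimately show ?thesis by (metis ennreal_mult')
  qed
  finally show ?thesis .
next
  case True
  show ?thesis unfolding True by simp
qed

section \<open>The normalising constant and the symbol of the fractional Laplacian\<close>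

lemma abs_Gamma_uminus:
  assumes "0 < \<alpha>" "\<alpha> < (1::real)"
  shows "\<bar>Gamma (- \<alpha>)\<bar> = Gamma (1 - \<alpha>) / \<alpha>"
proof -
  have "- \<alpha> \<notin> \<int>\<^sub>\<le>\<^sub>0"
  proof
    assume "- \<alpha> \<in> \<int>\<^sub>\<le>\<^sub>0"
    then obtain n where "- \<alpha> = of_int n" by (elim nonpos_Ints_cases)
    then have "real_of_int (- 1) < of_int n" "real_of_int n < of_int 0" using assms by auto
    then show False by (simp only: of_int_less_iff)
  qed
  then have "Gamma (1 - \<alpha>) = - \<alpha> * Gamma (- \<alpha>)"
    using Gamma_plus1[of "- \<alpha>"] by simp
  moreover have "Gamma (1 - \<alpha>) > 0" using assms by (intro Gamma_real_pos) simp
  ultimately show ?thesis using assms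
    by (auto simp: abs_if mult_less_0_iff)
qed

lemma frac_laplace_const_pos:
  assumes "0 < \<beta>" "\<beta> < 2"
  shows "frac_laplace_const \<beta> d > 0"
proof -
  have "\<bar>Gamma (- (\<beta> / 2))\<bar> > 0"
    using assms by (subst abs_Gamma_uminus) (auto intro!: divide_pos_pos Gamma_real_pos)
  moreover have "Gamma ((real d + \<beta>) / 2) > 0" using assms by (intro Gamma_real_pos) simp
  ultimately show ?thesis unfolding frac_laplace_const_def by simp
qed

text \<open>The factor \<open>1/|\<Gamma>(-\<beta>/2)|\<close> vanishes linearly at \<open>\<beta> = 2\<close>, where Gamma has a pole; the remaining factors are
continuous on the compact interval \<open>[1, 2]\<close>.\<close>

lemma frac_laplace_const_le:
  "\<exists>C>0. \<forall>\<beta>. 1 \<le> \<beta> \<and> \<beta> < 2 \<longrightarrow> frac_laplace_const \<beta> d \<le> C * (2 - \<beta>)"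
proof -
  define h where "h = (\<lambda>\<beta>. 2 powr \<beta> * Gamma ((real d + \<beta>) / 2) / pi powr (real d / 2) * (\<beta> / 4) / Gamma (2 - \<beta> / 2))"
  have nz: "Gamma (2 - \<beta> / 2) > 0" if "\<beta> \<in> {1..2}" for \<beta> :: real
    using that by (intro Gamma_real_pos) auto
  have "continuous_on {1..2} h" unfolding h_def
  proof (intro continuous_at_imp_continuous_on ballI)
    fix \<beta> :: real assume b: "\<beta> \<in> {1..2}"
    have "isCont (\<lambda>\<beta>. Gamma ((real d + \<beta>) / 2)) \<beta>"
      by (rule isCont_Gamma, intro continuous_intros) (use b in \<open>auto dest!: nonpos_Ints_nonpos\<close>)
    moreover have "isCont (\<lambda>\<beta>. Gamma (2 - \<beta> / 2)) \<beta>"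
      by (rule isCont_Gamma, intro continuous_intros) (use b in \<open>auto dest!: nonpos_Ints_nonpos\<close>)
    moreover have "isCont (\<lambda>\<beta>::real. 2 powr \<beta>) \<beta>"
      by (intro continuous_intros) simp
    ultimately show "isCont (\<lambda>\<beta>. 2 powr \<beta> * Gamma ((real d + \<beta>) / 2) / pi powr (real d / 2) * (\<beta> / 4) / Gamma (2 - \<beta> / 2)) \<beta>"
      using nz[OF b] by (intro isCont_divide isCont_mult continuous_const continuous_ident) simp_all
  qed
  then have "bounded (h ` {1..2})" by (intro compact_imp_bounded compact_continuous_image) auto
  then obtain C where C: "C > 0" "\<And>\<beta>. \<beta> \<in> {1..2} \<Longrightarrow> \<bar>h \<beta>\<bar> \<le> C"
    unfolding bounded_pos by auto
  have "frac_laplace_const \<beta> d \<le> C * (2 - \<beta>)" if b: "1 \<le> \<beta>" "\<beta> < 2" for \<beta>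
  proof -
    have "Gamma (1 - \<beta> / 2 + 1) = (1 - \<beta> / 2) * Gamma (1 - \<beta> / 2)"
      using b by (intro Gamma_plus1) (auto dest!: nonpos_Ints_nonpos)
    then have "Gamma (1 - \<beta> / 2) = Gamma (2 - \<beta> / 2) / (1 - \<beta> / 2)"
      using b by (simp add: field_simps)
    then have "\<bar>Gamma (- (\<beta> / 2))\<bar> = Gamma (2 - \<beta> / 2) / ((1 - \<beta> / 2) * (\<beta> / 2))"
      using b by (subst abs_Gamma_uminus) auto
    also have "(1 - \<beta> / 2) * (\<beta> / 2) = (\<beta> / 4) * (2 - \<beta>)" by (simp add: field_simps)
    finally have G: "\<bar>Gamma (- \<beta> / 2)\<bar> = Gamma (2 - \<beta> / 2) / ((\<beta> / 4) * (2 - \<beta>))" by simp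
    have "frac_laplace_const \<beta> d = h \<beta> * (2 - \<beta>)"
      unfolding frac_laplace_const_def h_def G by simp
    also have "\<dots> \<le> C * (2 - \<beta>)"
      using C(2)[of \<beta>] b by (intro mult_right_mono) auto
    finally show ?thesis .
  qed
  with C(1) show ?thesis by blast
qed

text \<open>Writing \<open>|\<sigma>|^(-d-\<beta>)\<close> as a Gamma integral over \<open>exp (- t |\<sigma>|^2)\<close> reduces the singular integral to Gaussian
cosine integrals, and the remaining integral over \<open>t\<close> is the Levy integral of exponent \<open>\<beta>/2\<close>.\<close>

lemma frac_laplace_symbol:
  fixes \<xi> :: "'a::euclidean_space"
  assumes \<beta>: "0 < \<beta>" "\<beta> < 2"
  shows "(\<integral>\<^sup>+\<sigma>. ennreal (1 / norm \<sigma> powr (real DIM('a) + \<beta>) * (1 - cos (\<sigma> \<bullet> \<xi>))) \<partial>lborel)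
    = ennreal (norm \<xi> powr \<beta> / frac_laplace_const \<beta> DIM('a))"
proof -
  define p where "p = (real DIM('a) + \<beta>) / 2"
  have p: "p > 0" using \<beta> by (simp add: p_def add_pos_pos)
  have Gp: "Gamma p > 0" using p by (rule Gamma_real_pos)
  let ?w = "\<lambda>t. indicator {0..} t * t powr (p - 1) :: real"
  let ?F = "\<lambda>\<sigma> t. ennreal (1 / Gamma p * ?w t * (exp (- (norm \<sigma>)\<^sup>2 * t) * (1 - cos (\<sigma> \<bullet> \<xi>))))"
  let ?levy = "\<lambda>t. indicator {0<..} t * (t powr (\<beta> / 2 - 1) * (1 - exp (- ((norm \<xi>)\<^sup>2 / 4) / t))) :: real"
  have rep: "ennreal (1 / norm \<sigma> powr (real DIM('a) + \<beta>) * (1 - cos (\<sigma> \<bullet> \<xi>))) = (\<integral>\<^sup>+t. ?F \<sigma> t \<partial>lborel)" for \<sigma>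
  \<comment> \<open>at \<open>\<sigma> = 0\<close> the weight is \<open>1 / 0 = 0\<close>\<close>
  proof (cases "\<sigma> = 0")
    case False
    have "(\<integral>\<^sup>+t. ?F \<sigma> t \<partial>lborel)
      = (\<integral>\<^sup>+t. ennreal ((1 - cos (\<sigma> \<bullet> \<xi>)) / Gamma p) * ennreal (indicator {0..} t * (t powr (p - 1) * exp (- (norm \<sigma>)\<^sup>2 * t))) \<partial>lborel)"
      using Gp by (intro nn_integral_cong) (simp add: ennreal_mult'[symmetric] mult_ac)
    also have "\<dots> = ennreal ((1 - cos (\<sigma> \<bullet> \<xi>)) / Gamma p) * ennreal (Gamma p / ((norm \<sigma>)\<^sup>2) powr p)"
      using False p by (subst nn_integral_cmult) (measurable, subst nn_integral_Gamma_rate, auto)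
    also have "\<dots> = ennreal ((1 - cos (\<sigma> \<bullet> \<xi>)) / Gamma p * (Gamma p / ((norm \<sigma>)\<^sup>2) powr p))"
      by (rule ennreal_mult'[symmetric]) (use Gp in simp)
    also have "((norm \<sigma>)\<^sup>2) powr p = norm \<sigma> powr (real DIM('a) + \<beta>)"
    proof -
      have "2 * p = real DIM('a) + \<beta>" by (simp add: p_def)
      moreover have "((norm \<sigma>)\<^sup>2) powr p = norm \<sigma> powr (2 * p)"
        by (subst powr_powr[symmetric]) simp
      ultimately show ?thesis by simp
    qed
    finally show ?thesis using Gp by simp
  qed simp
  have inner: "(\<integral>\<^sup>+\<sigma>. ?F \<sigma> t \<partial>lborel) = ennreal (sqrt pi ^ DIM('a) / Gamma p)
      * ennreal (?levy t)" if "t \<noteq> 0" for t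
  proof (cases "t > 0")
    case True
    have i: "integrable lborel (\<lambda>\<sigma>::'a. gaussian t \<sigma> - gaussian t \<sigma> * cos (\<sigma> \<bullet> \<xi>))"
      by (intro Bochner_Integration.integrable_diff gaussian_integral(1) gaussian_cos_integral(1) True)
    have "(\<integral>\<^sup>+\<sigma>. ?F \<sigma> t \<partial>lborel) = (\<integral>\<^sup>+\<sigma>. ennreal (?w t / Gamma p) * ennreal (gaussian t \<sigma> - gaussian t \<sigma> * cos (\<sigma> \<bullet> \<xi>)) \<partial>lborel)"
      using Gp by (intro nn_integral_cong) (simp add: ennreal_mult'[symmetric] algebra_simps diff_divide_distrib)
    also have "\<dots> = ennreal (?w t / Gamma p) * (\<integral>\<^sup>+\<sigma>. ennreal (gaussian t \<sigma> - gaussian t \<sigma> * cos (\<sigma> \<bullet> \<xi>)) \<partial>lborel)"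
      by (rule nn_integral_cmult) measurable
    also have "(\<integral>\<^sup>+\<sigma>. ennreal (gaussian t \<sigma> - gaussian t \<sigma> * cos (\<sigma> \<bullet> \<xi>)) \<partial>lborel)
        = ennreal (\<integral>\<sigma>. gaussian t \<sigma> - gaussian t \<sigma> * cos (\<sigma> \<bullet> \<xi>) \<partial>lborel)"
      by (rule nn_integral_eq_integral[OF i]) (auto intro!: AE_I2 simp: mult_left_le)
    also have "(\<integral>\<sigma>. gaussian t \<sigma> - gaussian t \<sigma> * cos (\<sigma> \<bullet> \<xi>) \<partial>lborel)
        = sqrt (pi / t) ^ DIM('a) * (1 - exp (- (norm \<xi>)\<^sup>2 / (4 * t)))"
      by (subst Bochner_Integration.integral_diff)
        (simp_all only: gaussian_integral[OF True] gaussian_cos_integral[OF True] right_diff_distrib mult_1_right)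
    also have "ennreal (?w t / Gamma p) * ennreal (sqrt (pi / t) ^ DIM('a) * (1 - exp (- (norm \<xi>)\<^sup>2 / (4 * t))))
      = ennreal (?w t / Gamma p * (sqrt (pi / t) ^ DIM('a) * (1 - exp (- (norm \<xi>)\<^sup>2 / (4 * t)))))"
      by (rule ennreal_mult'[symmetric]) (use Gp in simp)
    also have "?w t / Gamma p * (sqrt (pi / t) ^ DIM('a) * (1 - exp (- (norm \<xi>)\<^sup>2 / (4 * t))))
      = sqrt pi ^ DIM('a) / Gamma p * (?levy t)"
    proof -
      have "sqrt t ^ DIM('a) = t powr (real DIM('a) / 2)"
        using True by (simp add: powr_half_sqrt[symmetric] powr_power)
      then have "t powr (p - 1) = t powr (\<beta> / 2 - 1) * sqrt t ^ DIM('a)"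
        by (simp add: p_def add_divide_distrib algebra_simps flip: powr_add)
      then show ?thesis using True by (simp add: real_sqrt_divide power_divide)
    qed
    also have "ennreal \<dots> = ennreal (sqrt pi ^ DIM('a) / Gamma p)
        * ennreal (?levy t)"
      by (rule ennreal_mult') (use Gp in simp)
    finally show ?thesis .
  next
    case False
    with that show ?thesis by simp
  qed
  have "(\<integral>\<^sup>+\<sigma>. ennreal (1 / norm \<sigma> powr (real DIM('a) + \<beta>) * (1 - cos (\<sigma> \<bullet> \<xi>))) \<partial>lborel)
    = (\<integral>\<^sup>+\<sigma>. (\<integral>\<^sup>+t. ?F \<sigma> t \<partial>lborel) \<partial>lborel)"
    unfolding rep ..
  also have "\<dots> = (\<integral>\<^sup>+t. (\<integral>\<^sup>+\<sigma>. ?F \<sigma> t \<partial>lborel) \<partial>lborel)"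
    by (rule lborel_pair.Fubini'[symmetric]) measurable
  also have "\<dots> = (\<integral>\<^sup>+t. ennreal (sqrt pi ^ DIM('a) / Gamma p)
      * ennreal (?levy t) \<partial>lborel)"
    by (rule nn_integral_cong_AE, rule AE_mp[OF AE_lborel_singleton[of 0] AE_I2]) (use inner in blast)
  also have "\<dots> = ennreal (sqrt pi ^ DIM('a) / Gamma p) * ennreal (((norm \<xi>)\<^sup>2 / 4) powr (\<beta> / 2) * Gamma (1 - \<beta> / 2) / (\<beta> / 2))"
    using \<beta> by (subst nn_integral_cmult) (measurable, subst nn_integral_levy_powr, auto)
  also have "\<dots> = ennreal (sqrt pi ^ DIM('a) / Gamma p * (((norm \<xi>)\<^sup>2 / 4) powr (\<beta> / 2) * Gamma (1 - \<beta> / 2) / (\<beta> / 2)))"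
    by (rule ennreal_mult'[symmetric]) (use Gp in simp)
  also have "sqrt pi ^ DIM('a) / Gamma p * (((norm \<xi>)\<^sup>2 / 4) powr (\<beta> / 2) * Gamma (1 - \<beta> / 2) / (\<beta> / 2))
      = norm \<xi> powr \<beta> / frac_laplace_const \<beta> DIM('a)"
  proof -
    have 1: "((norm \<xi>)\<^sup>2 / 4) powr (\<beta> / 2) = norm \<xi> powr \<beta> / 2 powr \<beta>"
    proof -
      have "(norm \<xi>)\<^sup>2 / 4 = (norm \<xi> / 2) powr 2" by (simp add: power_divide)
      then have "((norm \<xi>)\<^sup>2 / 4) powr (\<beta> / 2) = (norm \<xi> / 2) powr \<beta>" by (simp only: powr_powr) simp
      then show ?thesis by (simp add: powr_divide)
    qed
    have 2: "sqrt pi ^ DIM('a) = pi powr (real DIM('a) / 2)"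
      by (simp add: powr_half_sqrt[symmetric] powr_power)
    have 3: "\<bar>Gamma (- (\<beta> / 2))\<bar> = Gamma (1 - \<beta> / 2) / (\<beta> / 2)"
      using \<beta> by (intro abs_Gamma_uminus) auto
    show ?thesis unfolding frac_laplace_const_def minus_divide_left[symmetric] 1 2 3 p_def[symmetric] by (simp add: mult_ac)
  qed
  finally show ?thesis .
qed

section \<open>Transfer of positivity from Gaussians to stable characteristic functions\<close>

abbreviation stable_char :: "real \<Rightarrow> 'a::real_normed_vector \<Rightarrow> real" where
  "stable_char \<beta> \<xi> \<equiv> exp (- (norm \<xi> powr \<beta>))"

text \<open>Multiplying the test function by \<open>exp (- |\<xi>|^2/t)\<close> only increases the parameter \<open>\<eta>\<close>, so positivity against all
Gaussians is preserved under multiplication by a positive mixture \<open>\<nu>\<close> of such factors, hence by all powers of \<open>\<nu>\<close> and,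
by the exponential series, by \<open>exp \<nu>\<close>. The compound Poisson exponential is \<open>exp (\<nu> - M)\<close> with \<open>M\<close> the total mass of the
mixture.\<close>

lemma compound_poisson_positivity:
  fixes W :: "'a::euclidean_space \<Rightarrow> real" and w :: "real \<Rightarrow> real"
  assumes Wm[measurable]: "W \<in> borel_measurable borel"
    and W_int: "\<And>\<eta>. \<eta> > 0 \<Longrightarrow> integrable lborel (\<lambda>\<xi>. W \<xi> * gaussian \<eta> \<xi>)"
    and W_pos: "\<And>\<eta>. \<eta> > 0 \<Longrightarrow> 0 \<le> (\<integral>\<xi>. W \<xi> * gaussian \<eta> \<xi> \<partial>lborel)"
    and w: "integrable lborel w" "\<And>t. w t \<ge> 0" "\<And>t. t \<le> 0 \<Longrightarrow> w t = 0"
    and \<eta>: "\<eta> > 0"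
  shows "0 \<le> (\<integral>\<xi>. W \<xi> * exp (- (\<integral>t. w t * (1 - exp (- ((norm \<xi>)\<^sup>2 / t))) \<partial>lborel)) * gaussian \<eta> \<xi> \<partial>lborel)"
proof -
  have wm[measurable]: "w \<in> borel_measurable borel" using borel_measurable_integrable[OF w(1)] by simp
  define E where "E = (\<lambda>\<xi>::'a. \<lambda>t. w t * exp (- ((norm \<xi>)\<^sup>2 / t)))"
  define \<nu> where "\<nu> = (\<lambda>\<xi>. \<integral>t. E \<xi> t \<partial>lborel)"
  define M where "M = integral\<^sup>L lborel w"
  have E_bd: "0 \<le> E \<xi> t" "E \<xi> t \<le> w t" for \<xi> t
    using w(2)[of t] w(3)[of t] by (cases "t \<le> 0"; simp add: E_def mult_left_le)+
  have E_int: "integrable lborel (E \<xi>)" for \<xi>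
    by (rule Bochner_Integration.integrable_bound[OF w(1)])
      (use E_bd w(2) in \<open>auto simp: E_def\<close>)
  have \<nu>m[measurable]: "\<nu> \<in> borel_measurable borel" unfolding \<nu>_def E_def by measurable
  have \<nu>_bd: "0 \<le> \<nu> \<xi>" "\<nu> \<xi> \<le> M" for \<xi>
    unfolding \<nu>_def M_def using E_bd w(1) E_int
    by (auto intro: integral_nonneg_AE integral_mono)
  have \<nu>_pow: "0 \<le> \<nu> \<xi> ^ k" "\<nu> \<xi> ^ k \<le> M ^ k" for \<xi> k
    using \<nu>_bd[of \<xi>] by (auto intro: power_mono)
  have int_bd: "integrable lborel (\<lambda>\<xi>. W \<xi> * f \<xi> * gaussian \<eta> \<xi>)"
    if "\<eta> > 0" "\<And>\<xi>. \<bar>f \<xi>\<bar> \<le> B" and [measurable]: "f \<in> borel_measurable borel" for f B and \<eta> :: real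
  proof (rule Bochner_Integration.integrable_bound[OF integrable_mult_right[OF W_int[OF that(1)], of B]])
    show "AE \<xi> in lborel. norm (W \<xi> * f \<xi> * gaussian \<eta> \<xi>) \<le> norm (B * (W \<xi> * gaussian \<eta> \<xi>))"
    proof (rule AE_I2)
      fix \<xi> :: 'a
      have "\<bar>W \<xi> * gaussian \<eta> \<xi>\<bar> * \<bar>f \<xi>\<bar> \<le> \<bar>W \<xi> * gaussian \<eta> \<xi>\<bar> * \<bar>B\<bar>"
        using that(2)[of \<xi>] by (intro mult_left_mono) auto
      then show "norm (W \<xi> * f \<xi> * gaussian \<eta> \<xi>) \<le> norm (B * (W \<xi> * gaussian \<eta> \<xi>))"
        by (simp add: abs_mult mult_ac)
    qed
  qed measurable
  have pow_pos: "0 \<le> (\<integral>\<xi>. W \<xi> * \<nu> \<xi> ^ k * gaussian \<eta> \<xi> \<partial>lborel)" if "\<eta> > 0" for k \<eta>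
    using that
  proof (induction k arbitrary: \<eta>)
    case 0
    then show ?case using W_pos by simp
  next
    case (Suc k)
    let ?F = "\<lambda>\<xi> t. W \<xi> * \<nu> \<xi> ^ k * gaussian \<eta> \<xi> * E \<xi> t"
    have "(\<integral>\<xi>. W \<xi> * \<nu> \<xi> ^ Suc k * gaussian \<eta> \<xi> \<partial>lborel) = (\<integral>\<xi>. (\<integral>t. ?F \<xi> t \<partial>lborel) \<partial>lborel)"
      by (intro Bochner_Integration.integral_cong refl) (simp add: \<nu>_def mult_ac)
    also have "\<dots> = (\<integral>t. (\<integral>\<xi>. ?F \<xi> t \<partial>lborel) \<partial>lborel)"
    proof (rule Fubini_lborel_product_bound[OF _ integrable_norm[OF int_bd[OF Suc.prems, of "\<lambda>\<xi>. \<nu> \<xi> ^ k" "M ^ k"]] w(1)])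
      show "case_prod ?F \<in> borel_measurable (borel \<Otimes>\<^sub>M borel)" unfolding E_def by measurable
      show "norm (?F \<xi> t) \<le> norm (W \<xi> * \<nu> \<xi> ^ k * gaussian \<eta> \<xi>) * w t" for \<xi> t
        unfolding norm_mult[of _ "E \<xi> t"] using E_bd[of \<xi> t] by (intro mult_left_mono) auto
    qed (use \<nu>_pow in auto)
    also have "\<dots> \<ge> 0"
    proof (rule integral_nonneg_AE, rule AE_I2)
      fix t :: real
      show "0 \<le> (\<integral>\<xi>. ?F \<xi> t \<partial>lborel)"
      proof (cases "t > 0")
        case True
        have "(\<integral>\<xi>. ?F \<xi> t \<partial>lborel) = (\<integral>\<xi>. w t * (W \<xi> * \<nu> \<xi> ^ k * gaussian (\<eta> + 1 / t) \<xi>) \<partial>lborel)"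
          by (intro Bochner_Integration.integral_cong refl) (simp add: E_def algebra_simps flip: exp_add)
        also have "\<dots> = w t * (\<integral>\<xi>. W \<xi> * \<nu> \<xi> ^ k * gaussian (\<eta> + 1 / t) \<xi> \<partial>lborel)"
          by (rule integral_mult_right_zero)
        also have "\<dots> \<ge> 0"
        proof (intro mult_nonneg_nonneg w(2) Suc.IH)
          show "\<eta> + 1 / t > 0" using Suc.prems True by (simp add: add_pos_pos)
        qed
        finally show ?thesis .
      next
        case False
        then show ?thesis using w(3)[of t] by (simp add: E_def)
      qed
    qed
    finally show ?case .
  qed
  have exp_pos: "0 \<le> (\<integral>\<xi>. W \<xi> * exp (\<nu> \<xi>) * gaussian \<eta> \<xi> \<partial>lborel)"
  proof (rule LIMSEQ_le_const)
    let ?S = "\<lambda>n \<xi>. \<Sum>k<n. \<nu> \<xi> ^ k / fact k"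
    have sums: "(\<lambda>k. \<nu> \<xi> ^ k / fact k) sums exp (\<nu> \<xi>)" for \<xi>
      using exp_converges[of "\<nu> \<xi>"] by (simp add: divide_inverse mult.commute)
    have S_bd: "\<bar>?S n \<xi>\<bar> \<le> exp M" for n \<xi>
    proof -
      have "?S n \<xi> \<le> exp (\<nu> \<xi>)"
        using sums[of \<xi>] \<nu>_pow(1)[of \<xi>] by (subst sums_unique[OF sums]) (intro sum_le_suminf sums_summable[OF sums], auto)
      moreover have "0 \<le> ?S n \<xi>" using \<nu>_pow(1)[of \<xi>] by (intro sum_nonneg) auto
      moreover have "exp (\<nu> \<xi>) \<le> exp M" using \<nu>_bd by simp
      ultimately show ?thesis by linarith
    qed
    show "(\<lambda>n. \<integral>\<xi>. W \<xi> * ?S n \<xi> * gaussian \<eta> \<xi> \<partial>lborel)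
        \<longlonglongrightarrow> (\<integral>\<xi>. W \<xi> * exp (\<nu> \<xi>) * gaussian \<eta> \<xi> \<partial>lborel)"
    proof (rule integral_dominated_convergence[where w = "\<lambda>\<xi>. norm (W \<xi> * gaussian \<eta> \<xi>) * exp M"])
      show "integrable lborel (\<lambda>\<xi>. norm (W \<xi> * gaussian \<eta> \<xi>) * exp M)"
        using W_int[OF \<eta>] by simp
      show "AE \<xi> in lborel. (\<lambda>n. W \<xi> * ?S n \<xi> * gaussian \<eta> \<xi>) \<longlonglongrightarrow> W \<xi> * exp (\<nu> \<xi>) * gaussian \<eta> \<xi>"
        using sums unfolding sums_def by (intro AE_I2 tendsto_intros)
      show "AE \<xi> in lborel. norm (W \<xi> * ?S n \<xi> * gaussian \<eta> \<xi>) \<le> norm (W \<xi> * gaussian \<eta> \<xi>) * exp M" for n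
      proof (rule AE_I2)
        fix \<xi>
        have "\<bar>W \<xi> * gaussian \<eta> \<xi>\<bar> * \<bar>?S n \<xi>\<bar> \<le> \<bar>W \<xi> * gaussian \<eta> \<xi>\<bar> * exp M"
          by (intro mult_left_mono S_bd) auto
        then show "norm (W \<xi> * ?S n \<xi> * gaussian \<eta> \<xi>) \<le> norm (W \<xi> * gaussian \<eta> \<xi>) * exp M"
          by (simp only: abs_mult real_norm_def mult_ac)
      qed
    qed measurable
    have "0 \<le> (\<integral>\<xi>. W \<xi> * ?S n \<xi> * gaussian \<eta> \<xi> \<partial>lborel)" for n
    proof -
      have "(\<integral>\<xi>. W \<xi> * ?S n \<xi> * gaussian \<eta> \<xi> \<partial>lborel)
          = (\<integral>\<xi>. (\<Sum>k<n. (W \<xi> * \<nu> \<xi> ^ k * gaussian \<eta> \<xi>) / fact k) \<partial>lborel)"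
        by (intro Bochner_Integration.integral_cong refl) (simp add: sum_distrib_left sum_distrib_right)
      also have "\<dots> = (\<Sum>k<n. (\<integral>\<xi>. (W \<xi> * \<nu> \<xi> ^ k * gaussian \<eta> \<xi>) / fact k \<partial>lborel))"
      proof (intro Bochner_Integration.integral_sum integrable_divide)
        fix k show "integrable lborel (\<lambda>\<xi>. W \<xi> * \<nu> \<xi> ^ k * gaussian \<eta> \<xi>)"
          by (rule int_bd[OF \<eta>, of _ "M ^ k"]) (use \<nu>_pow in auto)
      qed
      also have "\<dots> \<ge> 0" using pow_pos[OF \<eta>] by (intro sum_nonneg) simp
      finally show ?thesis .
    qed
    then show "\<exists>N. \<forall>n\<ge>N. 0 \<le> (\<integral>\<xi>. W \<xi> * ?S n \<xi> * gaussian \<eta> \<xi> \<partial>lborel)" by blast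
  qed
  have eq: "(\<integral>t. w t * (1 - exp (- ((norm \<xi>)\<^sup>2 / t))) \<partial>lborel) = M - \<nu> \<xi>" for \<xi> :: 'a
    unfolding M_def \<nu>_def using w(1) E_int[of \<xi>]
    by (subst Bochner_Integration.integral_diff[symmetric]) (auto simp: E_def right_diff_distrib)
  have "(\<integral>\<xi>. W \<xi> * exp (- (\<integral>t. w t * (1 - exp (- ((norm \<xi>)\<^sup>2 / t))) \<partial>lborel)) * gaussian \<eta> \<xi> \<partial>lborel)
      = (\<integral>\<xi>. exp (- M) * (W \<xi> * exp (\<nu> \<xi>) * gaussian \<eta> \<xi>) \<partial>lborel)"
    by (intro Bochner_Integration.integral_cong refl) (simp only: eq, simp only: minus_diff_eq exp_diff divide_inverse exp_minus mult_ac)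
  also have "\<dots> = exp (- M) * (\<integral>\<xi>. W \<xi> * exp (\<nu> \<xi>) * gaussian \<eta> \<xi> \<partial>lborel)"
    by (rule integral_mult_right_zero)
  also have "\<dots> \<ge> 0" using exp_pos by simp
  finally show ?thesis .
qed

text \<open>Truncating the Levy integral for \<open>|\<xi>|^\<beta>\<close> to \<open>t \<le> n\<close> gives a finite mixing measure, so the compound Poisson case
applies with an extra Gaussian factor. The truncation is removed first, dominated by that factor, and the factor
afterwards, dominated by \<open>W exp (-|\<xi>|^\<beta>)\<close>.\<close>

lemma gaussian_positivity_transfer:
  fixes W :: "'a::euclidean_space \<Rightarrow> real"
  assumes \<beta>: "0 < \<beta>" "\<beta> < 2"
    and Wm[measurable]: "W \<in> borel_measurable borel"
    and W_int: "\<And>\<eta>. \<eta> > 0 \<Longrightarrow> integrable lborel (\<lambda>\<xi>. W \<xi> * gaussian \<eta> \<xi>)"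
    and W_pos: "\<And>\<eta>. \<eta> > 0 \<Longrightarrow> 0 \<le> (\<integral>\<xi>. W \<xi> * gaussian \<eta> \<xi> \<partial>lborel)"
    and W_int': "integrable lborel (\<lambda>\<xi>. W \<xi> * stable_char \<beta> \<xi>)"
  shows "0 \<le> (\<integral>\<xi>. W \<xi> * stable_char \<beta> \<xi> \<partial>lborel)"
proof -
  define \<alpha> where "\<alpha> = \<beta> / 2"
  have \<alpha>: "0 < \<alpha>" "\<alpha> < 1" using \<beta> by (auto simp: \<alpha>_def)
  define \<kappa> where "\<kappa> = \<alpha> / Gamma (1 - \<alpha>)"
  have G: "Gamma (1 - \<alpha>) > 0" using \<alpha> by (intro Gamma_real_pos) simp
  have \<kappa>: "\<kappa> > 0" using \<alpha> G by (simp add: \<kappa>_def)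
  define w where "w = (\<lambda>n::nat. \<lambda>t::real. \<kappa> * (indicator {0<..real n} t * t powr (\<alpha> - 1)))"
  define w' where "w' = (\<lambda>t::real. \<kappa> * (indicator {0<..} t * t powr (\<alpha> - 1)))"
  have w_int: "integrable lborel (w n)" for n
  proof -
    have "(\<lambda>t. t powr (\<alpha> - 1)) absolutely_integrable_on {0..real n}"
      using \<alpha> by (intro nonnegative_absolutely_integrable_1 integrable_on_powr_from_0) auto
    then have "(\<lambda>t. t powr (\<alpha> - 1)) absolutely_integrable_on {0<..real n}"
      by (rule set_integrable_subset) auto
    then have "set_integrable lborel {0<..real n} (\<lambda>t. t powr (\<alpha> - 1))"
      unfolding set_integrable_def by (subst (asm) integrable_completion) auto
    then show ?thesis unfolding w_def set_integrable_def by simp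
  qed
  have w_levy: "has_bochner_integral lborel (\<lambda>t. w' t * (1 - exp (- ((norm \<xi>)\<^sup>2 / t)))) (norm \<xi> powr \<beta>)" for \<xi> :: 'a
  proof (rule has_bochner_integral_nn_integral)
    have "(\<integral>\<^sup>+t. ennreal (w' t * (1 - exp (- ((norm \<xi>)\<^sup>2 / t)))) \<partial>lborel)
        = (\<integral>\<^sup>+t. ennreal \<kappa> * ennreal (indicator {0<..} t * (t powr (\<alpha> - 1) * (1 - exp (- (norm \<xi>)\<^sup>2 / t)))) \<partial>lborel)"
      using \<kappa> by (intro nn_integral_cong) (simp add: w'_def ennreal_mult'[symmetric] mult_ac)
    also have "\<dots> = ennreal \<kappa> * ennreal (((norm \<xi>)\<^sup>2) powr \<alpha> * Gamma (1 - \<alpha>) / \<alpha>)"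
      using \<alpha> by (subst nn_integral_cmult) (measurable, subst nn_integral_levy_powr, auto)
    also have "\<dots> = ennreal (\<kappa> * (((norm \<xi>)\<^sup>2) powr \<alpha> * Gamma (1 - \<alpha>) / \<alpha>))"
      by (rule ennreal_mult'[symmetric]) (use \<kappa> in simp)
    also have "((norm \<xi>)\<^sup>2) powr \<alpha> = norm \<xi> powr \<beta>"
    proof -
      have "((norm \<xi>)\<^sup>2) powr \<alpha> = (norm \<xi> powr 2) powr \<alpha>" by simp
      then show ?thesis by (simp only: powr_powr \<alpha>_def) simp
    qed
    also have "\<kappa> * (norm \<xi> powr \<beta> * Gamma (1 - \<alpha>) / \<alpha>) = norm \<xi> powr \<beta>"
      using less_imp_neq[OF G] \<alpha> by (auto simp: \<kappa>_def)
    finally show "(\<integral>\<^sup>+t. ennreal (w' t * (1 - exp (- ((norm \<xi>)\<^sup>2 / t)))) \<partial>lborel) = ennreal (norm \<xi> powr \<beta>)" .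
    show "AE t in lborel. 0 \<le> w' t * (1 - exp (- ((norm \<xi>)\<^sup>2 / t)))"
      using \<kappa> by (intro AE_I2) (auto simp: w'_def split: split_indicator)
    show "(\<lambda>t. w' t * (1 - exp (- ((norm \<xi>)\<^sup>2 / t)))) \<in> borel_measurable lborel"
      unfolding w'_def by measurable
  qed simp
  define \<psi> where "\<psi> = (\<lambda>n \<xi>. \<integral>t. w n t * (1 - exp (- ((norm (\<xi>::'a))\<^sup>2 / t))) \<partial>lborel)"
  have w_nonneg: "w n t * (1 - exp (- (s\<^sup>2 / t))) \<ge> 0" for n t and s :: real
    using \<kappa> by (auto simp: w_def split: split_indicator)
  have \<psi>_nonneg: "\<psi> n \<xi> \<ge> 0" for n \<xi>
    unfolding \<psi>_def by (intro integral_nonneg_AE AE_I2 w_nonneg)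
  have \<psi>m[measurable]: "\<psi> n \<in> borel_measurable borel" for n
    unfolding \<psi>_def w_def by measurable
  have \<psi>_lim: "(\<lambda>n. \<psi> n \<xi>) \<longlonglongrightarrow> norm \<xi> powr \<beta>" for \<xi>
    unfolding \<psi>_def has_bochner_integral_integral_eq[OF w_levy[of \<xi>], symmetric]
  proof (rule integral_dominated_convergence)
    show "integrable lborel (\<lambda>t. w' t * (1 - exp (- ((norm \<xi>)\<^sup>2 / t))))"
      using w_levy[of \<xi>] by (simp add: has_bochner_integral_iff)
    show "AE t in lborel. (\<lambda>n. w n t * (1 - exp (- ((norm \<xi>)\<^sup>2 / t)))) \<longlonglongrightarrow> w' t * (1 - exp (- ((norm \<xi>)\<^sup>2 / t)))"
    proof (rule AE_I2)
      fix t :: real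
      obtain N :: nat where N: "t \<le> real N" using real_arch_simple by blast
      have "w n t = w' t" if "n \<ge> N" for n
      proof -
        have "real N \<le> real n" using that by simp
        then show ?thesis using N by (auto simp: w_def w'_def split: split_indicator)
      qed
      then show "(\<lambda>n. w n t * (1 - exp (- ((norm \<xi>)\<^sup>2 / t)))) \<longlonglongrightarrow> w' t * (1 - exp (- ((norm \<xi>)\<^sup>2 / t)))"
        by (intro tendsto_mult tendsto_const tendsto_eventually eventually_sequentiallyI[of N])
    qed
    show "AE t in lborel. norm (w n t * (1 - exp (- ((norm \<xi>)\<^sup>2 / t)))) \<le> w' t * (1 - exp (- ((norm \<xi>)\<^sup>2 / t)))" for n
    proof (rule AE_I2)
      fix t :: real
      show "norm (w n t * (1 - exp (- ((norm \<xi>)\<^sup>2 / t)))) \<le> w' t * (1 - exp (- ((norm \<xi>)\<^sup>2 / t)))"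
        unfolding real_norm_def abs_of_nonneg[OF w_nonneg]
        using \<kappa> by (auto simp: w_def w'_def split: split_indicator)
    qed
  qed (auto simp: w_def w'_def)
  have pos_\<eta>: "0 \<le> (\<integral>\<xi>. W \<xi> * stable_char \<beta> \<xi> * gaussian \<eta> \<xi> \<partial>lborel)" if \<eta>: "\<eta> > 0" for \<eta>
  proof (rule LIMSEQ_le_const)
    show "(\<lambda>n. \<integral>\<xi>. W \<xi> * exp (- \<psi> n \<xi>) * gaussian \<eta> \<xi> \<partial>lborel)
      \<longlonglongrightarrow> (\<integral>\<xi>. W \<xi> * stable_char \<beta> \<xi> * gaussian \<eta> \<xi> \<partial>lborel)"
    proof (rule integral_dominated_convergence[where w = "\<lambda>\<xi>. norm (W \<xi> * gaussian \<eta> \<xi>)"])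
      show "AE \<xi> in lborel. (\<lambda>n. W \<xi> * exp (- \<psi> n \<xi>) * gaussian \<eta> \<xi>) \<longlonglongrightarrow> W \<xi> * stable_char \<beta> \<xi> * gaussian \<eta> \<xi>"
        by (intro AE_I2 tendsto_intros \<psi>_lim)
      show "AE \<xi> in lborel. norm (W \<xi> * exp (- \<psi> n \<xi>) * gaussian \<eta> \<xi>) \<le> norm (W \<xi> * gaussian \<eta> \<xi>)" for n
        using \<psi>_nonneg[of n] by (intro AE_I2) (simp add: abs_mult mult_left_le mult_right_mono)
    qed (use W_int[OF \<eta>] in \<open>auto intro: integrable_norm\<close>)
    have "0 \<le> (\<integral>\<xi>. W \<xi> * exp (- \<psi> n \<xi>) * gaussian \<eta> \<xi> \<partial>lborel)" for n
      unfolding \<psi>_def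
      by (rule compound_poisson_positivity[OF Wm W_int W_pos w_int _ _ \<eta>])
        (use \<kappa> in \<open>auto simp: w_def\<close>)
    then show "\<exists>N. \<forall>n\<ge>N. 0 \<le> (\<integral>\<xi>. W \<xi> * exp (- \<psi> n \<xi>) * gaussian \<eta> \<xi> \<partial>lborel)" by blast
  qed
  show ?thesis
  proof (rule LIMSEQ_le_const)
    show "(\<lambda>n. \<integral>\<xi>. W \<xi> * stable_char \<beta> \<xi> * exp (- inverse (real (Suc n)) * (norm \<xi>)\<^sup>2) \<partial>lborel)
        \<longlonglongrightarrow> (\<integral>\<xi>. W \<xi> * stable_char \<beta> \<xi> \<partial>lborel)"
    proof (rule integral_dominated_convergence[OF _ _ integrable_norm[OF W_int']])
      show "AE \<xi> in lborel. (\<lambda>n. W \<xi> * stable_char \<beta> \<xi> * exp (- inverse (real (Suc n)) * (norm \<xi>)\<^sup>2)) \<longlonglongrightarrow> W \<xi> * stable_char \<beta> \<xi>"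
      proof (rule AE_I2)
        fix \<xi> :: 'a
        have "(\<lambda>n. W \<xi> * stable_char \<beta> \<xi> * exp (- inverse (real (Suc n)) * (norm \<xi>)\<^sup>2)) \<longlonglongrightarrow> W \<xi> * stable_char \<beta> \<xi> * gaussian 0 \<xi>"
          by (intro tendsto_intros LIMSEQ_inverse_real_of_nat)
        then show "(\<lambda>n. W \<xi> * stable_char \<beta> \<xi> * exp (- inverse (real (Suc n)) * (norm \<xi>)\<^sup>2)) \<longlonglongrightarrow> W \<xi> * stable_char \<beta> \<xi>"
          by simp
      qed
    qed (auto intro!: AE_I2 simp: abs_mult mult_left_le)
    show "\<exists>N. \<forall>n\<ge>N. 0 \<le> (\<integral>\<xi>. W \<xi> * stable_char \<beta> \<xi> * exp (- inverse (real (Suc n)) * (norm \<xi>)\<^sup>2) \<partial>lborel)"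
      using pos_\<eta> by simp
  qed
qed

section \<open>The isotropic stable density\<close>

text \<open>The inverse Fourier transform of \<open>exp (-|\<xi>|^\<beta>)\<close>; the sine part vanishes by symmetry.\<close>

definition stable_density :: "real \<Rightarrow> 'a::euclidean_space \<Rightarrow> real" where
  "stable_density \<beta> x = (\<integral>\<xi>. cos (\<xi> \<bullet> x) * stable_char \<beta> \<xi> \<partial>lborel) / (2 * pi) ^ DIM('a)"

lemma lborel_reflect:
  fixes f :: "'a::euclidean_space \<Rightarrow> 'b::{banach, second_countable_topology}"
  assumes [measurable]: "f \<in> borel_measurable borel"
  shows "(\<integral>x. f (- x) \<partial>lborel) = integral\<^sup>L lborel f"
proof -
  have *: "(lborel :: 'a measure) = distr lborel borel (\<lambda>x. - x)"
    using lborel_affine[of "- 1" "0::'a"] by (simp add: density_1)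
  show ?thesis by (subst (2) *) (simp add: integral_distr)
qed

lemma integrable_exp_norm_powr_0:
  assumes \<beta>: "\<beta> > 0"
  shows "integrable lborel (\<lambda>\<xi>::'a::euclidean_space. stable_char \<beta> \<xi>)"
    and "(\<integral>\<xi>. stable_char \<beta> (\<xi>::'a) \<partial>lborel)
      = unit_ball_vol (DIM('a)) * (real DIM('a) / \<beta>) * Gamma (real DIM('a) / \<beta>)"
proof -
  have ae: "AE \<xi>::'a in lborel. stable_char \<beta> \<xi> = (norm \<xi> powr \<beta>) powr 0 * stable_char \<beta> \<xi>"
    by (rule AE_mp[OF AE_lborel_singleton[of 0] AE_I2]) simp
  show "integrable lborel (\<lambda>\<xi>::'a. stable_char \<beta> \<xi>)"
    by (subst integrable_cong_AE[OF _ _ ae]) (use integrable_exp_norm_powr(1)[OF \<beta>, of 0] in auto)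
  show "(\<integral>\<xi>. stable_char \<beta> (\<xi>::'a) \<partial>lborel)
      = unit_ball_vol (DIM('a)) * (real DIM('a) / \<beta>) * Gamma (real DIM('a) / \<beta>)"
    by (subst integral_cong_AE[OF _ _ ae]) (use integrable_exp_norm_powr(2)[OF \<beta>, of 0, where 'a='a] in auto)
qed

lemma integrable_norm_sq_exp_norm_powr:
  assumes \<beta>: "\<beta> > 0"
  shows "integrable lborel (\<lambda>\<xi>::'a::euclidean_space. (norm \<xi>)\<^sup>2 * stable_char \<beta> \<xi>)"
proof -
  have "(norm \<xi> powr \<beta>) powr (2 / \<beta>) = (norm \<xi>)\<^sup>2" for \<xi> :: 'a
    using \<beta> by (simp add: powr_powr)
  then show ?thesis using integrable_exp_norm_powr(1)[OF \<beta>, of "2 / \<beta>", where 'a='a] \<beta> by simp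
qed

lemma integrable_bounded_mult_exp_norm_powr:
  fixes f :: "'a::euclidean_space \<Rightarrow> real"
  assumes \<beta>: "\<beta> > 0" and [measurable]: "f \<in> borel_measurable borel" and f: "\<And>\<xi>. \<bar>f \<xi>\<bar> \<le> 1"
  shows "integrable lborel (\<lambda>\<xi>. f \<xi> * stable_char \<beta> \<xi>)"
  by (rule Bochner_Integration.integrable_bound[OF integrable_exp_norm_powr_0(1)[OF \<beta>]])
    (auto intro!: AE_I2 simp: abs_mult f)

lemma stable_density_bounded:
  assumes \<beta>: "\<beta> > 0"
  shows "\<bar>stable_density \<beta> (x::'a::euclidean_space)\<bar> \<le> stable_density \<beta> (0::'a)"
proof -
  have "\<bar>\<integral>\<xi>. cos (\<xi> \<bullet> x) * stable_char \<beta> \<xi> \<partial>lborel\<bar> \<le> (\<integral>\<xi>. stable_char \<beta> (\<xi>::'a) \<partial>lborel)"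
    by (rule order_trans[OF integral_abs_bound], rule integral_mono)
      (auto intro!: integrable_abs integrable_bounded_mult_exp_norm_powr[OF \<beta>] integrable_exp_norm_powr_0[OF \<beta>] simp: abs_mult)
  then show ?thesis by (simp add: stable_density_def divide_right_mono abs_divide)
qed

lemma stable_density_0_pos:
  assumes \<beta>: "\<beta> > 0"
  shows "stable_density \<beta> (0::'a::euclidean_space) > 0"
  unfolding stable_density_def
  using \<beta> by (auto intro!: divide_pos_pos mult_pos_pos Gamma_real_pos simp: integrable_exp_norm_powr_0(2)[OF \<beta>])

lemma continuous_stable_density:
  assumes \<beta>: "\<beta> > 0"
  shows "continuous_on UNIV (stable_density \<beta> :: 'a::euclidean_space \<Rightarrow> real)"
  unfolding continuous_on_sequentially
proof (intro allI ballI impI)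
  fix X :: "nat \<Rightarrow> 'a" and x assume "(\<forall>n. X n \<in> UNIV) \<and> X \<longlonglongrightarrow> x"
  then have X: "X \<longlonglongrightarrow> x" by simp
  have "(\<lambda>n. \<integral>\<xi>. cos (\<xi> \<bullet> X n) * stable_char \<beta> \<xi> \<partial>lborel) \<longlonglongrightarrow> (\<integral>\<xi>. cos (\<xi> \<bullet> x) * stable_char \<beta> \<xi> \<partial>lborel)"
  proof (rule integral_dominated_convergence[OF _ _ integrable_exp_norm_powr_0(1)[OF \<beta>]])
    show "AE \<xi> in lborel. (\<lambda>n. cos (\<xi> \<bullet> X n) * stable_char \<beta> \<xi>) \<longlonglongrightarrow> cos (\<xi> \<bullet> x) * stable_char \<beta> \<xi>"
      by (intro AE_I2 tendsto_intros X)
  qed (auto simp: abs_mult)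
  then show "(stable_density \<beta> \<circ> X) \<longlonglongrightarrow> stable_density \<beta> x"
    unfolding stable_density_def o_def by (intro tendsto_divide tendsto_const) auto
qed

lemma measurable_stable_density [measurable]:
  "stable_density \<beta> \<in> borel_measurable borel"
  unfolding stable_density_def[abs_def] by measurable

lemma fourier_exp_norm_powr:
  fixes x :: "'a::euclidean_space"
  assumes \<beta>: "\<beta> > 0"
  shows "(\<integral>\<xi>. of_real (stable_char \<beta> \<xi>) * cis (- (\<xi> \<bullet> x)) \<partial>lborel) = of_real ((2 * pi) ^ DIM('a) * stable_density \<beta> x)"
proof -
  let ?c = "\<lambda>\<xi>. cos (\<xi> \<bullet> x) * stable_char \<beta> \<xi>" and ?s = "\<lambda>\<xi>. sin (\<xi> \<bullet> x) * stable_char \<beta> \<xi>"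
  have c: "integrable lborel ?c" and s: "integrable lborel ?s"
    by (intro integrable_bounded_mult_exp_norm_powr[OF \<beta>]; simp)+
  have odd: "(\<integral>\<xi>. ?s \<xi> \<partial>lborel) = 0"
    using lborel_reflect[of ?s] by simp
  have "(\<integral>\<xi>. of_real (stable_char \<beta> \<xi>) * cis (- (\<xi> \<bullet> x)) \<partial>lborel)
      = (\<integral>\<xi>. of_real (?c \<xi>) - \<i> * of_real (?s \<xi>) \<partial>lborel)"
    by (intro Bochner_Integration.integral_cong refl) (simp add: complex_eq_iff del: of_real_exp)
  also have "\<dots> = of_real (\<integral>\<xi>. ?c \<xi> \<partial>lborel) - \<i> * of_real (\<integral>\<xi>. ?s \<xi> \<partial>lborel)"
    using c s by (simp only: Bochner_Integration.integral_diff integrable_mult_right integrable_of_real integral_mult_right_zero integral_complex_of_real)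
  finally show ?thesis by (simp add: odd stable_density_def)
qed

text \<open>A finite linear combination of point values of \<open>\<Phi>\<close> is the integral of \<open>exp (-|\<xi>|^\<beta>)\<close> against a trigonometric
polynomial, and integrating that polynomial against a Gaussian gives the same combination of values of another centred
Gaussian. Thus linear inequalities valid for all centred Gaussians transfer to \<open>\<Phi>\<close>.\<close>

lemma stable_density_combination:
  fixes ps :: "(real \<times> 'a::euclidean_space) list"
  assumes \<beta>: "0 < \<beta>" "\<beta> < 2"
    and pos: "\<And>\<tau>. \<tau> > 0 \<Longrightarrow> 0 \<le> (\<Sum>(a, x)\<leftarrow>ps. a * gaussian \<tau> x)"
  shows "0 \<le> (\<Sum>(a, x)\<leftarrow>ps. a * stable_density \<beta> x)"
proof -
  define W where "W = (\<lambda>\<xi>. \<Sum>(a, x)\<leftarrow>ps. a * cos (\<xi> \<bullet> (x::'a)))"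
  have lin: "integrable lborel (\<lambda>\<xi>. W \<xi> * f \<xi>) \<and>
      (\<integral>\<xi>. W \<xi> * f \<xi> \<partial>lborel) = (\<Sum>(a, x)\<leftarrow>ps. a * (\<integral>\<xi>. cos (\<xi> \<bullet> x) * f \<xi> \<partial>lborel))"
    if "\<And>x. integrable lborel (\<lambda>\<xi>. cos (\<xi> \<bullet> x) * f \<xi>)" for f :: "'a \<Rightarrow> real"
    unfolding W_def by (induction ps) (auto simp: distrib_right mult.assoc that)
  have gauss: "integrable lborel (\<lambda>\<xi>. cos (\<xi> \<bullet> x) * gaussian \<eta> \<xi>)"
    "(\<integral>\<xi>. cos (\<xi> \<bullet> x) * gaussian \<eta> \<xi> \<partial>lborel) = sqrt (pi / \<eta>) ^ DIM('a) * gaussian (1 / (4 * \<eta>)) x"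
    if "\<eta> > 0" for x :: 'a and \<eta>
    using gaussian_cos_integral[OF that, of x] by (simp_all add: mult.commute)
  have stable: "integrable lborel (\<lambda>\<xi>. cos (\<xi> \<bullet> x) * stable_char \<beta> \<xi>)" for x :: 'a
    by (rule integrable_bounded_mult_exp_norm_powr) (use \<beta> in auto)
  have "0 \<le> (\<integral>\<xi>. W \<xi> * stable_char \<beta> \<xi> \<partial>lborel)"
  proof (rule gaussian_positivity_transfer[OF \<beta>])
    show "W \<in> borel_measurable borel" unfolding W_def by (induction ps) auto
    fix \<eta> :: real assume \<eta>: "\<eta> > 0"
    have "0 \<le> sqrt (pi / \<eta>) ^ DIM('a) * (\<Sum>(a, x)\<leftarrow>ps. a * gaussian (1 / (4 * \<eta>)) x)"
      using pos[of "1 / (4 * \<eta>)"] \<eta> by (intro mult_nonneg_nonneg) auto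
    also have "\<dots> = (\<integral>\<xi>. W \<xi> * gaussian \<eta> \<xi> \<partial>lborel)"
      unfolding lin[OF gauss(1)[OF \<eta>], THEN conjunct2] gauss(2)[OF \<eta>]
      by (simp add: sum_list_const_mult[symmetric] case_prod_unfold mult_ac)
    finally show "0 \<le> (\<integral>\<xi>. W \<xi> * gaussian \<eta> \<xi> \<partial>lborel)" .
  qed (use lin gauss stable in auto)
  also have "\<dots> = (\<Sum>(a, x)\<leftarrow>ps. a * (\<integral>\<xi>. cos (\<xi> \<bullet> x) * stable_char \<beta> \<xi> \<partial>lborel))"
    using lin[OF stable] by simp
  also have "\<dots> = (2 * pi) ^ DIM('a) * (\<Sum>(a, x)\<leftarrow>ps. a * stable_density \<beta> x)"
    by (simp add: sum_list_const_mult[symmetric] case_prod_unfold stable_density_def)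
  finally have "0 \<le> (2 * pi) ^ DIM('a) * (\<Sum>(a, x)\<leftarrow>ps. a * stable_density \<beta> x)" .
  moreover have "0 < (2 * pi) ^ DIM('a)" by simp
  ultimately show ?thesis by (meson mult_pos_neg not_le)
qed

section \<open>Log-convexity in the squared radius\<close>

lemma stable_density_nonneg:
  assumes "0 < \<beta>" "\<beta> < 2"
  shows "0 \<le> stable_density \<beta> x"
  using stable_density_combination[OF assms, of "[(1, x)]"] by simp

lemma stable_density_antimono:
  fixes x y :: "'a::euclidean_space"
  assumes "0 < \<beta>" "\<beta> < 2" and "norm x \<le> norm y"
  shows "stable_density \<beta> y \<le> stable_density \<beta> x"
  using stable_density_combination[OF assms(1,2), of "[(1, x), (- 1, y)]"] assms(3)
  by (simp add: power_mono)

text \<open>With \<open>|u|^2 = s\<close> and \<open>|v|^2 = t\<close> this says that \<open>l(0) - l(s)\<close> is subadditive, which holds for convex \<open>l\<close>. For a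
Gaussian \<open>exp (- \<tau> |x|^2)\<close> and any real \<open>c\<close>, the numbers \<open>1 - exp ((c - \<tau>) s)\<close> and \<open>1 - exp ((c - \<tau>) t)\<close> have the same
sign; their product being nonnegative is a linear inequality that transfers. The choice of \<open>c\<close> that equalises the two
terms on the larger side then gives the claim.\<close>

lemma stable_density_supermultiplicative:
  fixes u v w :: "'a::euclidean_space"
  assumes \<beta>: "0 < \<beta>" "\<beta> < 2" and w: "(norm w)\<^sup>2 = (norm u)\<^sup>2 + (norm v)\<^sup>2"
  shows "stable_density \<beta> u * stable_density \<beta> v \<le> stable_density \<beta> (0::'a) * stable_density \<beta> w"
proof -
  let ?f = "stable_density \<beta> :: 'a \<Rightarrow> real"
  have nn: "?f x \<ge> 0" for x using stable_density_nonneg[OF \<beta>] .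
  have f0: "?f 0 > 0" using \<beta> by (intro stable_density_0_pos)
  define s t where "s = (norm u)\<^sup>2" and "t = (norm v)\<^sup>2"
  have st: "s \<ge> 0" "t \<ge> 0" "(norm w)\<^sup>2 = s + t" using w by (auto simp: s_def t_def)
  have lin: "exp (c * s) * ?f u + exp (c * t) * ?f v \<le> ?f 0 + exp (c * (s + t)) * ?f w" for c
  proof -
    have "0 \<le> 1 - exp (c * s) * exp (- \<tau> * s) - exp (c * t) * exp (- \<tau> * t) + exp (c * (s + t)) * exp (- \<tau> * (s + t))" for \<tau>
    proof -
      have "1 - exp (c * s) * exp (- \<tau> * s) - exp (c * t) * exp (- \<tau> * t) + exp (c * (s + t)) * exp (- \<tau> * (s + t))
          = (1 - exp ((c - \<tau>) * s)) * (1 - exp ((c - \<tau>) * t))"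
      proof -
        have e1: "exp (c * x) * exp (- \<tau> * x) = exp ((c - \<tau>) * x)" for x
          unfolding exp_add[symmetric] by (simp add: algebra_simps)
        have e2: "exp ((c - \<tau>) * (s + t)) = exp ((c - \<tau>) * s) * exp ((c - \<tau>) * t)"
          unfolding exp_add[symmetric] by (simp add: algebra_simps)
        show ?thesis unfolding e1 e2 by (simp add: left_diff_distrib right_diff_distrib)
      qed
      also have "\<dots> \<ge> 0"
      proof (cases "c \<le> \<tau>")
        case True
        then show ?thesis using st by (intro mult_nonneg_nonneg) (simp_all add: mult_nonpos_nonneg)
      next
        case False
        then show ?thesis using st by (intro mult_nonpos_nonpos) simp_all
      qed
      finally show ?thesis .
    qed
    then show ?thesis
      using stable_density_combination[OF \<beta>, of "[(1, 0), (- exp (c * s), u), (- exp (c * t), v), (exp (c * (s + t)), w)]"]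
      by (simp add: algebra_simps st s_def[symmetric] t_def[symmetric])
  qed
  show ?thesis
  proof (cases "s + t = 0")
    case True
    then have "s = 0" "t = 0" using st by auto
    then have "u = 0" "v = 0" "w = 0" using st by (auto simp: s_def t_def)
    then show ?thesis by simp
  next
    case False
    then have pos: "s + t > 0" using st by auto
    show ?thesis
    proof (cases "?f w = 0")
      case True
      have "?f u * ?f v \<le> 0"
      proof (rule ccontr)
        assume "\<not> ?thesis"
        then have uv: "?f u > 0" "?f v > 0" using nn[of u] nn[of v] by (auto simp: not_le zero_less_mult_iff)
        have "\<exists>x y. (x = u \<or> x = v) \<and> norm x ^ 2 > 0"
          using pos st unfolding s_def t_def by (metis add.right_neutral zero_less_power2 norm_eq_zero zero_power2 order_less_irrefl norm_zero)
        then obtain x where x: "x = u \<or> x = v" "(norm x)\<^sup>2 > 0" by auto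
        \<comment> \<open>if \<open>\<Phi> w\<close> were \<open>0\<close>, a large \<open>c\<close> would violate \<open>lin\<close>\<close>
        define c where "c = ln ((?f 0 + 1) / ?f x) / (norm x)\<^sup>2"
        have "exp (c * (norm x)\<^sup>2) * ?f x = ?f 0 + 1"
          using x uv f0 by (auto simp: c_def)
        moreover have "exp (c * (norm x)\<^sup>2) * ?f x \<le> ?f 0"
          using lin[of c] True x uv by (auto simp: s_def t_def intro: order_trans[rotated] add_nonneg_nonneg)
        ultimately show False by simp
      qed
      then show ?thesis using True by simp
    next
      case False
      then have fw: "?f w > 0" using nn[of w] by simp
      \<comment> \<open>this \<open>c\<close> makes the two terms on the right of \<open>lin\<close> equal\<close>
      define c where "c = ln (?f 0 / ?f w) / (s + t)"
      have c: "exp (c * (s + t)) * ?f w = ?f 0"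
        using pos fw f0 by (simp add: c_def)
      let ?a = "exp (c * s) * ?f u" and ?b = "exp (c * t) * ?f v"
      have "?a + ?b \<le> 2 * ?f 0" using lin[of c] c by simp
      moreover have "0 \<le> ?a" "0 \<le> ?b" using nn by auto
      ultimately have "(?a + ?b)\<^sup>2 \<le> (2 * ?f 0)\<^sup>2" by (intro power_mono) auto
      moreover have "4 * (?a * ?b) \<le> (?a + ?b)\<^sup>2"
        using zero_le_power2[of "?a - ?b"] by (simp add: power2_eq_square algebra_simps)
      ultimately have "?a * ?b \<le> ?f 0 * ?f 0" by (simp add: power2_eq_square)
      moreover have "?a * ?b = exp (c * (s + t)) * (?f u * ?f v)"
        by (simp add: distrib_left exp_add)
      ultimately have "exp (c * (s + t)) * (?f u * ?f v) * ?f w \<le> ?f 0 * ?f 0 * ?f w"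
        using fw by (intro mult_right_mono) auto
      then have "?f 0 * (?f u * ?f v) \<le> ?f 0 * (?f 0 * ?f w)"
        using c by (simp add: mult_ac)
      then show ?thesis using f0 by simp
    qed
  qed
qed

lemma exists_norm:
  "r \<ge> 0 \<Longrightarrow> \<exists>x::'a::euclidean_space. norm x = r"
  by (metis vector_choose_size)

lemma one_minus_cos_le: "1 - cos t \<le> t\<^sup>2 / (2::real)"
proof -
  have "(sin (t / 2))\<^sup>2 \<le> (t / 2)\<^sup>2"
    using abs_sin_x_le_abs_x[of "t / 2"] by (simp only: abs_le_square_iff)
  then show ?thesis using cos_double_sin[of "t / 2"] by (simp add: power_divide)
qed

text \<open>The expansion of the cosine gives \<open>r(x) \<ge> 1 - A |x|^2\<close>, useful only for small \<open>x\<close>. Supermultiplicativity of \<open>r\<close> in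
\<open>|x|^2\<close> upgrades this to \<open>r(x) \<ge> (1 - A |x|^2/n)^n\<close>, which tends to the stated Gaussian lower bound. In particular
\<open>\<Phi>\<close> is positive.\<close>

lemma stable_density_ratio_ge:
  fixes x :: "'a::euclidean_space"
  assumes \<beta>: "0 < \<beta>" "\<beta> < 2"
  defines "A \<equiv> (\<integral>\<xi>. (norm (\<xi>::'a))\<^sup>2 * stable_char \<beta> \<xi> \<partial>lborel) / (2 * (\<integral>\<xi>. stable_char \<beta> (\<xi>::'a) \<partial>lborel))"
  shows "stable_density \<beta> (0::'a) * gaussian A x \<le> stable_density \<beta> x"
proof -
  let ?f = "stable_density \<beta> :: 'a \<Rightarrow> real"
  let ?m = "\<lambda>\<xi>::'a. stable_char \<beta> \<xi>"
  have f0: "?f 0 > 0" using \<beta> by (intro stable_density_0_pos)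
  have C: "(2 * pi) ^ DIM('a) > (0::real)" by simp
  have f0_eq: "(2 * pi) ^ DIM('a) * ?f 0 = (\<integral>\<xi>. ?m \<xi> \<partial>lborel)"
    by (simp add: stable_density_def)
  have m_pos: "(\<integral>\<xi>. ?m \<xi> \<partial>lborel) > 0" using f0_eq C f0 by (metis mult_pos_pos)
  define r where "r = (\<lambda>y. ?f y / ?f 0)"
  have r_lower: "1 - A * (norm y)\<^sup>2 \<le> r y" for y
  proof -
    have c: "integrable lborel (\<lambda>\<xi>. cos (\<xi> \<bullet> y) * ?m \<xi>)"
      by (intro integrable_bounded_mult_exp_norm_powr) (use \<beta> in auto)
    have "(2 * pi) ^ DIM('a) * (?f 0 - ?f y) = (\<integral>\<xi>. (1 - cos (\<xi> \<bullet> y)) * ?m \<xi> \<partial>lborel)"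
      using c integrable_exp_norm_powr_0(1)[OF \<beta>(1), where 'a='a]
      by (simp add: left_diff_distrib right_diff_distrib stable_density_def)
    also have "\<dots> \<le> (\<integral>\<xi>. ((norm y)\<^sup>2 / 2) * ((norm \<xi>)\<^sup>2 * ?m \<xi>) \<partial>lborel)"
    proof (rule integral_mono)
      show "integrable lborel (\<lambda>\<xi>. (1 - cos (\<xi> \<bullet> y)) * ?m \<xi>)"
        using c integrable_exp_norm_powr_0(1)[OF \<beta>(1), where 'a='a] by (simp add: left_diff_distrib)
      show "integrable lborel (\<lambda>\<xi>. ((norm y)\<^sup>2 / 2) * ((norm \<xi>)\<^sup>2 * ?m \<xi>))"
        using integrable_norm_sq_exp_norm_powr[OF \<beta>(1), where 'a='a] by simp
      fix \<xi> :: 'a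
      have "(\<xi> \<bullet> y)\<^sup>2 \<le> (norm \<xi> * norm y)\<^sup>2"
        using Cauchy_Schwarz_ineq2[of \<xi> y] by (rule power2_le_iff_abs_le[THEN iffD2, rotated]) simp
      then have "1 - cos (\<xi> \<bullet> y) \<le> (norm y)\<^sup>2 / 2 * (norm \<xi>)\<^sup>2"
        using one_minus_cos_le[of "\<xi> \<bullet> y"] by (simp add: power_mult_distrib mult_ac)
      then show "(1 - cos (\<xi> \<bullet> y)) * ?m \<xi> \<le> ((norm y)\<^sup>2 / 2) * ((norm \<xi>)\<^sup>2 * ?m \<xi>)"
        by (simp only: mult.assoc[symmetric]) (intro mult_right_mono, auto)
    qed
    also have "\<dots> = (norm y)\<^sup>2 * A * (\<integral>\<xi>. ?m \<xi> \<partial>lborel)"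
      using m_pos by (simp add: A_def)
    also have "\<dots> = (2 * pi) ^ DIM('a) * ((norm y)\<^sup>2 * A * ?f 0)"
      unfolding f0_eq[symmetric] by simp
    finally have "?f 0 - ?f y \<le> (norm y)\<^sup>2 * A * ?f 0" using C by simp
    then show ?thesis unfolding r_def pos_le_divide_eq[OF f0] by (simp add: algebra_simps)
  qed
  have r_pow: "r y ^ k \<le> r (sqrt (real k) *\<^sub>R y)" for k y
  proof (induction k)
    case 0
    then show ?case using f0 by (simp add: r_def)
  next
    case (Suc k)
    have "r y ^ Suc k \<le> r (sqrt (real k) *\<^sub>R y) * r y"
    proof -
      have "0 \<le> r y" using f0 stable_density_nonneg[OF \<beta>, of y] by (simp add: r_def)
      from mult_right_mono[OF Suc this] show ?thesis by (simp add: mult.commute)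
    qed
    also have "\<dots> = (?f (sqrt (real k) *\<^sub>R y) * ?f y) / (?f 0 * ?f 0)" by (simp add: r_def)
    also have "\<dots> \<le> (?f 0 * ?f (sqrt (real (Suc k)) *\<^sub>R y)) / (?f 0 * ?f 0)"
      using f0 by (intro divide_right_mono stable_density_supermultiplicative[OF \<beta>])
        (auto simp: power_mult_distrib algebra_simps)
    also have "\<dots> = r (sqrt (real (Suc k)) *\<^sub>R y)" using f0 by (simp add: r_def)
    finally show ?case .
  qed
  have "gaussian A x \<le> r x"
  proof (rule LIMSEQ_le_const2)
    show "(\<lambda>n. (1 + (- A * (norm x)\<^sup>2) / real n) ^ n) \<longlonglongrightarrow> gaussian A x"
      by (rule tendsto_exp_limit_sequentially)
    obtain N :: nat where N: "real N > A * (norm x)\<^sup>2" using reals_Archimedean2 by blast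
    have "(1 + (- A * (norm x)\<^sup>2) / real n) ^ n \<le> r x" if "n \<ge> Suc N" for n
    proof -
      have n: "real n > 0" "real n > A * (norm x)\<^sup>2" using that N by auto
      let ?y = "(1 / sqrt (real n)) *\<^sub>R x"
      have "1 + (- A * (norm x)\<^sup>2) / real n = 1 - A * (norm ?y)\<^sup>2"
        using n by (simp add: power_divide)
      then have "1 + (- A * (norm x)\<^sup>2) / real n \<le> r ?y" using r_lower[of ?y] by simp
      moreover have "0 \<le> 1 + (- A * (norm x)\<^sup>2) / real n" using n by (simp add: field_simps)
      ultimately have "(1 + (- A * (norm x)\<^sup>2) / real n) ^ n \<le> r ?y ^ n" by (rule power_mono)
      also have "\<dots> \<le> r (sqrt (real n) *\<^sub>R ?y)" by (rule r_pow)
      also have "sqrt (real n) *\<^sub>R ?y = x" using n by simp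
      finally show ?thesis .
    qed
    then show "\<exists>N. \<forall>n\<ge>N. (1 + (- A * (norm x)\<^sup>2) / real n) ^ n \<le> r x" by blast
  qed
  then show ?thesis using f0 by (simp add: r_def pos_le_divide_eq mult.commute)
qed

lemma stable_density_pos:
  assumes "0 < \<beta>" "\<beta> < 2"
  shows "stable_density \<beta> (x::'a::euclidean_space) > 0"
  by (rule less_le_trans[OF mult_pos_pos[OF stable_density_0_pos[OF assms(1)] exp_gt_zero] stable_density_ratio_ge[OF assms]])

text \<open>Midpoint log-convexity in \<open>|x|^2\<close>. For a Gaussian, the value at \<open>z\<close> is the geometric mean of those at \<open>x\<close> and \<open>y\<close>,
so the inequality between arithmetic and geometric means, weighted by \<open>p\<close> and \<open>q\<close>, is linear and transfers to \<open>\<Phi>\<close>.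
Optimising the weights afterwards recovers the product inequality.\<close>

lemma stable_density_parallelogram:
  fixes x y z :: "'a::euclidean_space"
  assumes \<beta>: "0 < \<beta>" "\<beta> < 2" and z: "2 * (norm z)\<^sup>2 = (norm x)\<^sup>2 + (norm y)\<^sup>2"
  shows "(stable_density \<beta> z)\<^sup>2 \<le> stable_density \<beta> x * stable_density \<beta> y"
proof -
  let ?f = "stable_density \<beta> :: 'a \<Rightarrow> real"
  have amgm: "2 * (p * q) * ?f z \<le> p\<^sup>2 * ?f x + q\<^sup>2 * ?f y" for p q
  proof -
    have "0 \<le> p\<^sup>2 * gaussian \<tau> x + q\<^sup>2 * gaussian \<tau> y - 2 * (p * q) * gaussian \<tau> z" for \<tau>
    proof -
      let ?u = "exp (- \<tau> * (norm x)\<^sup>2 / 2)" and ?v = "exp (- \<tau> * (norm y)\<^sup>2 / 2)"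
      have "gaussian \<tau> z = ?u * ?v"
      proof -
        have z': "(norm z)\<^sup>2 = ((norm x)\<^sup>2 + (norm y)\<^sup>2) / 2" using z by simp
        show ?thesis unfolding exp_add[symmetric] z' by (simp add: algebra_simps add_divide_distrib)
      qed
      moreover have "gaussian \<tau> x = ?u\<^sup>2" "gaussian \<tau> y = ?v\<^sup>2"
        by (simp_all flip: exp_double)
      ultimately have "p\<^sup>2 * gaussian \<tau> x + q\<^sup>2 * gaussian \<tau> y - 2 * (p * q) * gaussian \<tau> z
          = (p * ?u - q * ?v)\<^sup>2" by (simp add: power2_diff power_mult_distrib mult_ac)
      then show ?thesis by simp
    qed
    then show ?thesis
      using stable_density_combination[OF \<beta>, of "[(p\<^sup>2, x), (q\<^sup>2, y), (- (2 * (p * q)), z)]"] by (simp add: algebra_simps)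
  qed
  have pos: "?f x > 0" "?f y > 0" "?f z > 0" using stable_density_pos[OF \<beta>] by auto
  let ?g = "sqrt (?f x) * sqrt (?f y)"
  have g: "?g > 0" using pos by simp
  have "2 * (sqrt (?f y) * sqrt (?f x)) * ?f z \<le> ?f y * ?f x + ?f x * ?f y"
    using amgm[of "sqrt (?f y)" "sqrt (?f x)"] pos by simp
  also have "\<dots> = 2 * ?g * ?g" using pos by (simp add: mult_ac)
  finally have "2 * ?g * ?f z \<le> 2 * ?g * ?g" by (simp add: mult_ac)
  then have "?f z \<le> ?g" by (rule mult_left_le_imp_le) (use g in simp)
  then have "(?f z)\<^sup>2 \<le> ?g\<^sup>2" using pos by (intro power_mono) auto
  then show ?thesis using pos by (simp add: power_mult_distrib)
qed

section \<open>The heat profile is the stable density\<close>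

lemma stable_density_gaussian_mean:
  assumes \<beta>: "\<beta> > 0" and \<tau>: "\<tau> > 0"
  shows "integrable lborel (\<lambda>x::'a::euclidean_space. stable_density \<beta> x * gaussian \<tau> x)"
    and "(2 * pi) ^ DIM('a) * (\<integral>x. stable_density \<beta> (x::'a) * gaussian \<tau> x \<partial>lborel)
      = sqrt (pi / \<tau>) ^ DIM('a) * (\<integral>\<xi>. stable_char \<beta> (\<xi>::'a) * exp (- (norm \<xi>)\<^sup>2 / (4 * \<tau>)) \<partial>lborel)"
proof -
  show "integrable lborel (\<lambda>x::'a. stable_density \<beta> x * gaussian \<tau> x)"
  proof (rule Bochner_Integration.integrable_bound[OF integrable_mult_right[OF gaussian_integral(1)[OF \<tau>], of "stable_density \<beta> (0::'a)"]])
    show "AE x in lborel. norm (stable_density \<beta> (x::'a) * gaussian \<tau> x) \<le> norm (stable_density \<beta> (0::'a) * gaussian \<tau> x)"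
      using stable_density_bounded[OF \<beta>] by (intro AE_I2) (force simp: abs_mult intro: mult_right_mono order_trans)
  qed measurable
  define a where "a = 1 / (4 * \<tau>)"
  have a: "a > 0" using \<tau> by (simp add: a_def)
  have "complex_of_real (\<integral>\<xi>. (2 * pi) ^ DIM('a) * stable_density \<beta> (\<xi>::'a) * gaussian \<tau> \<xi> \<partial>lborel)
    = of_real (sqrt (4 * pi * a) ^ DIM('a) * (\<integral>x. stable_char \<beta> (x::'a) * gaussian a x \<partial>lborel))"
    using fourier_multiplication_formula[OF integrable_exp_norm_powr_0(1)[OF \<beta>] a, of "0::'a"] \<tau>
    unfolding fourier_exp_norm_powr[OF \<beta>]
    by (simp add: a_def integral_complex_of_real[symmetric] mult_ac del: of_real_exp)
  then have "(\<integral>\<xi>. (2 * pi) ^ DIM('a) * stable_density \<beta> (\<xi>::'a) * gaussian \<tau> \<xi> \<partial>lborel)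
    = sqrt (4 * pi * a) ^ DIM('a) * (\<integral>x. stable_char \<beta> (x::'a) * gaussian a x \<partial>lborel)"
    by (simp only: of_real_eq_iff)
  then show "(2 * pi) ^ DIM('a) * (\<integral>x. stable_density \<beta> (x::'a) * gaussian \<tau> x \<partial>lborel)
      = sqrt (pi / \<tau>) ^ DIM('a) * (\<integral>\<xi>. stable_char \<beta> (\<xi>::'a) * exp (- (norm \<xi>)\<^sup>2 / (4 * \<tau>)) \<partial>lborel)"
    by (simp add: a_def mult.assoc)
qed

lemma continuous_exp_norm_powr:
  "continuous_on UNIV (\<lambda>\<xi>::'a::euclidean_space. stable_char \<beta> \<xi>)" if "\<beta> > 0"
  by (intro continuous_intros continuous_on_powr') (use that in auto)

text \<open>\<open>\<Phi>\<close> is the Fourier transform of an integrable continuous function, up to a factor, and it is nonnegative. The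
Gaussian-regularised inversion formula at \<open>0\<close> bounds its regularised integrals, and monotone convergence removes the
regularisation.\<close>

lemma integrable_stable_density:
  assumes \<beta>: "0 < \<beta>" "\<beta> < 2"
  shows "integrable lborel (stable_density \<beta> :: 'a::euclidean_space \<Rightarrow> real)"
    and "(\<integral>x. stable_density \<beta> (x::'a) \<partial>lborel) = 1"
proof -
  let ?C = "(2 * pi) ^ DIM('a)"
  let ?I = "\<lambda>a. \<integral>x. stable_density \<beta> (x::'a) * gaussian (1 / (4 * a)) x \<partial>lborel"
  have lim: "(?I \<longlongrightarrow> 1) at_top"
  proof -
    have "((\<lambda>a. complex_of_real (?C * ?I a)) \<longlongrightarrow> of_real (?C * 1)) at_top"
      using fourier_inversion_gaussian_means[OF continuous_exp_norm_powr[OF \<beta>(1)] integrable_exp_norm_powr_0(1)[OF \<beta>(1)], of "0::'a"] \<beta>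
      unfolding fourier_exp_norm_powr[OF \<beta>(1)]
      by (simp add: integral_complex_of_real[symmetric] mult.assoc[symmetric] del: of_real_exp)
        (simp add: mult.assoc del: of_real_exp)
    then have "((\<lambda>a. ?C * ?I a) \<longlongrightarrow> ?C * 1) at_top" by (simp only: tendsto_of_real_iff)
    then show ?thesis by (subst (asm) tendsto_mult_left_iff) auto
  qed
  have seq: "(\<lambda>n. ?I (real (Suc n))) \<longlonglongrightarrow> 1"
    using lim filterlim_compose filterlim_real_sequentially LIMSEQ_Suc by blast
  have *: "integrable lborel (stable_density \<beta> :: 'a \<Rightarrow> real) \<and> (\<integral>x. stable_density \<beta> (x::'a) \<partial>lborel) = 1"
  proof (rule conjI)
    note mc = integral_monotone_convergence_nonneg[where f = "\<lambda>n x. stable_density \<beta> (x::'a) * exp (- (1 / (4 * real (Suc n))) * (norm x)\<^sup>2)" and M = lborel and u = "stable_density \<beta>" and x = 1]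
    have 1: "integrable lborel (\<lambda>x. stable_density \<beta> (x::'a) * exp (- (1 / (4 * real (Suc n))) * (norm x)\<^sup>2))" for n
      by (rule stable_density_gaussian_mean(1)) (use \<beta> in auto)
    have 2: "AE x in lborel. mono (\<lambda>n. stable_density \<beta> (x::'a) * exp (- (1 / (4 * real (Suc n))) * (norm x)\<^sup>2))"
      by (intro AE_I2 monoI mult_left_mono stable_density_nonneg[OF \<beta>])
        (auto simp: frac_le mult_right_mono)
    have 3: "AE x in lborel. 0 \<le> stable_density \<beta> (x::'a) * exp (- (1 / (4 * real (Suc n))) * (norm x)\<^sup>2)" for n
      by (intro AE_I2 mult_nonneg_nonneg stable_density_nonneg[OF \<beta>]) simp
    have 4: "AE x in lborel. (\<lambda>n. stable_density \<beta> (x::'a) * exp (- (1 / (4 * real (Suc n))) * (norm x)\<^sup>2)) \<longlonglongrightarrow> stable_density \<beta> x"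
    proof (rule AE_I2)
      fix x :: 'a
      have "(\<lambda>n. exp (- (1 / (4 * real (Suc n))) * (norm x)\<^sup>2)) \<longlonglongrightarrow> 1" by real_asymp
      from tendsto_mult_left[OF this, of "stable_density \<beta> x"]
      show "(\<lambda>n. stable_density \<beta> (x::'a) * exp (- (1 / (4 * real (Suc n))) * (norm x)\<^sup>2)) \<longlonglongrightarrow> stable_density \<beta> x" by simp
    qed
    show "integrable lborel (stable_density \<beta> :: 'a \<Rightarrow> real)"
      using mc(1)[OF 1 2 3 4 seq] by simp
    show "(\<integral>x. stable_density \<beta> (x::'a) \<partial>lborel) = 1"
      using mc(2)[OF 1 2 3 4 seq] by simp
  qed
  then show "integrable lborel (stable_density \<beta> :: 'a \<Rightarrow> real)" "(\<integral>x. stable_density \<beta> (x::'a) \<partial>lborel) = 1"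
    by auto
qed

lemma fourier_stable_density:
  fixes \<xi> :: "'a::euclidean_space"
  assumes \<beta>: "0 < \<beta>" "\<beta> < 2"
  shows "(\<integral>x. of_real (stable_density \<beta> x) * cis (- (x \<bullet> \<xi>)) \<partial>lborel) = of_real (stable_char \<beta> \<xi>)"
proof -
  let ?C = "(2 * pi) ^ DIM('a)"
  have "(\<integral>x. of_real (?C * stable_density \<beta> x) * cis (x \<bullet> (- \<xi>)) \<partial>lborel) = complex_of_real (?C * stable_char \<beta> (- \<xi>))"
    by (rule fourier_inversion[OF continuous_exp_norm_powr[OF \<beta>(1)] integrable_exp_norm_powr_0(1)[OF \<beta>(1)] fourier_exp_norm_powr[OF \<beta>(1)]])
      (intro integrable_of_real integrable_mult_right integrable_stable_density(1)[OF \<beta>])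
  moreover have "(\<integral>x. of_real (?C * stable_density \<beta> x) * cis (x \<bullet> (- \<xi>)) \<partial>lborel)
      = complex_of_real ?C * (\<integral>x. of_real (stable_density \<beta> x) * cis (- (x \<bullet> \<xi>)) \<partial>lborel)"
    by (subst integral_mult_right_zero[symmetric]) (simp add: mult.assoc)
  ultimately have "complex_of_real ?C * (\<integral>x. of_real (stable_density \<beta> x) * cis (- (x \<bullet> \<xi>)) \<partial>lborel) = complex_of_real ?C * of_real (stable_char \<beta> \<xi>)"
    by (simp del: of_real_exp)
  then show ?thesis by (subst (asm) mult_cancel_left) simp
qed

lemma fourier_transform_cis:
  "fourier_transform g \<xi> = fourier g \<xi>"
  unfolding fourier_transform_def by (simp add: cis_conv_exp)

text \<open>Existence is \<open>fourier_stable_density\<close>; uniqueness follows because the inversion formula recovers any continuous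
integrable function from an integrable Fourier transform.\<close>

lemma heat_profile_eq_stable_density:
  assumes \<beta>: "0 < \<beta>" "\<beta> < 2"
  shows "heat_profile \<beta> = (stable_density \<beta> :: real ^ 'n \<Rightarrow> real)"
proof -
  have "fractional_heat_kernel \<beta> 1 = (stable_density \<beta> :: real ^ 'n \<Rightarrow> real)"
    unfolding fractional_heat_kernel_def
  proof (rule the_equality)
    show "continuous_on UNIV (stable_density \<beta> :: real ^ 'n \<Rightarrow> real) \<and> integrable lborel (stable_density \<beta> :: real ^ 'n \<Rightarrow> real)
      \<and> (\<forall>\<xi>::real ^ 'n. fourier_transform (stable_density \<beta>) \<xi> = complex_of_real (exp (- 1 * norm \<xi> powr \<beta>)))"
      by (simp add: continuous_stable_density integrable_stable_density(1) fourier_stable_density \<beta> fourier_transform_cis del: of_real_exp)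
    fix g :: "real ^ 'n \<Rightarrow> real"
    assume g: "continuous_on UNIV g \<and> integrable lborel g \<and> (\<forall>\<xi>. fourier_transform g \<xi> = complex_of_real (exp (- 1 * norm \<xi> powr \<beta>)))"
    show "g = stable_density \<beta>"
    proof
      fix x
      let ?C = "(2 * pi) ^ DIM(real ^ 'n)"
      have h: "integrable lborel (\<lambda>\<xi>::real ^ 'n. complex_of_real (exp (- 1 * norm \<xi> powr \<beta>)))"
        unfolding mult_minus_left mult_1 by (intro integrable_of_real integrable_exp_norm_powr_0(1)[OF \<beta>(1)])
      have ft: "fourier g \<xi> = complex_of_real (exp (- 1 * norm \<xi> powr \<beta>))" for \<xi>
        using g by (simp only: fourier_transform_cis)
      have "of_real (?C * g x) = (\<integral>\<xi>. complex_of_real (exp (- 1 * norm \<xi> powr \<beta>)) * cis (\<xi> \<bullet> x) \<partial>lborel)"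
        using fourier_inversion[OF _ _ ft h, of x] g by simp
      also have "\<dots> = (\<integral>\<xi>. complex_of_real (stable_char \<beta> \<xi>) * cis (- (\<xi> \<bullet> - x)) \<partial>lborel)" by simp
      also have "\<dots> = of_real (?C * stable_density \<beta> (- x))" by (rule fourier_exp_norm_powr[OF \<beta>(1)])
      also have "stable_density \<beta> (- x) = stable_density \<beta> x" by (simp add: stable_density_def)
      finally have "?C * g x = ?C * stable_density \<beta> x" by (simp only: of_real_eq_iff)
      then show "g x = stable_density \<beta> x" by simp
    qed
  qed
  then show ?thesis by (simp add: heat_profile_def[abs_def])
qed

section \<open>A polynomial lower bound for the tail\<close>

lemma lborel_dilate:
  fixes f :: "'a::euclidean_space \<Rightarrow> real"
  assumes c: "c > 0" and [measurable]: "f \<in> borel_measurable borel"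
  shows "(\<integral>x. f x \<partial>lborel) = c ^ DIM('a) * (\<integral>x. f (c *\<^sub>R x) \<partial>lborel)"
proof -
  have "(\<integral>x. f x \<partial>lborel) = (\<integral>x. f x \<partial>density (distr lborel borel (\<lambda>x::'a. 0 + c *\<^sub>R x)) (\<lambda>_. ennreal (\<bar>c\<bar> ^ DIM('a))))"
    using lborel_affine[of c "0::'a"] c by simp
  also have "\<dots> = c ^ DIM('a) * (\<integral>x. f (c *\<^sub>R x) \<partial>lborel)"
    using c by (simp add: integral_density integral_distr)
  finally show ?thesis .
qed

text \<open>Gaussian means of \<open>\<Phi>\<close> are Gaussian means of its Fourier transform; after dilation the parameter \<open>\<tau>\<close> enters only
through \<open>\<tau>^(\<beta>/2)\<close>.\<close>

lemma stable_density_gaussian_mean_scaled: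
  assumes \<beta>: "\<beta> > 0" and \<tau>: "\<tau> > 0"
  shows "(\<integral>x. stable_density \<beta> (x::'a::euclidean_space) * gaussian \<tau> x \<partial>lborel)
    = (\<integral>z. exp (- (\<tau> powr (\<beta> / 2) * norm (z::'a) powr \<beta>)) * (gaussian (1 / 4) z / sqrt (4 * pi) ^ DIM('a)) \<partial>lborel)"
proof -
  let ?J = "\<integral>z. exp (- (\<tau> powr (\<beta> / 2) * norm (z::'a) powr \<beta>)) * gaussian (1 / 4) z \<partial>lborel"
  have "(\<integral>\<xi>. stable_char \<beta> (\<xi>::'a) * exp (- (norm \<xi>)\<^sup>2 / (4 * \<tau>)) \<partial>lborel)
      = sqrt \<tau> ^ DIM('a) * (\<integral>z. stable_char \<beta> (sqrt \<tau> *\<^sub>R (z::'a)) * exp (- (norm (sqrt \<tau> *\<^sub>R z))\<^sup>2 / (4 * \<tau>)) \<partial>lborel)"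
    using \<tau> by (intro lborel_dilate) auto
  also have "(\<integral>z. stable_char \<beta> (sqrt \<tau> *\<^sub>R (z::'a)) * exp (- (norm (sqrt \<tau> *\<^sub>R z))\<^sup>2 / (4 * \<tau>)) \<partial>lborel) = ?J"
  proof (intro Bochner_Integration.integral_cong refl)
    fix z :: 'a
    have "norm (sqrt \<tau> *\<^sub>R z) powr \<beta> = \<tau> powr (\<beta> / 2) * norm z powr \<beta>"
      using \<tau> by (simp add: powr_mult powr_half_sqrt[symmetric] powr_powr)
    moreover have "- (norm (sqrt \<tau> *\<^sub>R z))\<^sup>2 / (4 * \<tau>) = - (1 / 4) * (norm z)\<^sup>2"
      using \<tau> by (simp add: power_mult_distrib)
    ultimately show "stable_char \<beta> (sqrt \<tau> *\<^sub>R z) * exp (- (norm (sqrt \<tau> *\<^sub>R z))\<^sup>2 / (4 * \<tau>))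
        = exp (- (\<tau> powr (\<beta> / 2) * norm z powr \<beta>)) * gaussian (1 / 4) z"
      by (simp only:)
  qed
  finally have "(2 * pi) ^ DIM('a) * (\<integral>x. stable_density \<beta> (x::'a) * gaussian \<tau> x \<partial>lborel)
      = sqrt (pi / \<tau>) ^ DIM('a) * (sqrt \<tau> ^ DIM('a) * ?J)"
    using stable_density_gaussian_mean(2)[OF \<beta> \<tau>, where 'a='a] by simp
  also have "\<dots> = (sqrt (pi / \<tau>) * sqrt \<tau>) ^ DIM('a) * ?J" by (simp only: power_mult_distrib mult.assoc)
  also have "sqrt (pi / \<tau>) * sqrt \<tau> = 2 * pi / sqrt (4 * pi)"
    using \<tau> by (simp add: real_sqrt_divide real_sqrt_mult real_div_sqrt field_simps)
  also have "(2 * pi / sqrt (4 * pi)) ^ DIM('a) * ?J = (2 * pi) ^ DIM('a) * (?J / sqrt (4 * pi) ^ DIM('a))"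
    by (simp add: power_divide)
  finally have "(\<integral>x. stable_density \<beta> (x::'a) * gaussian \<tau> x \<partial>lborel) = ?J / sqrt (4 * pi) ^ DIM('a)"
    by (subst (asm) mult_cancel_left) simp
  then show ?thesis by simp
qed

lemma exp_neg_le_quadratic:
  assumes "x \<ge> (0::real)"
  shows "exp (- x) \<le> 1 - x + x\<^sup>2 / 2"
proof -
  have pos: "1 - x + x\<^sup>2 / 2 > 0"
  proof -
    have "1 - x + x\<^sup>2 / 2 = ((1 - x)\<^sup>2 + 1) / 2" by (simp add: power2_diff field_simps)
    moreover have "0 < ((1 - x)\<^sup>2 + 1) / 2" by (intro divide_pos_pos add_nonneg_pos) auto
    ultimately show ?thesis by simp
  qed
  have "1 \<le> (1 - x + x\<^sup>2 / 2) * (1 + x + x\<^sup>2 / 2)"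
  proof -
    have "(1 - x + x\<^sup>2 / 2) * (1 + x + x\<^sup>2 / 2) = 1 + (x\<^sup>2)\<^sup>2 / 4"
      by (simp add: algebra_simps power2_eq_square)
    then show ?thesis by simp
  qed
  also have "\<dots> \<le> (1 - x + x\<^sup>2 / 2) * exp x"
    using pos exp_lower_Taylor_quadratic[OF assms] by (intro mult_left_mono) auto
  finally show ?thesis by (simp add: exp_minus inverse_eq_divide divide_le_eq)
qed

text \<open>The left side is \<open>(w - 1)(2 - w)\<close> with \<open>w = 2^\<alpha>\<close>. It vanishes at \<open>\<alpha> = 1\<close>, the Gaussian case, and to first order
in \<open>1 - \<alpha>\<close> measures the failure of \<open>\<tau> \<mapsto> \<tau>^\<alpha>\<close> to be linear.\<close>

lemma two_powr_second_difference:
  assumes "1 / 2 \<le> \<alpha>" "\<alpha> \<le> (1::real)"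
  shows "3 * 2 powr \<alpha> - 2 - (2 powr \<alpha>)\<^sup>2 \<ge> 2 / 5 * (1 - \<alpha>)"
proof -
  let ?w = "2 powr \<alpha> :: real"
  have "7 / 5 \<le> sqrt (2::real)" by (rule real_le_rsqrt) (simp add: power2_eq_square)
  also have "sqrt 2 = 2 powr (1 / 2 :: real)" by (simp add: powr_half_sqrt)
  also have "\<dots> \<le> ?w" using assms by (intro powr_mono) auto
  finally have w1: "7 / 5 \<le> ?w" .
  have "exp ((1 - \<alpha>) *\<^sub>R 0 + \<alpha> *\<^sub>R ln 2) \<le> (1 - \<alpha>) * exp 0 + \<alpha> * exp (ln (2::real))"
    using assms convex_onD[OF exp_convex, of \<alpha> 0 "ln 2"] by simp
  then have w2: "?w \<le> 1 + \<alpha>" by (simp add: powr_def)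
  have "2 / 5 * (1 - \<alpha>) \<le> (?w - 1) * (2 - ?w)"
    using w1 w2 assms by (intro mult_mono) auto
  then show ?thesis by (simp add: algebra_simps power2_eq_square)
qed

text \<open>With \<open>z = exp (- \<delta> |x|^2)\<close> the test function is \<open>2 z - 3 z^2 + z^4 = z (z + 2) (1 - z)^2\<close>: it is nonnegative and of
fourth order at the origin, so it nearly ignores the bulk of \<open>\<Phi>\<close>. On the Fourier side the coefficients \<open>2, -3, 1\<close> at
\<open>\<delta>, 2 \<delta>, 4 \<delta>\<close> cancel constants and everything linear in \<open>\<delta>\<close>. What remains at first order is \<open>\<delta>^(\<beta>/2)\<close> with a
coefficient of size \<open>2 - \<beta>\<close>, coming from the non-smoothness of \<open>|\<xi>|^\<beta>\<close>.\<close>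

lemma stable_density_second_difference_ge:
  fixes \<delta> \<beta> :: real
  assumes \<beta>: "1 \<le> \<beta>" "\<beta> < 2" and \<delta>: "\<delta> > 0"
  defines "k \<equiv> \<lambda>x::'a::euclidean_space. 2 * gaussian \<delta> x - 3 * gaussian (2 * \<delta>) x + gaussian (4 * \<delta>) x"
  shows "integrable lborel (\<lambda>x. stable_density \<beta> x * k x)"
    and "(1 - (1 / sqrt 5) ^ DIM('a)) / 5 * (2 - \<beta>) * \<delta> powr (\<beta> / 2) - 774 * sqrt 2 ^ DIM('a) * (\<delta> powr (\<beta> / 2))\<^sup>2
      \<le> (\<integral>x. stable_density \<beta> x * k x \<partial>lborel)"
proof -
  define T where "T = \<delta> powr (\<beta> / 2)"
  have T: "T > 0" using \<delta> by (simp add: T_def)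
  define w :: real where "w = 2 powr (\<beta> / 2)"
  have w_pos: "w > 0" by (simp add: w_def)
  have w_sq: "w\<^sup>2 \<le> 4"
  proof -
    have "w \<le> 2 powr 1" unfolding w_def using \<beta> by (intro powr_mono) auto
    then have "w\<^sup>2 \<le> 2\<^sup>2" using w_pos by (intro power_mono) auto
    then show ?thesis by simp
  qed
  have w_diff: "3 * w - 2 - w\<^sup>2 \<ge> (2 - \<beta>) / 5"
    using two_powr_second_difference[of "\<beta> / 2"] \<beta> by (simp add: w_def)
  have "(2 * \<delta>) powr (\<beta> / 2) = w * T" "(4 * \<delta>) powr (\<beta> / 2) = w\<^sup>2 * T"
  proof -
    show "(2 * \<delta>) powr (\<beta> / 2) = w * T" using \<delta> by (simp add: powr_mult w_def T_def)
    have "(4::real) powr (\<beta> / 2) = (2 * 2) powr (\<beta> / 2)" by simp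
    also have "\<dots> = w\<^sup>2" by (simp only: powr_mult w_def power2_eq_square)
    finally show "(4 * \<delta>) powr (\<beta> / 2) = w\<^sup>2 * T" using \<delta> by (simp add: powr_mult T_def)
  qed
  note powers = T_def[symmetric] this
  define \<gamma> where "\<gamma> = (\<lambda>z::'a. gaussian (1 / 4) z / sqrt (4 * pi) ^ DIM('a))"
  have \<gamma>_nn: "\<gamma> z \<ge> 0" for z by (simp add: \<gamma>_def)
  define X where "X = (\<lambda>s. \<lambda>z::'a. exp (- (s * norm z powr \<beta>)) * \<gamma> z)"
  have X_int: "integrable lborel (X s)" if "s \<ge> 0" for s
  proof (rule Bochner_Integration.integrable_bound)
    show "integrable lborel \<gamma>" unfolding \<gamma>_def by (intro integrable_divide gaussian_integral(1)) simp
    show "AE z in lborel. norm (X s z) \<le> norm (\<gamma> z)"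
      using that \<gamma>_nn by (intro AE_I2) (auto simp: X_def abs_mult intro!: mult_left_le_one_le)
  qed (simp add: X_def \<gamma>_def)
  note i = stable_density_gaussian_mean(1)[of \<beta>, where 'a='a]
  have k_lin: "stable_density \<beta> x * k x = 2 * (stable_density \<beta> x * gaussian \<delta> x)
      - 3 * (stable_density \<beta> x * gaussian (2 * \<delta>) x) + stable_density \<beta> x * gaussian (4 * \<delta>) x" for x
    by (simp add: k_def algebra_simps)
  show "integrable lborel (\<lambda>x. stable_density \<beta> x * k x)"
    unfolding k_lin using \<beta> \<delta>
    by (intro Bochner_Integration.integrable_add Bochner_Integration.integrable_diff integrable_mult_right i) auto
  have split: "(\<integral>x. stable_density \<beta> x * k x \<partial>lborel)
     = 2 * (\<integral>x. stable_density \<beta> (x::'a) * gaussian \<delta> x \<partial>lborel)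
      - 3 * (\<integral>x. stable_density \<beta> (x::'a) * gaussian (2 * \<delta>) x \<partial>lborel)
      + (\<integral>x. stable_density \<beta> (x::'a) * gaussian (4 * \<delta>) x \<partial>lborel)"
    unfolding k_lin using i[of \<delta>] i[of "2 * \<delta>"] i[of "4 * \<delta>"] \<beta> \<delta> by simp
  have mean: "(\<integral>x. stable_density \<beta> (x::'a) * gaussian \<tau> x \<partial>lborel) = integral\<^sup>L lborel (X (\<tau> powr (\<beta> / 2)))"
    if "\<tau> > 0" for \<tau>
    using stable_density_gaussian_mean_scaled[OF _ that, of \<beta>] \<beta> by (simp add: X_def \<gamma>_def)
  have eq: "(\<integral>x. stable_density \<beta> x * k x \<partial>lborel) = (\<integral>z. 2 * X T z - 3 * X (w * T) z + X (w\<^sup>2 * T) z \<partial>lborel)"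
  proof -
    have pos: "2 * \<delta> > 0" "4 * \<delta> > 0" using \<delta> by auto
    show ?thesis unfolding split mean[OF \<delta>] mean[OF pos(1)] mean[OF pos(2)] powers
      using T w_pos X_int[of T] X_int[of "w * T"] X_int[of "w\<^sup>2 * T"] by simp
  qed
  have g_int: "integrable lborel (\<lambda>z::'a. gaussian a z / sqrt (4 * pi) ^ DIM('a))" if "a > 0" for a
    using gaussian_integral(1)[OF that, where 'a='a] by simp
  let ?L = "\<lambda>z::'a. (2 - \<beta>) / 5 * T * (\<gamma> z - gaussian (5 / 4) z / sqrt (4 * pi) ^ DIM('a))
        - 774 * T\<^sup>2 * (gaussian (1 / 8) z / sqrt (4 * pi) ^ DIM('a))"
  have L_int: "integrable lborel ?L"
    unfolding \<gamma>_def by (intro Bochner_Integration.integrable_diff integrable_mult_right g_int) auto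
  have "(\<integral>z. ?L z \<partial>lborel) = (2 - \<beta>) / 5 * T * (1 - (1 / sqrt 5) ^ DIM('a)) - 774 * T\<^sup>2 * sqrt 2 ^ DIM('a)"
  proof -
    have v: "(\<integral>z. gaussian a (z::'a) / sqrt (4 * pi) ^ DIM('a) \<partial>lborel) = sqrt (1 / (4 * a)) ^ DIM('a)" if "a > 0" for a
    proof -
      have "sqrt (pi / a) / sqrt (4 * pi) = sqrt (1 / (4 * a))"
        by (simp add: field_simps flip: real_sqrt_divide)
      then show ?thesis using gaussian_integral(2)[OF that, where 'a='a] by (simp flip: power_divide)
    qed
    have "(\<integral>z. ?L z \<partial>lborel) = (2 - \<beta>) / 5 * T * (sqrt (1 / (4 * (1 / 4))) ^ DIM('a) - sqrt (1 / (4 * (5 / 4))) ^ DIM('a))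
        - 774 * T\<^sup>2 * sqrt (1 / (4 * (1 / 8))) ^ DIM('a)"
      unfolding \<gamma>_def
      by (subst Bochner_Integration.integral_diff, (intro Bochner_Integration.integrable_diff integrable_mult_right g_int; simp)+,
          subst (1 2) integral_mult_right_zero,
          subst Bochner_Integration.integral_diff, (intro g_int; simp)+, subst (1 2 3) v, auto)
    then show ?thesis by (simp add: real_sqrt_divide)
  qed
  then have "(1 - (1 / sqrt 5) ^ DIM('a)) / 5 * (2 - \<beta>) * T - 774 * sqrt 2 ^ DIM('a) * T\<^sup>2 = (\<integral>z. ?L z \<partial>lborel)"
    by simp
  also have "\<dots> \<le> (\<integral>z. 2 * X T z - 3 * X (w * T) z + X (w\<^sup>2 * T) z \<partial>lborel)"
  proof (rule integral_mono[OF L_int])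
    show "integrable lborel (\<lambda>z. 2 * X T z - 3 * X (w * T) z + X (w\<^sup>2 * T) z)"
      using T w_pos X_int[of T] X_int[of "w * T"] X_int[of "w\<^sup>2 * T"] by simp
    fix z :: 'a
    define y where "y = norm z powr \<beta>"
    have y: "y \<ge> 0" by (simp add: y_def)
    \<comment> \<open>lower and upper bounds of \<open>|z|^\<beta>\<close> that are uniform in \<open>\<beta>\<close> and integrate explicitly against \<open>\<gamma>\<close>\<close>
    have y_low: "1 - exp (- (norm z)\<^sup>2) \<le> y"
    proof (cases "norm z \<le> 1")
      case True
      have "1 - exp (- (norm z)\<^sup>2) \<le> (norm z)\<^sup>2" using exp_ge_add_one_self[of "- (norm z)\<^sup>2"] by simp
      also have "\<dots> = norm z powr 2" by simp
      also have "\<dots> \<le> y" unfolding y_def using True \<beta> by (intro powr_mono') auto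
      finally show ?thesis .
    next
      case False
      then have "1 \<le> y" unfolding y_def using \<beta> by (intro ge_one_powr_ge_zero) auto
      then show ?thesis by (smt (verit) exp_gt_zero)
    qed
    \<comment> \<open>\<open>129\<close> times the quadratic Taylor polynomial of \<open>exp (q/8)\<close> dominates \<open>(1 + q)^2\<close>; the constant \<open>774\<close> is \<open>6 * 129\<close>\<close>
    have y_up: "y\<^sup>2 \<le> 129 * exp ((norm z)\<^sup>2 / 8)"
    proof -
      have "y \<le> 1 + (norm z)\<^sup>2"
      proof (cases "norm z \<le> 1")
        case True
        then have "y \<le> 1" unfolding y_def using \<beta> by (intro powr_le1) auto
        then show ?thesis by (simp add: add_increasing2)
      next
        case False
        then have "y \<le> norm z powr 2" unfolding y_def using \<beta> by (intro powr_mono) auto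
        then show ?thesis by simp
      qed
      then have "y\<^sup>2 \<le> (1 + (norm z)\<^sup>2)\<^sup>2" using y by (intro power_mono) auto
      also have "\<dots> \<le> 129 * (1 + (norm z)\<^sup>2 / 8 + ((norm z)\<^sup>2 / 8)\<^sup>2 / 2)"
      proof -
        have "0 \<le> q \<Longrightarrow> (1 + q)\<^sup>2 \<le> 129 * (1 + q / 8 + (q / 8)\<^sup>2 / 2)" for q :: real
        proof -
          assume q: "0 \<le> q"
          have "129 * (1 + q / 8 + (q / 8)\<^sup>2 / 2) = (1 + q)\<^sup>2 + (128 + 113 / 8 * q + q\<^sup>2 / 128)"
            by (simp add: power2_eq_square field_simps)
          moreover have "0 \<le> 128 + 113 / 8 * q + q\<^sup>2 / 128" using q by (intro add_nonneg_nonneg) auto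
          ultimately show ?thesis by linarith
        qed
        then show ?thesis by simp
      qed
      also have "\<dots> \<le> 129 * exp ((norm z)\<^sup>2 / 8)"
        by (intro mult_left_mono exp_lower_Taylor_quadratic) auto
      finally show ?thesis .
    qed
    define u where "u = T * y"
    have u: "u \<ge> 0" using T y by (simp add: u_def)
    \<comment> \<open>only the middle exponential needs an upper bound, hence one second-order term\<close>
    have "(2 - \<beta>) / 5 * u - 6 * u\<^sup>2 \<le> 2 * exp (- u) - 3 * exp (- (w * u)) + exp (- (w\<^sup>2 * u))"
    proof -
      have 1: "1 - u \<le> exp (- u)" using exp_ge_add_one_self[of "- u"] by simp
      have 2: "exp (- (w * u)) \<le> 1 - w * u + (w * u)\<^sup>2 / 2"
        using u w_pos by (intro exp_neg_le_quadratic) auto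
      have 3: "1 - w\<^sup>2 * u \<le> exp (- (w\<^sup>2 * u))" using exp_ge_add_one_self[of "- (w\<^sup>2 * u)"] by simp
      have 4: "(2 - \<beta>) / 5 * u \<le> (3 * w - 2 - w\<^sup>2) * u" using w_diff u by (intro mult_right_mono) auto
      have 5: "(w * u)\<^sup>2 \<le> 4 * u\<^sup>2" using w_sq by (simp add: power_mult_distrib mult_right_mono)
      show ?thesis using 1 2 3 4 5 by (simp add: algebra_simps)
    qed
    then have "((2 - \<beta>) / 5 * u - 6 * u\<^sup>2) * \<gamma> z \<le> (2 * exp (- u) - 3 * exp (- (w * u)) + exp (- (w\<^sup>2 * u))) * \<gamma> z"
      by (intro mult_right_mono \<gamma>_nn)
    also have "\<dots> = 2 * X T z - 3 * X (w * T) z + X (w\<^sup>2 * T) z"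
      by (simp add: X_def u_def y_def algebra_simps)
    finally have main: "((2 - \<beta>) / 5 * u - 6 * u\<^sup>2) * \<gamma> z \<le> 2 * X T z - 3 * X (w * T) z + X (w\<^sup>2 * T) z" .
    have e1: "exp (- (norm z)\<^sup>2) * \<gamma> z = gaussian (5 / 4) z / sqrt (4 * pi) ^ DIM('a)"
      unfolding \<gamma>_def times_divide_eq_right exp_add[symmetric] by simp
    have e2: "exp ((norm z)\<^sup>2 / 8) * \<gamma> z = gaussian (1 / 8) z / sqrt (4 * pi) ^ DIM('a)"
      unfolding \<gamma>_def times_divide_eq_right exp_add[symmetric] by simp
    have "?L z = (2 - \<beta>) / 5 * T * ((1 - exp (- (norm z)\<^sup>2)) * \<gamma> z) - 6 * T\<^sup>2 * (129 * exp ((norm z)\<^sup>2 / 8) * \<gamma> z)"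
      unfolding e1[symmetric] e2[symmetric] by (simp add: algebra_simps)
    also have "\<dots> \<le> (2 - \<beta>) / 5 * T * (y * \<gamma> z) - 6 * T\<^sup>2 * (y\<^sup>2 * \<gamma> z)"
      using \<beta> T by (intro diff_mono mult_left_mono mult_right_mono y_low y_up \<gamma>_nn) auto
    also have "\<dots> = ((2 - \<beta>) / 5 * u - 6 * u\<^sup>2) * \<gamma> z"
      by (simp add: u_def algebra_simps power2_eq_square)
    finally show "?L z \<le> 2 * X T z - 3 * X (w * T) z + X (w\<^sup>2 * T) z" using main by linarith
  qed
  finally show "(1 - (1 / sqrt 5) ^ DIM('a)) / 5 * (2 - \<beta>) * \<delta> powr (\<beta> / 2) - 774 * sqrt 2 ^ DIM('a) * (\<delta> powr (\<beta> / 2))\<^sup>2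
      \<le> (\<integral>x. stable_density \<beta> x * k x \<partial>lborel)"
    unfolding eq T_def .
qed

text \<open>The factorisation \<open>z (z + 2) (1 - z)^2\<close> with \<open>z = exp (- s)\<close> shows the sign; \<open>1 - z \<le> s\<close> gives the bound for small
\<open>s\<close>, and trading \<open>s^2\<close> for half of the exponent gives the bound for large \<open>s\<close>.\<close>

lemma second_difference_le:
  fixes s :: real
  assumes s: "s \<ge> 0"
  shows "0 \<le> 2 * exp (- s) - 3 * exp (- (2 * s)) + exp (- (4 * s))"
    and "2 * exp (- s) - 3 * exp (- (2 * s)) + exp (- (4 * s)) \<le> 3 * s\<^sup>2"
    and "2 * exp (- s) - 3 * exp (- (2 * s)) + exp (- (4 * s)) \<le> 24 * exp (- (s / 2))"
proof -
  define z where "z = exp (- s)"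
  have z: "0 < z" "z \<le> 1" using s by (auto simp: z_def)
  have "exp (- (2 * s)) = z\<^sup>2" "exp (- (4 * s)) = z ^ 4"
    by (simp_all add: z_def flip: exp_of_nat_mult)
  then have eq: "2 * exp (- s) - 3 * exp (- (2 * s)) + exp (- (4 * s)) = z * (z + 2) * (1 - z)\<^sup>2"
    by (simp add: z_def[symmetric] algebra_simps power2_eq_square power4_eq_xxxx)
  show "0 \<le> 2 * exp (- s) - 3 * exp (- (2 * s)) + exp (- (4 * s))" unfolding eq using z by simp
  have "1 - z \<le> s" using exp_ge_add_one_self[of "- s"] by (simp add: z_def)
  then have sq: "(1 - z)\<^sup>2 \<le> s\<^sup>2" using z by (intro power_mono) auto
  have main: "z * (z + 2) * (1 - z)\<^sup>2 \<le> (z * 3) * s\<^sup>2"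
    using z sq by (intro mult_mono) auto
  also have "\<dots> \<le> 3 * s\<^sup>2" using z by (intro mult_right_mono) auto
  finally show "2 * exp (- s) - 3 * exp (- (2 * s)) + exp (- (4 * s)) \<le> 3 * s\<^sup>2" unfolding eq .
  have "s\<^sup>2 / 8 \<le> exp (s / 2)"
    using exp_lower_Taylor_quadratic[of "s / 2"] s by (simp add: power_divide)
  then have "(z * 3) * s\<^sup>2 \<le> (z * 3) * (8 * exp (s / 2))" using z by (intro mult_left_mono) auto
  also have "\<dots> = 24 * exp (- (s / 2))" unfolding z_def by (simp flip: exp_add)
  finally show "2 * exp (- s) - 3 * exp (- (2 * s)) + exp (- (4 * s)) \<le> 24 * exp (- (s / 2))"
    unfolding eq using main by linarith
qed

text \<open>Inside the ball of radius \<open>|x|\<close> the test function is at most \<open>3 \<delta>^2 |x|^4\<close> and \<open>\<Phi>\<close> has mass \<open>1\<close>. Outside it,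
\<open>\<Phi>\<close> is at most \<open>\<Phi> x\<close> by radial monotonicity and the test function is dominated by a Gaussian.\<close>

lemma stable_density_second_difference_le:
  fixes x :: "'a::euclidean_space"
  assumes \<beta>: "1 \<le> \<beta>" "\<beta> < 2" and \<delta>: "\<delta> > 0"
  shows "(\<integral>y. stable_density \<beta> (y::'a) * (2 * gaussian \<delta> y - 3 * gaussian (2 * \<delta>) y + gaussian (4 * \<delta>) y) \<partial>lborel)
    \<le> 3 * \<delta>\<^sup>2 * norm x ^ 4 + 24 * sqrt (2 * pi / \<delta>) ^ DIM('a) * stable_density \<beta> x"
    (is "(\<integral>y. _ * ?k y \<partial>lborel) \<le> _")
proof -
  have \<beta>': "0 < \<beta>" using \<beta> by simp
  have \<delta>2: "\<delta> / 2 > 0" using \<delta> by simp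
  let ?R = "\<lambda>y::'a. 3 * \<delta>\<^sup>2 * norm x ^ 4 * stable_density \<beta> y + 24 * stable_density \<beta> x * gaussian (\<delta> / 2) y"
  have "(\<integral>y. stable_density \<beta> y * ?k y \<partial>lborel) \<le> (\<integral>y. ?R y \<partial>lborel)"
  proof (rule integral_mono[OF stable_density_second_difference_ge(1)[OF \<beta> \<delta>]])
    show "integrable lborel ?R"
      by (intro Bochner_Integration.integrable_add integrable_mult_right integrable_stable_density(1)[OF \<beta>' \<beta>(2)] gaussian_integral(1)[OF \<delta>2])
    fix y :: 'a
    define s where "s = \<delta> * (norm y)\<^sup>2"
    have s: "s \<ge> 0" using \<delta> by (simp add: s_def)
    have k: "?k y = 2 * exp (- s) - 3 * exp (- (2 * s)) + exp (- (4 * s))" by (simp add: s_def mult.assoc)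
    have nn: "stable_density \<beta> y \<ge> 0" "stable_density \<beta> x \<ge> 0" using stable_density_nonneg[OF \<beta>' \<beta>(2)] by auto
    have k24: "?k y \<le> 24 * gaussian (\<delta> / 2) y"
      using second_difference_le(3)[OF s] unfolding k by (simp add: s_def)
    show "stable_density \<beta> y * ?k y \<le> ?R y"
    proof (cases "norm y \<le> norm x")
      case True
      then have "s \<le> \<delta> * (norm x)\<^sup>2" unfolding s_def using \<delta> by (intro mult_left_mono power_mono) auto
      then have "s\<^sup>2 \<le> (\<delta> * (norm x)\<^sup>2)\<^sup>2" using s by (intro power_mono) auto
      also have "\<dots> = \<delta>\<^sup>2 * norm x ^ 4" by (simp add: power_mult_distrib)
      finally have "?k y \<le> 3 * \<delta>\<^sup>2 * norm x ^ 4" using second_difference_le(2)[OF s] unfolding k by linarith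
      then have "stable_density \<beta> y * ?k y \<le> stable_density \<beta> y * (3 * \<delta>\<^sup>2 * norm x ^ 4)"
        using nn by (intro mult_left_mono) auto
      moreover have "0 \<le> 24 * stable_density \<beta> x * gaussian (\<delta> / 2) y" using nn by simp
      ultimately show ?thesis by (simp only: mult.commute[of "stable_density \<beta> y" "3 * \<delta>\<^sup>2 * norm x ^ 4"])
    next
      case False
      then have "stable_density \<beta> y \<le> stable_density \<beta> x"
        using \<beta>' \<beta>(2) by (intro stable_density_antimono) auto
      then have "stable_density \<beta> y * ?k y \<le> stable_density \<beta> x * (24 * gaussian (\<delta> / 2) y)"
        using nn k24 second_difference_le(1)[OF s] unfolding k by (intro mult_mono) auto
      moreover have "0 \<le> 3 * \<delta>\<^sup>2 * norm x ^ 4 * stable_density \<beta> y" using nn by simp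
      ultimately show ?thesis by (simp only: mult_ac)
    qed
  qed
  also have "\<dots> = 3 * \<delta>\<^sup>2 * norm x ^ 4 * 1 + 24 * stable_density \<beta> x * sqrt (pi / (\<delta> / 2)) ^ DIM('a)"
    using integrable_stable_density[OF \<beta>' \<beta>(2), where 'a='a] gaussian_integral[OF \<delta>2, where 'a='a] by simp
  finally show ?thesis by (simp add: mult_ac)
qed

text \<open>Comparing the two estimates of the same integral bounds \<open>\<Phi> x\<close> from below as soon as the quadratic error terms are
absorbed, which the choice \<open>\<delta> = (\<kappa> (2 - \<beta>) / |x|^2)^2\<close> with a small constant \<open>\<kappa>\<close> achieves. The resulting powers are far
from sharp (the true decay is \<open>(2 - \<beta>) |x|^(-d-\<beta>)\<close>), but only the logarithm of this bound is used.\<close>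

lemma stable_density_tail_ge:
  "\<exists>c>0. \<forall>\<beta> (x::'a::euclidean_space). 1 \<le> \<beta> \<and> \<beta> < 2 \<and> 1 \<le> norm x \<longrightarrow>
     c * (2 - \<beta>) ^ (DIM('a) + 3) / norm x ^ (2 * DIM('a) + 4) \<le> stable_density \<beta> x"
proof -
  define d where "d = DIM('a)"
  define c1 :: real where "c1 = (1 - (1 / sqrt 5) ^ d) / 5"
  define c2 :: real where "c2 = 774 * sqrt 2 ^ d"
  have c1: "c1 > 0"
    using power_strict_mono[of "1 / sqrt 5" "1::real" d] by (simp add: c1_def d_def)
  have c2: "c2 > 0" by (simp add: c2_def)
  define \<kappa> where "\<kappa> = min 1 (min (c1 / (4 * c2)) (c1 / 12))"
  have \<kappa>: "0 < \<kappa>" "\<kappa> \<le> 1" "c2 * \<kappa> \<le> c1 / 4" "3 * \<kappa> \<le> c1 / 4"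
  proof -
    show "0 < \<kappa>" "\<kappa> \<le> 1" using c1 c2 by (auto simp: \<kappa>_def)
    have "\<kappa> \<le> c1 / (4 * c2)" by (simp add: \<kappa>_def)
    then show "c2 * \<kappa> \<le> c1 / 4" using c2 by (simp add: field_simps)
    have "\<kappa> \<le> c1 / 12" by (simp add: \<kappa>_def)
    then show "3 * \<kappa> \<le> c1 / 4" by simp
  qed
  define c where "c = c1 / 48 * \<kappa> ^ (d + 2) / sqrt (2 * pi) ^ d"
  have c: "c > 0" using c1 \<kappa> by (simp add: c_def)
  have "c * (2 - \<beta>) ^ (d + 3) / norm x ^ (2 * d + 4) \<le> stable_density \<beta> x"
    if \<beta>: "1 \<le> \<beta>" "\<beta> < 2" and x: "1 \<le> norm x" for \<beta> and x :: 'a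
  proof -
    define e where "e = 2 - \<beta>"
    have e: "0 < e" "e \<le> 1" using \<beta> by (auto simp: e_def)
    define q where "q = \<kappa> * e / (norm x)\<^sup>2"
    have x2: "1 \<le> (norm x)\<^sup>2" using x by simp
    have q: "0 < q" "q \<le> \<kappa> * e"
      using \<kappa> e x2 by (auto simp: q_def divide_le_eq intro!: divide_pos_pos mult_le_cancel_left1[THEN iffD2])
    have ke: "\<kappa> * e \<le> 1" using \<kappa> e by (simp add: mult_le_one)
    define \<delta> where "\<delta> = q\<^sup>2"
    have \<delta>: "0 < \<delta>" "\<delta> \<le> 1" using q ke by (auto simp: \<delta>_def intro: power_le_one)
    define T where "T = \<delta> powr (\<beta> / 2)"
    have T1: "\<delta> \<le> T"
      using powr_mono'[of "\<beta> / 2" 1 \<delta>] \<delta> \<beta> by (simp add: T_def)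
    have T2: "T \<le> q"
    proof -
      have "T \<le> \<delta> powr (1 / 2)" unfolding T_def using \<delta> \<beta> by (intro powr_mono') auto
      also have "\<dots> = q" using q by (simp add: powr_half_sqrt \<delta>_def)
      finally show ?thesis .
    qed
    have T0: "T > 0" using \<delta> T1 by simp
    \<comment> \<open>each of the two error terms below takes at most a quarter of the main term \<open>c1 e T\<close>\<close>
    have "c1 * e * T - c2 * T\<^sup>2 \<le> 3 * \<delta>\<^sup>2 * norm x ^ 4 + 24 * sqrt (2 * pi / \<delta>) ^ d * stable_density \<beta> x"
      using stable_density_second_difference_ge(2)[OF \<beta> \<delta>(1), where 'a='a] stable_density_second_difference_le[OF \<beta> \<delta>(1), of x]
      by (simp add: c1_def c2_def d_def e_def T_def)
    moreover have "c2 * T\<^sup>2 \<le> c1 / 4 * (e * T)"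
    proof -
      have "c2 * T * T \<le> c2 * (\<kappa> * e) * T" using T2 q(2) c2 T0 by (intro mult_left_mono mult_right_mono) auto
      also have "\<dots> = c2 * \<kappa> * (e * T)" by simp
      also have "\<dots> \<le> c1 / 4 * (e * T)" using \<kappa> e T0 by (intro mult_right_mono) auto
      finally show ?thesis by (simp add: power2_eq_square mult.assoc)
    qed
    moreover have "3 * \<delta>\<^sup>2 * norm x ^ 4 \<le> c1 / 4 * (e * T)"
    proof -
      have "q * (norm x)\<^sup>2 = \<kappa> * e" using x2 by (auto simp: q_def)
      then have "q\<^sup>2 * norm x ^ 4 = (\<kappa> * e)\<^sup>2"
        by (metis power_mult_distrib power_mult mult_2 numeral_Bit0 power2_eq_square power_add)
      then have "3 * \<delta>\<^sup>2 * norm x ^ 4 = \<delta> * (3 * (\<kappa> * e)\<^sup>2)"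
      proof -
        have "3 * \<delta>\<^sup>2 * norm x ^ 4 = \<delta> * (3 * (q\<^sup>2 * norm x ^ 4))"
          unfolding \<delta>_def power2_eq_square[of "q\<^sup>2"] by (simp only: mult_ac)
        then show ?thesis by (simp only: \<open>q\<^sup>2 * norm x ^ 4 = (\<kappa> * e)\<^sup>2\<close>)
      qed
      also have "\<dots> \<le> T * (3 * (\<kappa> * e)\<^sup>2)" using T1 by (intro mult_right_mono) auto
      also have "\<dots> \<le> T * (3 * (\<kappa> * e))"
        using T0 \<kappa> e ke by (intro mult_left_mono) (auto simp: power2_eq_square mult_left_le)
      also have "\<dots> = 3 * \<kappa> * (e * T)" by simp
      also have "\<dots> \<le> c1 / 4 * (e * T)" using \<kappa> e T0 by (intro mult_right_mono) auto
      finally show ?thesis .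
    qed
    moreover have "c1 / 2 * (e * \<delta>) \<le> c1 / 2 * (e * T)" using c1 e T1 by (intro mult_left_mono) auto
    ultimately have main: "c1 / 2 * (e * \<delta>) \<le> 24 * sqrt (2 * pi / \<delta>) ^ d * stable_density \<beta> x"
      by (simp add: algebra_simps)
    have sq: "sqrt (2 * pi / \<delta>) = sqrt (2 * pi) / q" using q by (simp add: \<delta>_def real_sqrt_divide)
    have "c1 / 48 * e * q\<^sup>2 * (q ^ d / sqrt (2 * pi) ^ d) \<le> stable_density \<beta> x"
      using main[unfolded sq] q unfolding \<delta>_def by (simp add: power_divide field_simps)
    also have "c1 / 48 * e * q\<^sup>2 * (q ^ d / sqrt (2 * pi) ^ d) = c * e ^ (d + 3) / norm x ^ (2 * d + 4)"
    proof -
      have "q ^ (d + 2) = \<kappa> ^ (d + 2) * e ^ (d + 2) / norm x ^ (2 * d + 4)"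
        unfolding q_def power_divide power_mult_distrib by (simp add: power_mult[symmetric] power_add mult.commute)
      moreover have "c1 / 48 * e * q\<^sup>2 * (q ^ d / sqrt (2 * pi) ^ d) = c1 / 48 / sqrt (2 * pi) ^ d * e * q ^ (d + 2)"
        by (simp add: power_add power2_eq_square mult_ac)
      moreover have "e * e ^ (d + 2) = e ^ (d + 3)" by (simp add: power_add eval_nat_numeral)
      ultimately show ?thesis by (simp add: c_def mult_ac)
    qed
    finally show ?thesis by (simp add: e_def)
  qed
  with c show ?thesis unfolding d_def by blast
qed

section \<open>Bounds uniform in the exponent\<close>

lemma exp_norm_powr_between:
  fixes \<xi> :: "'a::real_normed_vector"
  assumes "1 \<le> \<beta>" "\<beta> < 2"
  shows "stable_char \<beta> \<xi> \<le> exp 1 * exp (- norm \<xi>)"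
    and "exp (- 1) * gaussian 1 \<xi> \<le> stable_char \<beta> \<xi>"
proof -
  have "norm \<xi> - 1 \<le> norm \<xi> powr \<beta> \<and> norm \<xi> powr \<beta> \<le> 1 + (norm \<xi>)\<^sup>2"
  proof (cases "norm \<xi> \<le> 1")
    case True
    then have "norm \<xi> powr \<beta> \<le> 1" using assms by (intro powr_le1) auto
    then have "norm \<xi> powr \<beta> \<le> 1 + (norm \<xi>)\<^sup>2" by (rule order_trans) simp
    moreover have "0 \<le> norm \<xi> powr \<beta>" by simp
    ultimately show ?thesis using True by linarith
  next
    case False
    then show ?thesis
      using powr_mono[of 1 \<beta> "norm \<xi>"] powr_mono[of \<beta> 2 "norm \<xi>"] assms by simp
  qed
  then show "stable_char \<beta> \<xi> \<le> exp 1 * exp (- norm \<xi>)"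
    and "exp (- 1) * gaussian 1 \<xi> \<le> stable_char \<beta> \<xi>"
    by (simp_all flip: exp_add)
qed

text \<open>The constant of \<open>stable_density_ratio_ge\<close> is a quotient of two integrals of \<open>exp (-|\<xi>|^\<beta>)\<close>. For \<open>1 \<le> \<beta> < 2\<close> this
function lies between multiples of \<open>exp (-|\<xi>|^2)\<close> and \<open>exp (-|\<xi>|)\<close>, which makes the constant uniform.\<close>

lemma stable_density_uniform_bounds:
  "\<exists>A>0. \<forall>\<beta> (x::'a::euclidean_space). 1 \<le> \<beta> \<and> \<beta> < 2 \<longrightarrow>
    stable_density \<beta> (0::'a) \<le> A \<and> stable_density \<beta> (0::'a) * gaussian A x \<le> stable_density \<beta> x"
proof -
  define L :: real where "L = exp (- 1) * sqrt pi ^ DIM('a)"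
  define U0 where "U0 = exp 1 * (\<integral>\<xi>. exp (- norm (\<xi>::'a)) \<partial>lborel)"
  define U2 where "U2 = exp 1 * (\<integral>\<xi>. (norm (\<xi>::'a))\<^sup>2 * exp (- norm \<xi>) \<partial>lborel)"
  have L: "L > 0" by (simp add: L_def)
  have i0: "integrable lborel (\<lambda>\<xi>::'a. exp (- norm \<xi>))"
    using integrable_exp_norm_powr_0(1)[of 1, where 'a='a] by simp
  have i2: "integrable lborel (\<lambda>\<xi>::'a. (norm \<xi>)\<^sup>2 * exp (- norm \<xi>))"
    using integrable_norm_sq_exp_norm_powr[of 1, where 'a='a] by simp
  have U: "U0 \<ge> 0" "U2 \<ge> 0" by (auto simp: U0_def U2_def)
  define A where "A = U0 / (2 * pi) ^ DIM('a) + U2 / (2 * L) + 1"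
  have A: "A > 0" unfolding A_def using U L by (intro add_nonneg_pos add_nonneg_nonneg) auto
  have "stable_density \<beta> (0::'a) \<le> A \<and> stable_density \<beta> (0::'a) * gaussian A x \<le> stable_density \<beta> x"
    if \<beta>: "1 \<le> \<beta>" "\<beta> < 2" for \<beta> and x :: 'a
  proof -
    let ?m = "\<lambda>\<xi>::'a. stable_char \<beta> \<xi>"
    have \<beta>0: "\<beta> > 0" using \<beta> by simp
    note im = integrable_exp_norm_powr_0(1)[OF \<beta>0, where 'a='a] integrable_norm_sq_exp_norm_powr[OF \<beta>0, where 'a='a]
    have m_up: "(\<integral>\<xi>. ?m \<xi> \<partial>lborel) \<le> U0"
      unfolding U0_def integral_mult_right_zero[symmetric]
      by (rule integral_mono) (use im i0 exp_norm_powr_between(1)[OF \<beta>] in auto)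
    have m2_up: "(\<integral>\<xi>. (norm \<xi>)\<^sup>2 * ?m \<xi> \<partial>lborel) \<le> U2"
      unfolding U2_def integral_mult_right_zero[symmetric]
    proof (rule integral_mono)
      fix \<xi> :: 'a
      show "(norm \<xi>)\<^sup>2 * ?m \<xi> \<le> exp 1 * ((norm \<xi>)\<^sup>2 * exp (- norm \<xi>))"
        using mult_left_mono[OF exp_norm_powr_between(1)[OF \<beta>, of \<xi>], of "(norm \<xi>)\<^sup>2"] by (simp add: mult_ac)
    qed (use im i2 in auto)
    have m_low: "L \<le> (\<integral>\<xi>. ?m \<xi> \<partial>lborel)"
    proof -
      have "L = (\<integral>\<xi>. exp (- 1) * gaussian 1 (\<xi>::'a) \<partial>lborel)"
        using gaussian_integral(2)[of 1, where 'a='a] by (simp add: L_def)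
      also have "\<dots> \<le> (\<integral>\<xi>. ?m \<xi> \<partial>lborel)"
      proof (rule integral_mono)
        show "integrable lborel (\<lambda>\<xi>::'a. exp (- 1) * gaussian 1 \<xi>)"
          by (intro integrable_mult_right gaussian_integral(1)) simp
      qed (use im exp_norm_powr_between(2)[OF \<beta>] in auto)
      finally show ?thesis .
    qed
    have "stable_density \<beta> (0::'a) \<le> U0 / (2 * pi) ^ DIM('a)"
      unfolding stable_density_def using m_up by (simp add: divide_right_mono)
    also have "\<dots> \<le> A" using U L by (simp add: A_def)
    finally have up: "stable_density \<beta> (0::'a) \<le> A" .
    define A0 where "A0 = (\<integral>\<xi>. (norm \<xi>)\<^sup>2 * ?m \<xi> \<partial>lborel) / (2 * (\<integral>\<xi>. ?m \<xi> \<partial>lborel))"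
    have "A0 \<le> U2 / (2 * L)"
      unfolding A0_def using m_low m2_up L U by (intro frac_le) auto
    also have "\<dots> \<le> A" using U by (simp add: A_def)
    finally have A0: "A0 \<le> A" .
    have "stable_density \<beta> (0::'a) * gaussian A x \<le> stable_density \<beta> (0::'a) * gaussian A0 x"
      using A0 less_imp_le[OF stable_density_0_pos[OF \<beta>0, where 'a='a]]
      by (intro mult_left_mono) (auto intro: mult_right_mono)
    also have "\<dots> \<le> stable_density \<beta> x" unfolding A0_def by (rule stable_density_ratio_ge[OF \<beta>0 \<beta>(2)])
    finally show ?thesis using up by simp
  qed
  with A show ?thesis by blast
qed

lemma integrable_norm_powr_ball:
  "integrable lborel (\<lambda>x::'a::euclidean_space. indicator (ball 0 1) x * norm x powr (2 - real DIM('a)))"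
proof (rule integrableI_nonneg)
  let ?d = "real DIM('a)" and ?V = "unit_ball_vol (real DIM('a))"
  have "(\<integral>\<^sup>+x. ennreal (indicator (ball 0 1) x * norm (x::'a) powr (2 - ?d)) \<partial>lborel)
    = (\<integral>\<^sup>+x. ennreal (indicator {..<1} (norm (x::'a) powr 1) * (norm x powr 1) powr (2 - ?d)) \<partial>lborel)"
    by (intro nn_integral_cong) (auto split: split_indicator)
  also have "\<dots> = (\<integral>\<^sup>+u. ennreal (radial_weight DIM('a) 1 u) * ennreal (indicator {..<1} u * u powr (2 - ?d)) \<partial>lborel)"
    by (rule nn_integral_radial) auto
  also have "\<dots> \<le> (\<integral>\<^sup>+u. ennreal (?V * ?d) * indicator {0..1::real} u \<partial>lborel)"
  proof (rule nn_integral_mono)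
    fix u :: real
    have "u powr (?d - 1) * u powr (2 - ?d) \<le> 1" if "0 \<le> u" "u < 1"
      using that by (simp flip: powr_add)
    then show "ennreal (radial_weight DIM('a) 1 u) * ennreal (indicator {..<1} u * u powr (2 - ?d))
        \<le> ennreal (?V * ?d) * indicator {0..1::real} u"
      by (auto simp: ennreal_mult'[symmetric] ennreal_mult''[symmetric] mult.assoc intro!: ennreal_leI mult_left_le mult_left_mono split: split_indicator)
  qed
  also have "\<dots> = ennreal (?V * ?d)" by (subst nn_integral_cmult_indicator) auto
  also have "\<dots> < \<infinity>" by simp
  finally show "(\<integral>\<^sup>+x. ennreal (indicator (ball 0 1) x * norm (x::'a) powr (2 - ?d)) \<partial>lborel) < \<infinity>" .
  show "(\<lambda>x::'a. indicator (ball 0 1) x * norm x powr (2 - ?d)) \<in> borel_measurable lborel"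
    by (intro borel_measurable_times borel_measurable_indicator) simp_all
qed auto

lemma integrable_norm_powr_outside_ball:
  "integrable lborel (\<lambda>x::'a::euclidean_space. indicator (- ball 0 1) x * norm x powr (- real DIM('a) - 1 / 2))"
proof (rule integrableI_nonneg)
  let ?d = "real DIM('a)" and ?V = "unit_ball_vol (real DIM('a))"
  have "(\<integral>\<^sup>+x. ennreal (indicator (- ball 0 1) x * norm (x::'a) powr (- ?d - 1 / 2)) \<partial>lborel)
    = (\<integral>\<^sup>+x. ennreal (indicator {1..} (norm (x::'a) powr 1) * (norm x powr 1) powr (- ?d - 1 / 2)) \<partial>lborel)"
    by (intro nn_integral_cong) (auto split: split_indicator)
  also have "\<dots> = (\<integral>\<^sup>+u. ennreal (radial_weight DIM('a) 1 u) * ennreal (indicator {1..} u * u powr (- ?d - 1 / 2)) \<partial>lborel)"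
    by (rule nn_integral_radial) auto
  also have "\<dots> = (\<integral>\<^sup>+u. ennreal (?V * ?d) * ennreal (indicator {1..} u * u powr (- 3 / 2)) \<partial>lborel)"
  proof (intro nn_integral_cong)
    fix u :: real
    have "u powr (?d - 1) * u powr (- ?d - 1 / 2) = u powr (- 3 / 2)"
      by (simp flip: powr_add)
    then show "ennreal (radial_weight DIM('a) 1 u) * ennreal (indicator {1..} u * u powr (- ?d - 1 / 2))
        = ennreal (?V * ?d) * ennreal (indicator {1..} u * u powr (- 3 / 2))"
      by (simp add: ennreal_mult'[symmetric] ennreal_mult''[symmetric] mult.assoc split: split_indicator)
  qed
  also have "\<dots> = ennreal (?V * ?d) * (\<integral>\<^sup>+u. ennreal (indicator {1..} u * u powr (- 3 / 2)) \<partial>lborel)"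
    by (rule nn_integral_cmult) auto
  also have "(\<integral>\<^sup>+u. ennreal (indicator {1..} u * u powr (- 3 / 2)) \<partial>lborel) = ennreal (- (1 powr (- 3 / 2 + 1)) / (- 3 / 2 + 1))"
    by (rule nn_integral_has_integral_lebesgue[OF _ has_integral_powr_to_inf]) auto
  also have "ennreal (?V * ?d) * \<dots> < \<infinity>" by (simp add: ennreal_mult_less_top)
  finally show "(\<integral>\<^sup>+x. ennreal (indicator (- ball 0 1) x * norm (x::'a) powr (- ?d - 1 / 2)) \<partial>lborel) < \<infinity>" .
  show "(\<lambda>x::'a. indicator (- ball 0 1) x * norm x powr (- ?d - 1 / 2)) \<in> borel_measurable lborel"
    by (intro borel_measurable_times borel_measurable_indicator) simp_all
qed auto

section \<open>The fractional Laplacian of the stable density at the origin\<close>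

text \<open>By Tonelli the singular integral acts on each Fourier mode as multiplication by \<open>|\<xi>|^\<beta>/c\<close>. The two radial
integrals \<open>\<integral> |\<xi>|^\<beta> exp (-|\<xi>|^\<beta>)\<close> and \<open>\<integral> exp (-|\<xi>|^\<beta>)\<close> are Gamma values at \<open>d/\<beta> + 1\<close> and \<open>d/\<beta>\<close>, and their
quotient is \<open>d/\<beta>\<close>. This is the heat equation at \<open>x = 0\<close> for the self-similar kernel.\<close>

lemma frac_laplace_stable_density_origin:
  assumes \<beta>: "0 < \<beta>" "\<beta> < 2"
  shows "has_bochner_integral lborel
    (\<lambda>\<sigma>::'a::euclidean_space. 1 / norm \<sigma> powr (real DIM('a) + \<beta>) * (stable_density \<beta> (0::'a) - stable_density \<beta> \<sigma>))
    (real DIM('a) / \<beta> * stable_density \<beta> (0::'a) / frac_laplace_const \<beta> DIM('a))"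
proof (rule has_bochner_integral_nn_integral)
  let ?d = "real DIM('a)" and ?c = "frac_laplace_const \<beta> DIM('a)" and ?C = "(2 * pi) ^ DIM('a)"
  let ?m = "\<lambda>\<xi>::'a. stable_char \<beta> \<xi>"
  let ?w = "\<lambda>\<sigma>::'a. 1 / norm \<sigma> powr (?d + \<beta>)"
  let ?F = "\<lambda>(\<sigma>::'a) (\<xi>::'a). ennreal (?w \<sigma> * (1 - cos (\<sigma> \<bullet> \<xi>)) * (?m \<xi> / ?C))"
  have c: "?c > 0" using frac_laplace_const_pos[OF \<beta>] .
  have C: "?C > 0" by simp
  show "(\<lambda>\<sigma>::'a. ?w \<sigma> * (stable_density \<beta> (0::'a) - stable_density \<beta> \<sigma>)) \<in> borel_measurable lborel" by measurable
  show "AE \<sigma> in lborel. 0 \<le> ?w \<sigma> * (stable_density \<beta> (0::'a) - stable_density \<beta> \<sigma>)"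
    using stable_density_bounded[OF \<beta>(1), where 'a='a] by (intro AE_I2 mult_nonneg_nonneg) (auto simp: abs_le_iff)
  show "0 \<le> ?d / \<beta> * stable_density \<beta> (0::'a) / ?c"
    using \<beta> c stable_density_0_pos[OF \<beta>(1), where 'a='a] by simp
  have inner: "ennreal (?w \<sigma> * (stable_density \<beta> (0::'a) - stable_density \<beta> \<sigma>)) = (\<integral>\<^sup>+\<xi>. ?F \<sigma> \<xi> \<partial>lborel)" for \<sigma>
  proof -
    have ic: "integrable lborel (\<lambda>\<xi>. cos (\<xi> \<bullet> \<sigma>) * ?m \<xi>)"
      by (intro integrable_bounded_mult_exp_norm_powr) (use \<beta> in auto)
    note im = integrable_exp_norm_powr_0(1)[OF \<beta>(1), where 'a='a]
    have "(\<integral>\<^sup>+\<xi>. ?F \<sigma> \<xi> \<partial>lborel) = (\<integral>\<^sup>+\<xi>. ennreal (?w \<sigma> / ?C * (?m \<xi> - cos (\<xi> \<bullet> \<sigma>) * ?m \<xi>)) \<partial>lborel)"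
      by (intro nn_integral_cong) (simp add: algebra_simps diff_divide_distrib inner_commute)
    also have "\<dots> = ennreal (\<integral>\<xi>. ?w \<sigma> / ?C * (?m \<xi> - cos (\<xi> \<bullet> \<sigma>) * ?m \<xi>) \<partial>lborel)"
    proof (rule nn_integral_eq_integral)
      show "integrable lborel (\<lambda>\<xi>. ?w \<sigma> / ?C * (?m \<xi> - cos (\<xi> \<bullet> \<sigma>) * ?m \<xi>))"
        using ic im by (intro integrable_mult_right Bochner_Integration.integrable_diff)
      show "AE \<xi> in lborel. 0 \<le> ?w \<sigma> / ?C * (?m \<xi> - cos (\<xi> \<bullet> \<sigma>) * ?m \<xi>)"
        by (intro AE_I2 mult_nonneg_nonneg) (auto simp: mult_left_le_one_le)
    qed
    also have "(\<integral>\<xi>. ?w \<sigma> / ?C * (?m \<xi> - cos (\<xi> \<bullet> \<sigma>) * ?m \<xi>) \<partial>lborel)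
        = ?w \<sigma> / ?C * ((\<integral>\<xi>. ?m \<xi> \<partial>lborel) - (\<integral>\<xi>. cos (\<xi> \<bullet> \<sigma>) * ?m \<xi> \<partial>lborel))"
      unfolding integral_mult_right_zero by (subst Bochner_Integration.integral_diff[OF im ic]) simp
    also have "\<dots> = ?w \<sigma> * (stable_density \<beta> (0::'a) - stable_density \<beta> \<sigma>)"
      by (simp add: stable_density_def diff_divide_distrib right_diff_distrib)
    finally show ?thesis ..
  qed
  have outer: "(\<integral>\<^sup>+\<sigma>. ?F \<sigma> \<xi> \<partial>lborel) = ennreal (1 / (?C * ?c)) * ennreal ((norm \<xi> powr \<beta>) powr 1 * ?m \<xi>)" for \<xi>
  proof -
    have "(\<integral>\<^sup>+\<sigma>. ?F \<sigma> \<xi> \<partial>lborel) = (\<integral>\<^sup>+\<sigma>. ennreal (?m \<xi> / ?C) * ennreal (?w \<sigma> * (1 - cos (\<sigma> \<bullet> \<xi>))) \<partial>lborel)"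
      by (intro nn_integral_cong) (simp add: ennreal_mult'[symmetric] mult_ac)
    also have "\<dots> = ennreal (?m \<xi> / ?C) * ennreal (norm \<xi> powr \<beta> / ?c)"
      by (subst nn_integral_cmult) (measurable, simp only: frac_laplace_symbol[OF \<beta>])
    also have "\<dots> = ennreal (?m \<xi> / ?C * (norm \<xi> powr \<beta> / ?c))"
      by (rule ennreal_mult'[symmetric]) simp
    also have "?m \<xi> / ?C * (norm \<xi> powr \<beta> / ?c) = 1 / (?C * ?c) * ((norm \<xi> powr \<beta>) powr 1 * ?m \<xi>)" by simp
    also have "ennreal \<dots> = ennreal (1 / (?C * ?c)) * ennreal ((norm \<xi> powr \<beta>) powr 1 * ?m \<xi>)"
      by (rule ennreal_mult') (use c in simp)
    finally show ?thesis .
  qed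
  have "(\<integral>\<^sup>+\<sigma>. ennreal (?w \<sigma> * (stable_density \<beta> (0::'a) - stable_density \<beta> \<sigma>)) \<partial>lborel) = (\<integral>\<^sup>+\<sigma>. (\<integral>\<^sup>+\<xi>. ?F \<sigma> \<xi> \<partial>lborel) \<partial>lborel)"
    unfolding inner ..
  also have "\<dots> = (\<integral>\<^sup>+\<xi>. (\<integral>\<^sup>+\<sigma>. ?F \<sigma> \<xi> \<partial>lborel) \<partial>lborel)"
    by (rule lborel_pair.Fubini'[symmetric]) measurable
  also have "\<dots> = ennreal (1 / (?C * ?c)) * ennreal (unit_ball_vol ?d * (?d / \<beta>) * Gamma (?d / \<beta> + 1))"
    unfolding outer using nn_integral_exp_norm_powr[OF \<beta>(1), of 1, where 'a='a]
    by (subst nn_integral_cmult) auto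
  also have "\<dots> = ennreal (1 / (?C * ?c) * (unit_ball_vol ?d * (?d / \<beta>) * Gamma (?d / \<beta> + 1)))"
    by (rule ennreal_mult'[symmetric]) (use c in simp)
  also have "1 / (?C * ?c) * (unit_ball_vol ?d * (?d / \<beta>) * Gamma (?d / \<beta> + 1)) = ?d / \<beta> * stable_density \<beta> (0::'a) / ?c"
  proof -
    have pos: "?d / \<beta> > 0" using \<beta> by simp
    have "Gamma (?d / \<beta> + 1) = ?d / \<beta> * Gamma (?d / \<beta>)"
      using pos by (intro Gamma_plus1) (auto dest!: nonpos_Ints_nonpos)
    moreover have "stable_density \<beta> (0::'a) = unit_ball_vol ?d * (?d / \<beta>) * Gamma (?d / \<beta>) / ?C"
      using integrable_exp_norm_powr_0(2)[OF \<beta>(1), where 'a='a] by (simp add: stable_density_def)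
    ultimately show ?thesis by (simp add: mult_ac)
  qed
  finally show "(\<integral>\<^sup>+\<sigma>. ennreal (?w \<sigma> * (stable_density \<beta> (0::'a) - stable_density \<beta> \<sigma>)) \<partial>lborel) = ennreal (?d / \<beta> * stable_density \<beta> (0::'a) / ?c)" .
qed

section \<open>The Li--Yau constant\<close>

definition stable_log_defect :: "real \<Rightarrow> 'a::euclidean_space \<Rightarrow> real" where
  "stable_log_defect \<beta> \<sigma> = - ln (stable_density \<beta> \<sigma> / stable_density \<beta> (0::'a)) - 1 + stable_density \<beta> \<sigma> / stable_density \<beta> (0::'a)"

text \<open>The second-order bound serves near the origin, where \<open>r\<close> is close to \<open>1\<close>; the last one serves for small \<open>r\<close>.\<close>

lemma log_defect_bounds:
  fixes r :: real
  assumes r: "0 < r" "r \<le> 1"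
  shows "0 \<le> - ln r - 1 + r" and "- ln r - 1 + r \<le> (ln r)\<^sup>2 / 2" and "- ln r - 1 + r \<le> - ln r"
proof -
  show "0 \<le> - ln r - 1 + r" using ln_le_minus_one[OF r(1)] by simp
  have "exp (- (- ln r)) \<le> 1 - (- ln r) + (- ln r)\<^sup>2 / 2"
    using r by (intro exp_neg_le_quadratic) simp
  then show "- ln r - 1 + r \<le> (ln r)\<^sup>2 / 2" using r by simp
  show "- ln r - 1 + r \<le> - ln r" using r by simp
qed

lemma ln_le_two_sqrt:
  assumes "1 \<le> (s::real)"
  shows "ln s \<le> 2 * s powr (1 / 2)"
proof -
  have "ln (s powr (1 / 2)) \<le> s powr (1 / 2) - 1" using assms by (intro ln_le_minus_one) simp
  then show ?thesis using assms by (simp add: ln_powr)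
qed

text \<open>Only the region \<open>|\<sigma>| \<ge> 1\<close> produces the logarithm: there \<open>- ln r\<close> is at most a constant plus multiples of
\<open>- ln (2 - \<beta>)\<close> and \<open>ln |\<sigma>|\<close>, by the tail bound. Both comparison functions \<open>i1\<close> and \<open>i2\<close> are independent of \<open>\<beta>\<close>.\<close>

lemma stable_density_log_defect:
  "\<exists>K>0. \<forall>\<beta>. 1 \<le> \<beta> \<and> \<beta> < 2 \<longrightarrow>
    integrable lborel (\<lambda>\<sigma>::'a::euclidean_space. 1 / norm \<sigma> powr (real DIM('a) + \<beta>) * stable_log_defect \<beta> \<sigma>)
    \<and> (\<integral>\<sigma>. 1 / norm (\<sigma>::'a) powr (real DIM('a) + \<beta>) * stable_log_defect \<beta> \<sigma> \<partial>lborel)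
      \<le> K * ln (exp 1 / (2 - \<beta>))"
proof -
  define d where "d = DIM('a)"
  obtain A where A: "A > 0"
    "\<And>\<beta> x. 1 \<le> \<beta> \<Longrightarrow> \<beta> < 2 \<Longrightarrow> stable_density \<beta> (0::'a) \<le> A"
    "\<And>\<beta> x. 1 \<le> \<beta> \<Longrightarrow> \<beta> < 2 \<Longrightarrow> stable_density \<beta> (0::'a) * gaussian A x \<le> stable_density \<beta> (x::'a)"
    using stable_density_uniform_bounds[where 'a='a] by auto
  obtain c where c: "c > 0"
    "\<And>\<beta> x. 1 \<le> \<beta> \<Longrightarrow> \<beta> < 2 \<Longrightarrow> 1 \<le> norm x \<Longrightarrow> c * (2 - \<beta>) ^ (d + 3) / norm x ^ (2 * d + 4) \<le> stable_density \<beta> (x::'a)"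
    using stable_density_tail_ge[where 'a='a] unfolding d_def by auto
  define i1 where "i1 = (\<lambda>x::'a. indicator (ball 0 1) x * norm x powr (2 - real d))"
  define i2 where "i2 = (\<lambda>x::'a. indicator (- ball 0 1) x * norm x powr (- real d - 1 / 2))"
  have i: "integrable lborel i1" "integrable lborel i2"
    using integrable_norm_powr_ball[where 'a='a] integrable_norm_powr_outside_ball[where 'a='a] by (simp_all add: i1_def i2_def d_def)
  have i_nn: "0 \<le> i1 x" "0 \<le> i2 x" for x by (auto simp: i1_def i2_def)
  define K0 where "K0 = \<bar>ln (A / c)\<bar> + (real d + 3) + 2 * (2 * real d + 4)"
  have K0: "K0 \<ge> 0" by (simp add: K0_def)
  define K where "K = A\<^sup>2 / 2 * integral\<^sup>L lborel i1 + K0 * integral\<^sup>L lborel i2 + 1"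
  have I: "0 \<le> integral\<^sup>L lborel i1" "0 \<le> integral\<^sup>L lborel i2" using i_nn by (auto intro: integral_nonneg_AE)
  have K: "K > 0" unfolding K_def using I K0 by (intro add_nonneg_pos add_nonneg_nonneg mult_nonneg_nonneg) auto
  have "integrable lborel (\<lambda>\<sigma>::'a. 1 / norm \<sigma> powr (real d + \<beta>) * stable_log_defect \<beta> \<sigma>)
    \<and> (\<integral>\<sigma>. 1 / norm (\<sigma>::'a) powr (real d + \<beta>) * stable_log_defect \<beta> \<sigma> \<partial>lborel)
      \<le> K * ln (exp 1 / (2 - \<beta>))" if \<beta>: "1 \<le> \<beta>" "\<beta> < 2" for \<beta>
  proof -
    have \<beta>0: "0 < \<beta>" using \<beta> by simp
    define r where "r = (\<lambda>\<sigma>::'a. stable_density \<beta> \<sigma> / stable_density \<beta> (0::'a))"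
    define g where "g = (\<lambda>\<sigma>. - ln (r \<sigma>) - 1 + r \<sigma>)"
    define w where "w = (\<lambda>\<sigma>::'a. 1 / norm \<sigma> powr (real d + \<beta>))"
    define L where "L = ln (exp 1 / (2 - \<beta>))"
    have L: "L = 1 - ln (2 - \<beta>)" "1 \<le> L"
      using \<beta> by (auto simp: L_def ln_div)
    have pos: "stable_density \<beta> (x::'a) > 0" for x using stable_density_pos[OF \<beta>0 \<beta>(2)] .
    have r: "0 < r x" "r x \<le> 1" for x
      using pos[of x] pos[of 0] stable_density_bounded[OF \<beta>0, of x] by (auto simp: r_def)
    have g_nn: "0 \<le> g x" for x unfolding g_def by (rule log_defect_bounds(1)[OF r])
    have w_nn: "0 \<le> w x" for x by (simp add: w_def)
    have wm[measurable]: "w \<in> borel_measurable borel" "g \<in> borel_measurable borel"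
      unfolding w_def g_def r_def by measurable
    have bound: "w x * g x \<le> A\<^sup>2 / 2 * i1 x + K0 * L * i2 x" for x
    proof (cases "x = 0")
      case True
      then show ?thesis using i_nn[of x] K0 L by (simp add: w_def)
    next
      case False
      then have nx: "norm x > 0" by simp
      show ?thesis
      proof (cases "norm x < 1")
        case True
        have "gaussian A x \<le> r x"
          using A(3)[OF \<beta>, of x] pos[of 0] by (simp add: r_def pos_le_divide_eq mult.commute)
        then have "- A * (norm x)\<^sup>2 \<le> ln (r x)" using r[of x] by (simp add: ln_ge_iff)
        moreover have "ln (r x) \<le> 0" using r[of x] by simp
        ultimately have "\<bar>ln (r x)\<bar> \<le> \<bar>A * (norm x)\<^sup>2\<bar>" by linarith
        then have "(ln (r x))\<^sup>2 \<le> (A * (norm x)\<^sup>2)\<^sup>2" by (simp only: abs_le_square_iff)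
        then have "g x \<le> (A * (norm x)\<^sup>2)\<^sup>2 / 2"
          using log_defect_bounds(2)[OF r, of x] unfolding g_def by linarith
        then have "w x * g x \<le> w x * ((A * (norm x)\<^sup>2)\<^sup>2 / 2)" by (intro mult_left_mono w_nn)
        also have "\<dots> = A\<^sup>2 / 2 * norm x powr (4 - real d - \<beta>)"
        proof -
          have "((norm x)\<^sup>2)\<^sup>2 = norm x powr 4" using nx by simp
          moreover have "norm x powr (4 - real d - \<beta>) = norm x powr 4 / norm x powr (real d + \<beta>)"
            by (simp add: powr_diff powr_add)
          ultimately show ?thesis by (simp add: w_def power_mult_distrib)
        qed
        also have "\<dots> \<le> A\<^sup>2 / 2 * norm x powr (2 - real d)"
          using True nx \<beta> by (intro mult_left_mono powr_mono') auto
        also have "\<dots> = A\<^sup>2 / 2 * i1 x" using True by (simp add: i1_def)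
        finally show ?thesis using i_nn[of x] K0 L by (simp add: add_increasing2)
      next
        case False
        then have x1: "1 \<le> norm x" by simp
        let ?s = "norm x powr (1 / 2)"
        have s1: "1 \<le> ?s" using x1 by (intro ge_one_powr_ge_zero) auto
        define lo where "lo = c * (2 - \<beta>) ^ (d + 3) / norm x ^ (2 * d + 4)"
        have lo: "lo > 0" "lo \<le> stable_density \<beta> x" using c(1) c(2)[OF \<beta> x1] \<beta> nx by (simp_all add: lo_def)
        have "lo / A \<le> r x" unfolding r_def using lo A pos[of 0] A(2)[OF \<beta>] by (intro frac_le) auto
        then have "ln (lo / A) \<le> ln (r x)" using lo A(1) by (intro ln_mono) auto
        moreover have "ln (lo / A) = - ln (A / c) + (real d + 3) * ln (2 - \<beta>) - (2 * real d + 4) * ln (norm x)"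
          using c(1) A(1) \<beta> nx by (simp add: lo_def ln_div ln_mult ln_realpow)
        ultimately have "g x \<le> ln (A / c) - (real d + 3) * ln (2 - \<beta>) + (2 * real d + 4) * ln (norm x)"
          using log_defect_bounds(3)[OF r, of x] unfolding g_def by linarith
        also have "\<dots> \<le> \<bar>ln (A / c)\<bar> * (L * ?s) + (real d + 3) * (L * ?s) + (2 * real d + 4) * (2 * (L * ?s))"
        proof (intro add_mono)
          have Ls: "1 \<le> L * ?s" using L(2) s1 mult_mono[of 1 L 1 ?s] by simp
          have "\<bar>ln (A / c)\<bar> * 1 \<le> \<bar>ln (A / c)\<bar> * (L * ?s)" using Ls by (intro mult_left_mono) auto
          then have a1: "ln (A / c) \<le> \<bar>ln (A / c)\<bar> * (L * ?s)" by linarith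
          have "- ln (2 - \<beta>) \<le> L * 1" using L(1) by simp
          also have "\<dots> \<le> L * ?s" using s1 L(2) by (intro mult_left_mono) auto
          finally have "(real d + 3) * (- ln (2 - \<beta>)) \<le> (real d + 3) * (L * ?s)" by (intro mult_left_mono) auto
          then show "ln (A / c) - (real d + 3) * ln (2 - \<beta>) \<le> \<bar>ln (A / c)\<bar> * (L * ?s) + (real d + 3) * (L * ?s)"
            using a1 by simp
          have "ln (norm x) \<le> 2 * (1 * ?s)" using ln_le_two_sqrt[OF x1] by simp
          also have "\<dots> \<le> 2 * (L * ?s)" using L(2) by (intro mult_left_mono mult_right_mono) auto
          finally show "(2 * real d + 4) * ln (norm x) \<le> (2 * real d + 4) * (2 * (L * ?s))" by (intro mult_left_mono) auto
        qed
        also have "\<dots> = K0 * L * ?s" by (simp add: K0_def algebra_simps)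
        finally have "w x * g x \<le> w x * (K0 * L * ?s)" by (intro mult_left_mono w_nn)
        also have "\<dots> = K0 * L * norm x powr (1 / 2 - real d - \<beta>)"
          by (simp add: w_def powr_diff powr_add)
        also have "\<dots> \<le> K0 * L * norm x powr (- real d - 1 / 2)"
          using x1 \<beta> K0 L(2) by (intro mult_left_mono powr_mono mult_nonneg_nonneg) auto
        also have "\<dots> = K0 * L * i2 x" using False by (simp add: i2_def)
        finally show ?thesis using i_nn(1)[of x] by (simp add: add_increasing)
      qed
    qed
    have Bi: "integrable lborel (\<lambda>x. A\<^sup>2 / 2 * i1 x + K0 * L * i2 x)" using i by simp
    have gi: "integrable lborel (\<lambda>x. w x * g x)"
    proof (rule Bochner_Integration.integrable_bound[OF Bi])
      show "AE x in lborel. norm (w x * g x) \<le> norm (A\<^sup>2 / 2 * i1 x + K0 * L * i2 x)"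
      proof (rule AE_I2)
        fix x
        have "norm (w x * g x) = w x * g x" using w_nn[of x] g_nn[of x] by simp
        with bound[of x] show "norm (w x * g x) \<le> norm (A\<^sup>2 / 2 * i1 x + K0 * L * i2 x)" by simp
      qed
    qed measurable
    have "(\<integral>x. w x * g x \<partial>lborel) \<le> (\<integral>x. A\<^sup>2 / 2 * i1 x + K0 * L * i2 x \<partial>lborel)"
      by (intro integral_mono gi Bi bound)
    also have "\<dots> = A\<^sup>2 / 2 * integral\<^sup>L lborel i1 * 1 + K0 * integral\<^sup>L lborel i2 * L" using i by simp
    also have "\<dots> \<le> A\<^sup>2 / 2 * integral\<^sup>L lborel i1 * L + K0 * integral\<^sup>L lborel i2 * L"
      using I L(2) by (intro add_right_mono mult_left_mono) auto
    also have "\<dots> \<le> K * L" using L(2) by (simp add: K_def algebra_simps)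
    finally show ?thesis using gi unfolding w_def g_def r_def L_def stable_log_defect_def by simp
  qed
  with K show ?thesis unfolding d_def by blast
qed

text \<open>This is the pointwise maximality of the origin. The auxiliary point \<open>w\<close> has squared norm \<open>|y|^2 + |\<sigma>|^2\<close>, the mean of
\<open>|y + \<sigma>|^2\<close> and \<open>|y - \<sigma>|^2\<close> by the parallelogram law.\<close>

lemma stable_density_log_ratio_le:
  fixes y \<sigma> :: "'a::euclidean_space"
  assumes \<beta>: "0 < \<beta>" "\<beta> < 2"
  shows "ln ((stable_density \<beta> y)\<^sup>2 / (stable_density \<beta> (y + \<sigma>) * stable_density \<beta> (y - \<sigma>)))
    \<le> - 2 * ln (stable_density \<beta> \<sigma> / stable_density \<beta> (0::'a))"
proof -
  let ?f = "stable_density \<beta> :: 'a \<Rightarrow> real"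
  have pos: "?f x > 0" for x using stable_density_pos[OF \<beta>] .
  obtain w :: 'a where w: "norm w = sqrt ((norm y)\<^sup>2 + (norm \<sigma>)\<^sup>2)"
    using exists_norm[of "sqrt ((norm y)\<^sup>2 + (norm \<sigma>)\<^sup>2)"] by auto
  then have w2: "(norm w)\<^sup>2 = (norm y)\<^sup>2 + (norm \<sigma>)\<^sup>2" by simp
  have "2 * (norm w)\<^sup>2 = (norm (y + \<sigma>))\<^sup>2 + (norm (y - \<sigma>))\<^sup>2"
  proof -
    have "(norm (y + \<sigma>))\<^sup>2 + (norm (y - \<sigma>))\<^sup>2 = 2 * ((norm y)\<^sup>2 + (norm \<sigma>)\<^sup>2)"
      by (simp add: power2_norm_eq_inner inner_simps inner_commute)
    then show ?thesis using w2 by simp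
  qed
  then have 1: "(?f w)\<^sup>2 \<le> ?f (y + \<sigma>) * ?f (y - \<sigma>)"
    by (rule stable_density_parallelogram[OF \<beta>])
  have "?f y * ?f \<sigma> \<le> ?f 0 * ?f w" by (rule stable_density_supermultiplicative[OF \<beta> w2])
  then have "(?f y * ?f \<sigma>)\<^sup>2 \<le> (?f 0 * ?f w)\<^sup>2" using pos by (intro power_mono) (auto intro: less_imp_le)
  also have "\<dots> \<le> (?f 0)\<^sup>2 * (?f (y + \<sigma>) * ?f (y - \<sigma>))"
    unfolding power_mult_distrib using 1 by (intro mult_left_mono) auto
  finally have "(?f y)\<^sup>2 / (?f (y + \<sigma>) * ?f (y - \<sigma>)) \<le> (?f 0)\<^sup>2 / (?f \<sigma>)\<^sup>2"
    using pos[of "y + \<sigma>"] pos[of "y - \<sigma>"] pos[of \<sigma>] by (simp add: divide_simps power_mult_distrib mult_ac)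
  then have "ln ((?f y)\<^sup>2 / (?f (y + \<sigma>) * ?f (y - \<sigma>))) \<le> ln ((?f 0)\<^sup>2 / (?f \<sigma>)\<^sup>2)"
    by (intro ln_mono divide_pos_pos mult_pos_pos zero_less_power pos)
  also have "\<dots> = - 2 * ln (?f \<sigma> / ?f 0)"
    using pos[of 0] pos[of \<sigma>] by (simp add: ln_div ln_realpow)
  finally show ?thesis .
qed

text \<open>Integrating the pointwise bound shows that the supremum is the value at \<open>y = 0\<close>, which splits into the linear part
\<open>d/\<beta>\<close> and the integrated defect.\<close>

lemma li_yau_const_eq:
  assumes \<beta>: "0 < \<beta>" "\<beta> < 2"
    and int: "integrable lborel (\<lambda>\<sigma>::real ^ 'n. 1 / norm \<sigma> powr (real CARD('n) + \<beta>) * stable_log_defect \<beta> \<sigma>)"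
  shows "li_yau_const TYPE('n) \<beta> = ereal (real CARD('n) / \<beta> + frac_laplace_const \<beta> CARD('n) *
      (\<integral>\<sigma>. 1 / norm (\<sigma>::real ^ 'n) powr (real CARD('n) + \<beta>) * stable_log_defect \<beta> \<sigma> \<partial>lborel))"
proof -
  let ?f = "stable_density \<beta> :: real ^ 'n \<Rightarrow> real"
  let ?c = "frac_laplace_const \<beta> CARD('n)"
  define w where "w = (\<lambda>\<sigma>::real ^ 'n. 1 / norm \<sigma> powr (real CARD('n) + \<beta>))"
  define r where "r = (\<lambda>\<sigma>. ?f \<sigma> / ?f 0)"
  define G where "G = (\<integral>\<sigma>. w \<sigma> * (- ln (r \<sigma>) - 1 + r \<sigma>) \<partial>lborel)"
  define I where "I = (\<lambda>y. \<integral>\<sigma>. w \<sigma> * ln ((?f y)\<^sup>2 / (?f (y + \<sigma>) * ?f (y - \<sigma>))) \<partial>lborel)"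
  have c: "?c > 0" using frac_laplace_const_pos[OF \<beta>] .
  have pos: "?f x > 0" for x using stable_density_pos[OF \<beta>] .
  have sym: "?f (- x) = ?f x" for x by (simp add: stable_density_def)
  have w_nn: "w x \<ge> 0" for x by (simp add: w_def)
  have int_G: "integrable lborel (\<lambda>\<sigma>. w \<sigma> * (- ln (r \<sigma>) - 1 + r \<sigma>))" using int by (simp add: w_def r_def stable_log_defect_def)
  have lin: "has_bochner_integral lborel (\<lambda>\<sigma>. w \<sigma> * (1 - r \<sigma>)) (real CARD('n) / \<beta> / ?c)"
  proof -
    have "has_bochner_integral lborel (\<lambda>\<sigma>. w \<sigma> * (?f 0 - ?f \<sigma>) / ?f 0) (real CARD('n) / \<beta> * ?f 0 / ?c / ?f 0)"
      using frac_laplace_stable_density_origin[OF \<beta>, where 'a="real ^ 'n"]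
      by (intro has_bochner_integral_divide) (simp add: w_def)
    moreover have "w \<sigma> * (?f 0 - ?f \<sigma>) / ?f 0 = w \<sigma> * (1 - r \<sigma>)" for \<sigma>
      using pos[of 0] by (simp add: r_def diff_divide_distrib right_diff_distrib)
    ultimately show ?thesis using pos[of 0] by simp
  qed
  have dec: "w \<sigma> * (- 2 * ln (r \<sigma>)) = 2 * (w \<sigma> * (1 - r \<sigma>) + w \<sigma> * (- ln (r \<sigma>) - 1 + r \<sigma>))" for \<sigma>
    by (simp add: algebra_simps)
  have int2: "integrable lborel (\<lambda>\<sigma>. w \<sigma> * (- 2 * ln (r \<sigma>)))"
    unfolding dec using lin int_G by (intro integrable_mult_right Bochner_Integration.integrable_add) (auto simp: has_bochner_integral_iff)
  have val2: "(\<integral>\<sigma>. w \<sigma> * (- 2 * ln (r \<sigma>)) \<partial>lborel) = 2 * (real CARD('n) / \<beta> / ?c + G)"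
    unfolding dec G_def integral_mult_right_zero
    using lin int_G by (subst Bochner_Integration.integral_add) (auto simp: has_bochner_integral_iff)
  have I0: "I 0 = 2 * (real CARD('n) / \<beta> / ?c + G)"
  proof -
    have "ln ((?f 0)\<^sup>2 / (?f (0 + \<sigma>) * ?f (0 - \<sigma>))) = - 2 * ln (r \<sigma>)" for \<sigma>
      using pos[of 0] pos[of \<sigma>] sym[of \<sigma>] by (simp add: r_def ln_div ln_mult ln_realpow)
    then show ?thesis unfolding I_def val2[symmetric] by simp
  qed
  have G_nn: "G \<ge> 0"
  proof -
    have "0 \<le> - ln (r \<sigma>) - 1 + r \<sigma>" for \<sigma>
      using pos[of 0] pos[of \<sigma>] ln_le_minus_one[of "r \<sigma>"] by (simp add: r_def)
    then show ?thesis unfolding G_def using w_nn by (intro integral_nonneg_AE AE_I2 mult_nonneg_nonneg)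
  qed
  have I_le: "I y \<le> I 0" for y
  proof (cases "integrable lborel (\<lambda>\<sigma>. w \<sigma> * ln ((?f y)\<^sup>2 / (?f (y + \<sigma>) * ?f (y - \<sigma>))))")
    case True
    have "I y \<le> (\<integral>\<sigma>. w \<sigma> * (- 2 * ln (r \<sigma>)) \<partial>lborel)"
      unfolding I_def r_def
      by (rule integral_mono[OF True int2[unfolded r_def]])
        (intro mult_left_mono w_nn stable_density_log_ratio_le[OF \<beta>])
    then show ?thesis using I0 val2 by simp
  next
    case False
    \<comment> \<open>a divergent integral has the default value \<open>0\<close>, which is below the value at the origin\<close>
    then have "I y = 0" unfolding I_def by (rule not_integrable_integral_eq)
    then show ?thesis using I0 G_nn c \<beta> by simp
  qed
  have "li_yau_const TYPE('n) \<beta> = ereal (?c / 2) * (SUP y. ereal (I y))"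
    unfolding li_yau_const_def heat_profile_eq_stable_density[OF \<beta>] I_def w_def ..
  also have "(SUP y. ereal (I y)) = ereal (I 0)"
    by (intro antisym SUP_least SUP_upper) (auto simp: I_le)
  also have "ereal (?c / 2) * ereal (I 0) = ereal (real CARD('n) / \<beta> + ?c * G)"
    using c by (simp add: I0 distrib_left)
  finally show ?thesis by (simp add: G_def w_def r_def stable_log_defect_def)
qed

text \<open>If the integral vanished, the defect would vanish almost everywhere, so \<open>\<Phi>\<close> would equal \<open>\<Phi> 0\<close> almost everywhere
and its fractional Laplacian at the origin would be \<open>0\<close> instead of a positive multiple of \<open>d/\<beta>\<close>.\<close>

lemma stable_density_log_defect_pos:
  assumes \<beta>: "0 < \<beta>" "\<beta> < 2"
    and int: "integrable lborel (\<lambda>\<sigma>::'a::euclidean_space. 1 / norm \<sigma> powr (real DIM('a) + \<beta>) * stable_log_defect \<beta> \<sigma>)"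
  shows "0 < (\<integral>\<sigma>. 1 / norm (\<sigma>::'a) powr (real DIM('a) + \<beta>) * stable_log_defect \<beta> \<sigma> \<partial>lborel)"
    (is "0 < integral\<^sup>L lborel ?h")
proof -
  let ?f = "stable_density \<beta> :: 'a \<Rightarrow> real"
  have pos: "?f x > 0" for x using stable_density_pos[OF \<beta>] .
  have h_nn: "0 \<le> ?h \<sigma>" for \<sigma>
    using pos[of 0] pos[of \<sigma>] ln_le_minus_one[of "?f \<sigma> / ?f 0"]
    unfolding stable_log_defect_def by (intro mult_nonneg_nonneg) auto
  have "integral\<^sup>L lborel ?h \<noteq> 0"
  proof
    assume "integral\<^sup>L lborel ?h = 0"
    then have "AE \<sigma> in lborel. ?h \<sigma> = 0"
      using integral_nonneg_eq_0_iff_AE[OF int] h_nn by simp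
    then have "AE \<sigma> in lborel. 1 / norm \<sigma> powr (real DIM('a) + \<beta>) * (?f 0 - ?f \<sigma>) = 0"
    proof eventually_elim
      case (elim \<sigma>)
      show ?case
      proof (cases "\<sigma> = 0")
        case False
        then have "ln (?f \<sigma> / ?f 0) = ?f \<sigma> / ?f 0 - 1" using elim by (simp add: stable_log_defect_def)
        then have "?f \<sigma> / ?f 0 = 1" using pos by (intro ln_eq_minus_one) simp_all
        then show ?thesis using pos[of 0] by simp
      qed simp
    qed
    then have "(\<integral>\<sigma>. 1 / norm \<sigma> powr (real DIM('a) + \<beta>) * (?f 0 - ?f \<sigma>) \<partial>lborel) = 0"
      by (rule integral_eq_zero_AE)
    then have "real DIM('a) / \<beta> * ?f 0 / frac_laplace_const \<beta> DIM('a) = 0"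
      using has_bochner_integral_integral_eq[OF frac_laplace_stable_density_origin[OF \<beta>, where 'a='a]] by simp
    then show False using pos[of 0] frac_laplace_const_pos[OF \<beta>, of "DIM('a)"] \<beta> by simp
  qed
  moreover have "0 \<le> integral\<^sup>L lborel ?h" using h_nn by (intro integral_nonneg_AE AE_I2)
  ultimately show ?thesis by simp
qed

theorem theorem1p1:
  shows "(li_yau_const TYPE('n::finite) \<longlongrightarrow> ereal (real CARD('n) / 2)) (at_left 2) \<and>
    (\<exists>K>0. \<forall>\<beta>::real. 1 \<le> \<beta> \<and> \<beta> < 2 \<longrightarrow>
       ereal (real CARD('n) / \<beta>) < li_yau_const TYPE('n) \<beta> \<and>
       li_yau_const TYPE('n) \<beta>
         \<le> ereal (real CARD('n) / \<beta> + K * (2 - \<beta>) * ln (exp 1 / (2 - \<beta>))))"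
proof -
  let ?G = "\<lambda>\<beta>. \<integral>\<sigma>. 1 / norm (\<sigma>::real ^ 'n) powr (real CARD('n) + \<beta>) * stable_log_defect \<beta> \<sigma> \<partial>lborel"
  obtain C where C: "C > 0" "\<And>\<beta>. 1 \<le> \<beta> \<Longrightarrow> \<beta> < 2 \<Longrightarrow> frac_laplace_const \<beta> CARD('n) \<le> C * (2 - \<beta>)"
    using frac_laplace_const_le[of "CARD('n)"] by auto
  obtain K where K: "K > 0"
    "\<And>\<beta>. 1 \<le> \<beta> \<Longrightarrow> \<beta> < 2 \<Longrightarrow> integrable lborel (\<lambda>\<sigma>::real ^ 'n. 1 / norm \<sigma> powr (real CARD('n) + \<beta>) * stable_log_defect \<beta> \<sigma>)"
    "\<And>\<beta>. 1 \<le> \<beta> \<Longrightarrow> \<beta> < 2 \<Longrightarrow> ?G \<beta> \<le> K * ln (exp 1 / (2 - \<beta>))"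
    using stable_density_log_defect[where 'a="real ^ 'n"] by auto
  have bounds: "ereal (real CARD('n) / \<beta>) < li_yau_const TYPE('n) \<beta> \<and>
      li_yau_const TYPE('n) \<beta> \<le> ereal (real CARD('n) / \<beta> + C * K * (2 - \<beta>) * ln (exp 1 / (2 - \<beta>)))"
    if \<beta>: "1 \<le> \<beta>" "\<beta> < 2" for \<beta>
  proof -
    have \<beta>0: "0 < \<beta>" using \<beta> by simp
    let ?c = "frac_laplace_const \<beta> CARD('n)"
    have c: "?c > 0" using frac_laplace_const_pos[OF \<beta>0 \<beta>(2)] .
    have G: "?G \<beta> > 0"
      using stable_density_log_defect_pos[OF \<beta>0 \<beta>(2), where 'a="real ^ 'n"] K(2)[OF \<beta>] by simp
    have "?c * ?G \<beta> \<le> (C * (2 - \<beta>)) * (K * ln (exp 1 / (2 - \<beta>)))"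
      using C(2)[OF \<beta>] K(3)[OF \<beta>] c G C(1) \<beta> by (intro mult_mono) auto
    moreover have "0 < ?c * ?G \<beta>" using c G by simp
    ultimately show ?thesis
      unfolding li_yau_const_eq[OF \<beta>0 \<beta>(2) K(2)[OF \<beta>]] by (simp add: mult_ac)
  qed
  have "(li_yau_const TYPE('n) \<longlongrightarrow> ereal (real CARD('n) / 2)) (at_left 2)"
  proof (rule tendsto_sandwich)
    have ev: "\<forall>\<^sub>F \<beta> in at_left (2::real). 1 \<le> \<beta> \<and> \<beta> < 2"
      unfolding eventually_at_left_field by (intro exI[of _ 1]) auto
    show "\<forall>\<^sub>F \<beta> in at_left 2. ereal (real CARD('n) / \<beta>) \<le> li_yau_const TYPE('n) \<beta>"
      using ev by eventually_elim (use bounds in \<open>auto intro: less_imp_le\<close>)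
    show "\<forall>\<^sub>F \<beta> in at_left 2. li_yau_const TYPE('n) \<beta> \<le> ereal (real CARD('n) / \<beta> + C * K * (2 - \<beta>) * ln (exp 1 / (2 - \<beta>)))"
      using ev by eventually_elim (use bounds in auto)
    have "((\<lambda>\<beta>. d / \<beta>) \<longlongrightarrow> d / 2) (at_left 2)" for d :: real by (intro tendsto_intros) auto
    then show "((\<lambda>\<beta>. ereal (real CARD('n) / \<beta>)) \<longlongrightarrow> ereal (real CARD('n) / 2)) (at_left 2)"
      by (intro tendsto_ereal)
    have "((\<lambda>\<beta>. d / \<beta> + k * (2 - \<beta>) * ln (exp 1 / (2 - \<beta>))) \<longlongrightarrow> d / 2) (at_left 2)" for d k :: real
      by real_asymp
    then show "((\<lambda>\<beta>. ereal (real CARD('n) / \<beta> + C * K * (2 - \<beta>) * ln (exp 1 / (2 - \<beta>)))) \<longlongrightarrow> ereal (real CARD('n) / 2)) (at_left 2)"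
      by (intro tendsto_ereal)
  qed
  moreover have "C * K > 0" using C(1) K(1) by simp
  ultimately show ?thesis using bounds by blast
qed

end
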